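(* Let $n=1$, let $\Omega\subset\mathbb{R}$ be a bounded open interval, let $p>1$ and $w\in L^2(\Omega)$. Then, for all $L>1$ there exists $\bar k(L)\in\mathbb{N}$ such that $$\{T\in\mathcal{C}_L(P_k,\overline\Omega): T(P_k)=\overline\Omega\}\neq\emptyset\qquad\forall k\ge\bar k(L).$$ Moreover, $$\lim_{k\to\infty}\mathcal{L}(T^L_k)=1\qquad\forall L>1 .$$
   Context: Energy: $E(u)=\frac12\int_\Omega|u'|^2dx-\frac1{p+1}\int_\Omega|u|^{p+1}dx-\int_\Omega wu\,dx$ on $H^1_0(\Omega)$; for open $U\subset\Omega$, functions in $H^1_0(U)$ are extended by $0$ to $\Omega$. Cells: $C_0=\,]0,1[$, $C_z=z+C_0$ and $\sigma(z)=(-1)^{z}$ for $z\in\mathbb{Z}$; for $k\in\mathbb{N}$, $Z_k=\{z\in\mathbb{Z}:\frac1kC_z\subset\Omega\}$ and $P_k=\bigcup_{z\in Z_k}\frac1k\overline{C}_z$. Fix $k_\Omega\in\mathbb{N}$ with $Z_k\ne\emptyset$ for all $k\ge k_\Omega$. Maps: for $L\ge1$ and $P,Q\subset\mathbb{R}$, $\mathcal{C}_L(P,Q)$ is the set of $T:P\to Q$ with $\frac1L|x-y|\le|T(x)-T(y)|\le L|x-y|$ for all $x,y\in P$. For $T\in\mathcal{C}_L(P_k,\overline\Omega)$, $\mathcal{L}(T)=\inf\{\ell\ge1:\frac1\ell|x-y|\le|T(x)-T(y)|\le \ell|x-y|\ \forall x,y\in P_k\}$. The functions $\tilde u^T_{k,z}$: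 for every $L\ge1$ there is (and we fix) $k(L)\ge k_\Omega$ such that for all $k\ge k(L)$, $z\in Z_k$, $T\in\mathcal{C}_L(P_k,\overline\Omega)$, the minimum of $E(u)$ over $u\in H^1_0(T(\frac1kC_z))$ with $\int_{T(\frac1kC_z)}|u|^{p+1}dx<1$ is achieved by a unique function $\tilde u^T_{k,z}$. The functions $u^T_{k,z}$: for such $k,z,T$ and $u\in H^1_0(T(\frac1kC_z))$ set $M(u)=\max\{E(\tilde u^T_{k,z}+t(u-\tilde u^T_{k,z})):t\ge0\}$. There exists (and we fix one) $u^T_{k,z}\in H^1_0(T(\frac1kC_z))$ with $u^T_{k,z}\not\equiv\tilde u^T_{k,z}$, $\sigma(z)[u^T_{k,z}-\tilde u^T_{k,z}]\ge0$ in $T(\frac1kC_z)$ and $E(u^T_{k,z})=M(u^T_{k,z})=\min\{M(u): u\in H^1_0(T(\frac1kC_z)),\ u\not\equiv\tilde u^T_{k,z},\ \sigma(z)[u-\tilde u^T_{k,z}]\ge0 \text{ in }T(\frac1kC_z)\}$. The maps $T^L_k$: for $L\ge 1$ and $k\ge k(L)$ such that $\{T\in\mathcal{C}_L(P_k,\overline\Omega):T(P_k)=\overline\Omega\}\ne\emptyset$, let $\widetilde T^L_k$ be a minimizer of $T\mapsto\sum_{z\in Z_k}E(u^T_{k,z})$ over this set (it exists). Then $T^L_k$ denotes a minimizer of $\mathcal{L}(T)$ among all $T\in\mathcal{C}_L(P_k,\overline\Omega)$ such that $T(\frac1kC_z)=\widetilde T^L_k(\frac1kC_z)$ for all $z\in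 Z_k$ (it exists). *)

theory Defs
  imports "HOL-Analysis.Analysis"
begin

section \<open>Sobolev spaces on open subsets of the line\<close>

text \<open>
  Elements of function spaces are represented by functions on the whole line; equality of
  elements is equality almost everywhere.
\<close>

definition L2_space :: "real set \<Rightarrow> (real \<Rightarrow> real) set" where
  "L2_space U = {f \<in> borel_measurable (lebesgue_on U). integrable (lebesgue_on U) (\<lambda>x. (f x)\<^sup>2)}"

definition test_functions :: "real set \<Rightarrow> (real \<Rightarrow> real) set" where
  "test_functions U = {\<phi>. (\<forall>m x. (deriv ^^ m) \<phi> field_differentiable (at x)) \<and>
     compact (closure {x. \<phi> x \<noteq> 0}) \<and> closure {x. \<phi> x \<noteq> 0} \<subseteq> U}"

definition is_weak_deriv :: "real set \<Rightarrow> (real \<Rightarrow> real) \<Rightarrow> (real \<Rightarrow> real) \<Rightarrow> bool" where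
  "is_weak_deriv U u g \<longleftrightarrow> (\<forall>\<phi>\<in>test_functions U.
     integral\<^sup>L (lebesgue_on U) (\<lambda>x. u x * deriv \<phi> x) = - integral\<^sup>L (lebesgue_on U) (\<lambda>x. g x * \<phi> x))"

definition H1 :: "real set \<Rightarrow> (real \<Rightarrow> real) set" where
  "H1 U = {u \<in> L2_space U. \<exists>g\<in>L2_space U. is_weak_deriv U u g}"

text \<open>A representative of the weak derivative, which is unique up to null sets.\<close>

definition weak_deriv :: "real set \<Rightarrow> (real \<Rightarrow> real) \<Rightarrow> real \<Rightarrow> real" where
  "weak_deriv U u = (SOME g. g \<in> L2_space U \<and> is_weak_deriv U u g)"

text \<open>
  The closure of the test functions in the norm of \<^term>\<open>H1 U\<close>. The extension by zero is built in:
  members vanish outside \<^term>\<open>U\<close>.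
\<close>

definition H10 :: "real set \<Rightarrow> (real \<Rightarrow> real) set" where
  "H10 U = {u \<in> H1 U. (\<forall>x. x \<notin> U \<longrightarrow> u x = 0) \<and>
     (\<exists>\<phi>::nat \<Rightarrow> real \<Rightarrow> real. (\<forall>n. \<phi> n \<in> test_functions U) \<and>
        (\<lambda>n. integral\<^sup>L (lebesgue_on U) (\<lambda>x. (\<phi> n x - u x)\<^sup>2)
           + integral\<^sup>L (lebesgue_on U) (\<lambda>x. (deriv (\<phi> n) x - weak_deriv U u x)\<^sup>2)) \<longlonglongrightarrow> 0)}"

definition eq_ae :: "real set \<Rightarrow> (real \<Rightarrow> real) \<Rightarrow> (real \<Rightarrow> real) \<Rightarrow> bool" where
  "eq_ae U u v \<longleftrightarrow> (AE x in lebesgue_on U. u x = v x)"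

definition energy :: "real set \<Rightarrow> real \<Rightarrow> (real \<Rightarrow> real) \<Rightarrow> (real \<Rightarrow> real) \<Rightarrow> real" where
  "energy \<Omega> p w u =
     1 / 2 * integral\<^sup>L (lebesgue_on \<Omega>) (\<lambda>x. \<bar>weak_deriv \<Omega> u x\<bar>\<^sup>2)
     - 1 / (p + 1) * integral\<^sup>L (lebesgue_on \<Omega>) (\<lambda>x. \<bar>u x\<bar> powr (p + 1))
     - integral\<^sup>L (lebesgue_on \<Omega>) (\<lambda>x. w x * u x)"

section \<open>Cells and bi-Lipschitz maps\<close>

definition unit_cell :: "int \<Rightarrow> real set" where
  "unit_cell z = (\<lambda>x. of_int z + x) ` {0<..<1}"

definition cell :: "nat \<Rightarrow> int \<Rightarrow> real set" where
  "cell k z = (\<lambda>x. 1 / real k * x) ` unit_cell z"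

definition cell_sign :: "int \<Rightarrow> real" where
  "cell_sign z = (-1) powi z"

definition cell_indices :: "real set \<Rightarrow> nat \<Rightarrow> int set" where
  "cell_indices \<Omega> k = {z. cell k z \<subseteq> \<Omega>}"

definition cell_union :: "real set \<Rightarrow> nat \<Rightarrow> real set" where
  "cell_union \<Omega> k = (\<Union>z\<in>cell_indices \<Omega> k. (\<lambda>x. 1 / real k * x) ` closure (unit_cell z))"

definition bilipschitz_on :: "real \<Rightarrow> real set \<Rightarrow> (real \<Rightarrow> real) \<Rightarrow> bool" where
  "bilipschitz_on L P T \<longleftrightarrow>
     (\<forall>x\<in>P. \<forall>y\<in>P. 1 / L * \<bar>x - y\<bar> \<le> \<bar>T x - T y\<bar> \<and> \<bar>T x - T y\<bar> \<le> L * \<bar>x - y\<bar>)"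

text \<open>Extensional functions, so that maps are identified with their restrictions to \<^term>\<open>P\<close>.\<close>

definition bilip_maps :: "real \<Rightarrow> real set \<Rightarrow> real set \<Rightarrow> (real \<Rightarrow> real) set" where
  "bilip_maps L P Q = {T \<in> P \<rightarrow>\<^sub>E Q. bilipschitz_on L P T}"

definition bilip_const :: "real set \<Rightarrow> (real \<Rightarrow> real) \<Rightarrow> real" where
  "bilip_const P T = Inf {l. 1 \<le> l \<and> bilipschitz_on l P T}"

definition cell_maps :: "real set \<Rightarrow> real \<Rightarrow> nat \<Rightarrow> (real \<Rightarrow> real) set" where
  "cell_maps \<Omega> L k = bilip_maps L (cell_union \<Omega> k) (closure \<Omega>)"

definition onto_cell_maps :: "real set \<Rightarrow> real \<Rightarrow> nat \<Rightarrow> (real \<Rightarrow> real) set" where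
  "onto_cell_maps \<Omega> L k = {T \<in> cell_maps \<Omega> L k. T ` cell_union \<Omega> k = closure \<Omega>}"

section \<open>The variational problems on one deformed cell\<close>

definition is_local_min ::
  "real set \<Rightarrow> real \<Rightarrow> (real \<Rightarrow> real) \<Rightarrow> real set \<Rightarrow> (real \<Rightarrow> real) \<Rightarrow> bool" where
  "is_local_min \<Omega> p w U v \<longleftrightarrow>
     v \<in> H10 U \<and> integral\<^sup>L (lebesgue_on U) (\<lambda>x. \<bar>v x\<bar> powr (p + 1)) < 1 \<and>
     (\<forall>u\<in>H10 U. integral\<^sup>L (lebesgue_on U) (\<lambda>x. \<bar>u x\<bar> powr (p + 1)) < 1 \<longrightarrow>
        energy \<Omega> p w v \<le> energy \<Omega> p w u)"

definition is_unique_local_min ::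
  "real set \<Rightarrow> real \<Rightarrow> (real \<Rightarrow> real) \<Rightarrow> real set \<Rightarrow> (real \<Rightarrow> real) \<Rightarrow> bool" where
  "is_unique_local_min \<Omega> p w U v \<longleftrightarrow>
     is_local_min \<Omega> p w U v \<and> (\<forall>v'. is_local_min \<Omega> p w U v' \<longrightarrow> eq_ae U v' v)"

text \<open>
  The supremum is a maximum: since \<open>p > 1\<close>, the energy tends to minus infinity along the ray
  unless \<open>u\<close> and \<open>v\<close> agree almost everywhere, in which case it is constant.
\<close>

definition ray_max ::
  "real set \<Rightarrow> real \<Rightarrow> (real \<Rightarrow> real) \<Rightarrow> (real \<Rightarrow> real) \<Rightarrow> (real \<Rightarrow> real) \<Rightarrow> real" where
  "ray_max \<Omega> p w v u = (SUP t\<in>{0..}. energy \<Omega> p w (\<lambda>x. v x + t * (u x - v x)))"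

definition signed_competitors ::
  "real set \<Rightarrow> real \<Rightarrow> (real \<Rightarrow> real) \<Rightarrow> (real \<Rightarrow> real) set" where
  "signed_competitors U s v =
     {u \<in> H10 U. \<not> eq_ae U u v \<and> (AE x in lebesgue_on U. 0 \<le> s * (u x - v x))}"

definition is_minimax ::
  "real set \<Rightarrow> real \<Rightarrow> (real \<Rightarrow> real) \<Rightarrow> real set \<Rightarrow> real \<Rightarrow> (real \<Rightarrow> real) \<Rightarrow> (real \<Rightarrow> real) \<Rightarrow> bool" where
  "is_minimax \<Omega> p w U s v u \<longleftrightarrow>
     u \<in> signed_competitors U s v \<and>
     energy \<Omega> p w u = ray_max \<Omega> p w v u \<and>
     (\<forall>u'\<in>signed_competitors U s v. ray_max \<Omega> p w v u \<le> ray_max \<Omega> p w v u')"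

section \<open>The fixed choices\<close>

text \<open>
  The following predicates say that given families are admissible choices of \<open>k\<^sub>\<Omega>\<close>, \<open>k(L)\<close>, the
  local minimizers (\<open>ut\<close>), the minimax functions (\<open>us\<close>), the energy-minimizing maps (\<open>Tt\<close>) and
  the final maps (\<open>T\<close>). Natural numbers \<open>k\<close> used as scales are positive.
\<close>

definition threshold_choice :: "real set \<Rightarrow> nat \<Rightarrow> bool" where
  "threshold_choice \<Omega> k\<Omega> \<longleftrightarrow> 1 \<le> k\<Omega> \<and> (\<forall>k\<ge>k\<Omega>. cell_indices \<Omega> k \<noteq> {})"

definition local_min_choice ::
  "real set \<Rightarrow> real \<Rightarrow> (real \<Rightarrow> real) \<Rightarrow> nat \<Rightarrow> (real \<Rightarrow> nat) \<Rightarrow>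
   (nat \<Rightarrow> int \<Rightarrow> (real \<Rightarrow> real) \<Rightarrow> real \<Rightarrow> real) \<Rightarrow> bool" where
  "local_min_choice \<Omega> p w k\<Omega> kL ut \<longleftrightarrow>
     (\<forall>L\<ge>1. k\<Omega> \<le> kL L \<and>
       (\<forall>k\<ge>kL L. \<forall>z\<in>cell_indices \<Omega> k. \<forall>T\<in>cell_maps \<Omega> L k.
          is_unique_local_min \<Omega> p w (T ` cell k z) (ut k z T)))"

definition minimax_choice ::
  "real set \<Rightarrow> real \<Rightarrow> (real \<Rightarrow> real) \<Rightarrow> (real \<Rightarrow> nat) \<Rightarrow>
   (nat \<Rightarrow> int \<Rightarrow> (real \<Rightarrow> real) \<Rightarrow> real \<Rightarrow> real) \<Rightarrow>
   (nat \<Rightarrow> int \<Rightarrow> (real \<Rightarrow> real) \<Rightarrow> real \<Rightarrow> real) \<Rightarrow> bool" where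
  "minimax_choice \<Omega> p w kL ut us \<longleftrightarrow>
     (\<forall>L\<ge>1. \<forall>k\<ge>kL L. \<forall>z\<in>cell_indices \<Omega> k. \<forall>T\<in>cell_maps \<Omega> L k.
        is_minimax \<Omega> p w (T ` cell k z) (cell_sign z) (ut k z T) (us k z T))"

definition energy_map_choice ::
  "real set \<Rightarrow> real \<Rightarrow> (real \<Rightarrow> real) \<Rightarrow> (real \<Rightarrow> nat) \<Rightarrow>
   (nat \<Rightarrow> int \<Rightarrow> (real \<Rightarrow> real) \<Rightarrow> real \<Rightarrow> real) \<Rightarrow> (real \<Rightarrow> nat \<Rightarrow> real \<Rightarrow> real) \<Rightarrow> bool" where
  "energy_map_choice \<Omega> p w kL us Tt \<longleftrightarrow>
     (\<forall>L\<ge>1. \<forall>k\<ge>kL L. onto_cell_maps \<Omega> L k \<noteq> {} \<longrightarrow>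
        is_arg_min (\<lambda>S. \<Sum>z\<in>cell_indices \<Omega> k. energy \<Omega> p w (us k z S))
          (\<lambda>S. S \<in> onto_cell_maps \<Omega> L k) (Tt L k))"

definition optimal_map_choice ::
  "real set \<Rightarrow> (real \<Rightarrow> nat) \<Rightarrow> (real \<Rightarrow> nat \<Rightarrow> real \<Rightarrow> real) \<Rightarrow>
   (real \<Rightarrow> nat \<Rightarrow> real \<Rightarrow> real) \<Rightarrow> bool" where
  "optimal_map_choice \<Omega> kL Tt T \<longleftrightarrow>
     (\<forall>L\<ge>1. \<forall>k\<ge>kL L. onto_cell_maps \<Omega> L k \<noteq> {} \<longrightarrow>
        is_arg_min (bilip_const (cell_union \<Omega> k))
          (\<lambda>S. S \<in> cell_maps \<Omega> L k \<and> (\<forall>z\<in>cell_indices \<Omega> k. S ` cell k z = Tt L k ` cell k z))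
          (T L k))"

end

theory Submission
  imports Defs "HOL-Real_Asymp.Real_Asymp"
begin

text \<open>
  On an interval of length \<open>l\<close> the minimax level with \<open>w = 0\<close> is exactly
  \<open>c * l powr (- q)\<close> with \<open>q = (p + 3) / (p - 1) > 1\<close>, by scaling. The forcing term and the local minimizer
  change it only by a relative error \<open>o(1 / k)\<close> and a bounded additive error when \<open>l\<close> is of order \<open>1 / k\<close>.
  Comparing the energy-minimizing map with the affine one, the sum of \<open>s powr (- q)\<close> over the rescaled cell
  lengths \<open>s = k * l\<close>, whose mean tends to 1, exceeds its value for equal lengths by \<open>o(1)\<close>, and strong
  convexity makes every \<open>s\<close> tend to 1 uniformly. The piecewise affine map with the same cell images is then
  an admissible competitor whose bi-Lipschitz constant tends to 1.
\<close>

section \<open>Square integrable functions on the line\<close>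

text \<open>The error budget is dictated by a mismatch of scales. About k cells carry an energy of
  order \<open>k powr q\<close> each, while changing one cell length by a fixed fraction alters the
  total only by order \<open>k powr q\<close>. Relative errors per cell must therefore be o(1 / k);
  bounded additive errors sum to O(k), which is negligible because q > 1. The free parameter
  \<theta> of the perturbation inequalities is set to \<open>k powr (- 3 / 2)\<close>: then k *
  \<theta> tends to 0, whereas l^2 / \<theta> stays bounded for l of order 1 / k. The infimum over
  profiles on the unit interval is never shown to be attained; a positive lower bound suffices, and
  nonemptiness is read off from the given minimax functions. The obstacle shaping the first half is
  that the energy involves a chosen representative of the weak derivative on all of \<Omega>, even
  for functions living on one cell, so uniqueness of weak derivatives has to precede every
  estimate.\<close>

definition L2R :: "(real \<Rightarrow> real) \<Rightarrow> bool" where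
  "L2R f \<longleftrightarrow> f \<in> borel_measurable lebesgue \<and> integrable lebesgue (\<lambda>x. (f x)\<^sup>2)"

definition nsq :: "(real \<Rightarrow> real) \<Rightarrow> real" where
  "nsq f = (LINT x|lebesgue. (f x)\<^sup>2)"

lemma nsq_nonneg [simp]: "0 \<le> nsq f"
  by (simp add: nsq_def)

lemma L2R_measurable [measurable_dest]: "L2R f \<Longrightarrow> f \<in> borel_measurable lebesgue"
  by (simp add: L2R_def)

lemma L2R_integrable_sq: "L2R f \<Longrightarrow> integrable lebesgue (\<lambda>x. (f x)\<^sup>2)"
  by (simp add: L2R_def)

lemma L2R_integrable_mult:
  assumes "L2R f" "L2R g"
  shows "integrable lebesgue (\<lambda>x. f x * g x)"
proof (rule Bochner_Integration.integrable_bound)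
  show "integrable lebesgue (\<lambda>x. (f x)\<^sup>2 + (g x)\<^sup>2)"
    using assms by (intro Bochner_Integration.integrable_add L2R_integrable_sq)
  show "(\<lambda>x. f x * g x) \<in> borel_measurable lebesgue"
    using assms[THEN L2R_measurable] by measurable
  have "\<bar>f x * g x\<bar> \<le> (f x)\<^sup>2 + (g x)\<^sup>2" for x
  proof -
    have "2 * (\<bar>f x\<bar> * \<bar>g x\<bar>) \<le> (f x)\<^sup>2 + (g x)\<^sup>2"
      using sum_squares_bound[of "\<bar>f x\<bar>" "\<bar>g x\<bar>"] by simp
    moreover have "0 \<le> \<bar>f x\<bar> * \<bar>g x\<bar>" by simp
    ultimately show ?thesis unfolding abs_mult by linarith
  qed
  then show "AE x in lebesgue. norm (f x * g x) \<le> norm ((f x)\<^sup>2 + (g x)\<^sup>2)"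
    by simp
qed

lemma L2R_add: "L2R f \<Longrightarrow> L2R g \<Longrightarrow> L2R (\<lambda>x. f x + g x)"
proof -
  assume fg: "L2R f" "L2R g"
  have "integrable lebesgue (\<lambda>x. (f x)\<^sup>2 + (g x)\<^sup>2 + 2 * (f x * g x))"
    using fg by (intro Bochner_Integration.integrable_add L2R_integrable_sq
        integrable_mult_right L2R_integrable_mult)
  then have "integrable lebesgue (\<lambda>x. (f x + g x)\<^sup>2)"
    by (simp add: power2_sum mult.assoc)
  then show ?thesis using fg[THEN L2R_measurable] by (simp add: L2R_def)
qed

lemma L2R_scale: "L2R f \<Longrightarrow> L2R (\<lambda>x. c * f x)"
  by (auto simp: L2R_def power_mult_distrib)

lemma L2R_diff: "L2R f \<Longrightarrow> L2R g \<Longrightarrow> L2R (\<lambda>x. f x - g x)"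
  using L2R_add[of f "\<lambda>x. (-1) * g x"] L2R_scale[of g "-1"] by simp

lemma L2R_zero [simp]: "L2R (\<lambda>x. 0)"
  by (simp add: L2R_def)

lemma nsq_add_scale:
  assumes "L2R f" "L2R g"
  shows "nsq (\<lambda>x. f x + c * g x) = nsq f + 2 * c * (LINT x|lebesgue. f x * g x) + c\<^sup>2 * nsq g"
proof -
  have "nsq (\<lambda>x. f x + c * g x)
    = (LINT x|lebesgue. (f x)\<^sup>2 + (2 * c) * (f x * g x) + c\<^sup>2 * (g x)\<^sup>2)"
    unfolding nsq_def by (simp add: power2_sum power_mult_distrib algebra_simps)
  also have "\<dots> = nsq f + 2 * c * (LINT x|lebesgue. f x * g x) + c\<^sup>2 * nsq g"
    using assms by (simp add: L2R_integrable_sq L2R_integrable_mult nsq_def)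
  finally show ?thesis .
qed

text \<open>The squared norm of \<open>f + c * g\<close> is a nonnegative quadratic polynomial in c,
  so its discriminant is not positive.\<close>

lemma L2R_Cauchy_Schwarz:
  assumes "L2R f" "L2R g"
  shows "\<bar>LINT x|lebesgue. f x * g x\<bar> \<le> sqrt (nsq f) * sqrt (nsq g)"
proof -
  define I where "I = (LINT x|lebesgue. f x * g x)"
  have q: "0 \<le> nsq f + 2 * c * I + c\<^sup>2 * nsq g" for c
    using nsq_add_scale[OF assms, of c] nsq_nonneg unfolding I_def by metis
  have "I\<^sup>2 \<le> nsq f * nsq g"
  proof (cases "nsq g = 0")
    case True
    have "I = 0"
    proof (rule ccontr)
      assume "I \<noteq> 0"
      \<comment> \<open>For \<open>nsq g = 0\<close> the expression is affine in c, and this c gives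
        it the value -1.\<close>
      with q[of "- (nsq f + 1) / (2 * I)"] True show False by (simp add: field_simps)
    qed
    then show ?thesis by simp
  next
    case False
    then have "nsq g > 0" using nsq_nonneg[of g] by linarith
    \<comment> \<open>This c is the vertex of the parabola.\<close>
    with q[of "- I / nsq g"] show ?thesis
      by (simp add: field_simps power2_eq_square)
  qed
  then have "sqrt (I\<^sup>2) \<le> sqrt (nsq f * nsq g)" by (rule real_sqrt_le_mono)
  then show ?thesis by (simp add: I_def real_sqrt_mult)
qed

lemma nsq_scale: "nsq (\<lambda>x. c * f x) = c\<^sup>2 * nsq f"
  by (simp add: nsq_def power_mult_distrib)

lemma nsq_cong_AE:
  assumes "f \<in> borel_measurable lebesgue" "g \<in> borel_measurable lebesgue" "AE x in lebesgue. f x = g x"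
  shows "nsq f = nsq g"
  unfolding nsq_def using assms by (intro integral_cong_AE) auto

text \<open>
  For small \<open>\<theta>\<close> the perturbation \<open>g\<close> costs only a factor close to one in the leading term.
\<close>

lemma nsq_add_le:
  assumes "L2R f" "L2R g" "0 < \<theta>" "\<theta> < 1"
  shows "nsq (\<lambda>x. f x + g x) \<le> nsq f / (1 - \<theta>) + nsq g / \<theta>"
proof -
  have pw: "(a + b)\<^sup>2 \<le> a\<^sup>2 / (1 - \<theta>) + b\<^sup>2 / \<theta>" for a b :: real
  proof -
    have "a\<^sup>2 / (1 - \<theta>) + b\<^sup>2 / \<theta> - (a + b)\<^sup>2 = (\<theta> * a - (1 - \<theta>) * b)\<^sup>2 / (\<theta> * (1 - \<theta>))"
      using assms(3,4) by (simp add: field_simps power2_eq_square)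
    moreover have "0 \<le> (\<theta> * a - (1 - \<theta>) * b)\<^sup>2 / (\<theta> * (1 - \<theta>))"
      using assms(3,4) by simp
    ultimately show ?thesis by linarith
  qed
  have "nsq (\<lambda>x. f x + g x) \<le> (LINT x|lebesgue. (f x)\<^sup>2 / (1 - \<theta>) + (g x)\<^sup>2 / \<theta>)"
    unfolding nsq_def
    using assms L2R_add[OF assms(1,2)] by (intro integral_mono) (auto simp: L2R_integrable_sq pw)
  also have "\<dots> = nsq f / (1 - \<theta>) + nsq g / \<theta>"
    using assms by (simp add: L2R_integrable_sq nsq_def)
  finally show ?thesis .
qed

lemma L2_tendsto_integral_mult:
  assumes "\<And>n. L2R (f n)" "L2R g" "L2R h" "(\<lambda>n. nsq (\<lambda>x. f n x - g x)) \<longlonglongrightarrow> 0"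
  shows "(\<lambda>n. LINT x|lebesgue. f n x * h x) \<longlonglongrightarrow> (LINT x|lebesgue. g x * h x)"
proof -
  have "(\<lambda>n. sqrt (nsq (\<lambda>x. f n x - g x)) * sqrt (nsq h)) \<longlonglongrightarrow> sqrt 0 * sqrt (nsq h)"
    using assms(4) by (intro tendsto_intros)
  then have *: "(\<lambda>n. sqrt (nsq (\<lambda>x. f n x - g x)) * sqrt (nsq h)) \<longlonglongrightarrow> 0"
    by simp
  have "(LINT x|lebesgue. f n x * h x) - (LINT x|lebesgue. g x * h x)
      = (LINT x|lebesgue. (f n x - g x) * h x)" for n
    using assms by (simp add: left_diff_distrib L2R_integrable_mult)
  then have "\<bar>(LINT x|lebesgue. f n x * h x) - (LINT x|lebesgue. g x * h x)\<bar>
     \<le> sqrt (nsq (\<lambda>x. f n x - g x)) * sqrt (nsq h)" for n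
    using L2R_Cauchy_Schwarz[OF L2R_diff[OF assms(1)[of n] assms(2)] assms(3)] by simp
  then have "(\<lambda>n. (LINT x|lebesgue. f n x * h x) - (LINT x|lebesgue. g x * h x)) \<longlonglongrightarrow> 0"
    by (intro Lim_null_comparison[OF _ *]) auto
  then show ?thesis by (rule LIM_zero_cancel)
qed

lemma L2_tendsto_nsq:
  assumes "\<And>n. L2R (f n)" "L2R g" "(\<lambda>n. nsq (\<lambda>x. f n x - g x)) \<longlonglongrightarrow> 0"
  shows "(\<lambda>n. nsq (f n)) \<longlonglongrightarrow> nsq g"
proof -
  have "(\<lambda>n. nsq (\<lambda>x. f n x - g x) + 2 * (LINT x|lebesgue. f n x * g x) - nsq g)
      \<longlonglongrightarrow> 0 + 2 * (LINT x|lebesgue. g x * g x) - nsq g"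
    using assms by (intro tendsto_intros L2_tendsto_integral_mult)
  moreover have "nsq (\<lambda>x. f n x - g x) + 2 * (LINT x|lebesgue. f n x * g x) - nsq g = nsq (f n)" for n
    using nsq_add_scale[OF assms(1)[of n] assms(2), of "-1"] by simp
  moreover have "0 + 2 * (LINT x|lebesgue. g x * g x) - nsq g = nsq g"
    by (simp add: nsq_def power2_eq_square)
  ultimately show ?thesis by simp
qed

section \<open>Smooth functions with compact support\<close>

text \<open>Smoothness is \<open>diff_upto n\<close> for every n. Grading by finite order makes the
  product and substitution rules provable by induction on n, generalised over the functions.\<close>

definition diff_upto :: "nat \<Rightarrow> (real \<Rightarrow> real) \<Rightarrow> bool" where
  "diff_upto n f \<longleftrightarrow> (\<forall>m<n. \<forall>x. (deriv ^^ m) f field_differentiable (at x))"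

lemma diff_upto_0 [simp]: "diff_upto 0 f"
  by (simp add: diff_upto_def)

lemma diff_upto_Suc:
  "diff_upto (Suc n) f \<longleftrightarrow> (\<forall>x. f field_differentiable (at x)) \<and> diff_upto n (deriv f)"
  unfolding diff_upto_def by (subst All_less_Suc2) (simp add: funpow_Suc_right del: funpow.simps)

lemma diff_upto_Suc_D: "diff_upto (Suc n) f \<Longrightarrow> diff_upto n f"
  by (simp add: diff_upto_def)

lemma diff_upto_const: "diff_upto n (\<lambda>x. c)"
proof (induction n arbitrary: c)
  case (Suc n)
  have "deriv (\<lambda>x. c) = (\<lambda>x. 0)" by auto
  then show ?case using Suc by (simp add: diff_upto_Suc)
qed simp

lemma diff_upto_add: "diff_upto n f \<Longrightarrow> diff_upto n g \<Longrightarrow> diff_upto n (\<lambda>x. f x + g x)"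
proof (induction n arbitrary: f g)
  case (Suc n)
  then have "deriv (\<lambda>x. f x + g x) = (\<lambda>x. deriv f x + deriv g x)"
    by (intro ext deriv_add) (auto simp: diff_upto_Suc)
  with Suc show ?case by (auto simp: diff_upto_Suc intro: field_differentiable_add)
qed simp

lemma diff_upto_mult: "diff_upto n f \<Longrightarrow> diff_upto n g \<Longrightarrow> diff_upto n (\<lambda>x. f x * g x)"
proof (induction n arbitrary: f g)
  case (Suc n)
  then have "deriv (\<lambda>x. f x * g x) = (\<lambda>x. f x * deriv g x + deriv f x * g x)"
    by (intro ext deriv_mult) (auto simp: diff_upto_Suc)
  moreover have "diff_upto n f" "diff_upto n g" using Suc.prems by (auto intro: diff_upto_Suc_D)
  ultimately show ?case using Suc
    by (auto simp: diff_upto_Suc intro!: field_differentiable_mult diff_upto_add)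
qed simp

lemma diff_upto_affine: "diff_upto n f \<Longrightarrow> diff_upto n (\<lambda>x. f (s * x + t))"
proof (induction n arbitrary: f)
  case (Suc n)
  have d: "((\<lambda>x. f (s * x + t)) has_field_derivative s * deriv f (s * x + t)) (at x)" for x
  proof -
    have "(f has_field_derivative deriv f (s * x + t)) (at (s * x + t))"
      using Suc.prems by (auto simp: diff_upto_Suc DERIV_deriv_iff_field_differentiable)
    moreover have "((\<lambda>x. s * x + t) has_field_derivative s) (at x)"
      by (auto intro!: derivative_eq_intros)
    ultimately have "((\<lambda>x. f (s * x + t)) has_field_derivative deriv f (s * x + t) * s) (at x)"
      using DERIV_chain2[of f _ "\<lambda>x. s * x + t"] by blast
    then show ?thesis by (simp only: mult.commute)
  qed
  then have "deriv (\<lambda>x. f (s * x + t)) = (\<lambda>x. s * deriv f (s * x + t))"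
    by (intro ext DERIV_imp_deriv)
  with Suc d show ?case
    by (auto simp: diff_upto_Suc field_differentiable_def intro!: diff_upto_mult diff_upto_const)
qed simp

section \<open>Closure properties of test functions\<close>

lemma test_functions_iff:
  "\<phi> \<in> test_functions U \<longleftrightarrow> (\<forall>n. diff_upto n \<phi>) \<and> compact (closure {x. \<phi> x \<noteq> 0}) \<and> closure {x. \<phi> x \<noteq> 0} \<subseteq> U"
  unfolding test_functions_def diff_upto_def by blast

text \<open>Any compact set outside which the function vanishes can stand for the support, so
  closures of supports need not be computed in what follows.\<close>

lemma test_functionsI:
  assumes "\<And>n. diff_upto n \<phi>" "compact K" "K \<subseteq> U" "\<And>x. x \<notin> K \<Longrightarrow> \<phi> x = 0"
  shows "\<phi> \<in> test_functions U"
proof -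
  have "{x. \<phi> x \<noteq> 0} \<subseteq> K" using assms(4) by auto
  then have "closure {x. \<phi> x \<noteq> 0} \<subseteq> K"
    by (simp add: assms(2) closure_minimal compact_imp_closed)
  then show ?thesis unfolding test_functions_iff
    using assms bounded_subset[OF compact_imp_bounded[OF assms(2)] \<open>{x. \<phi> x \<noteq> 0} \<subseteq> K\<close>] by auto
qed

lemma test_functionsE:
  assumes "\<phi> \<in> test_functions U"
  obtains K where "compact K" "K \<subseteq> U" "\<And>x. x \<notin> K \<Longrightarrow> \<phi> x = 0" "\<And>n. diff_upto n \<phi>"
  using assms unfolding test_functions_iff
  by (metis (mono_tags, lifting) closure_subset mem_Collect_eq subsetD)

lemma test_functions_has_deriv:
  assumes "\<phi> \<in> test_functions U"
  shows "(\<phi> has_field_derivative deriv \<phi> x) (at x)"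
proof -
  have "diff_upto (Suc 0) \<phi>" using assms unfolding test_functions_iff by blast
  then show ?thesis by (auto simp: diff_upto_Suc DERIV_deriv_iff_field_differentiable)
qed

lemma test_functions_zero: "\<phi> \<in> test_functions U \<Longrightarrow> x \<notin> U \<Longrightarrow> \<phi> x = 0"
  by (metis subsetD test_functionsE)

lemma test_functions_add:
  assumes "\<phi> \<in> test_functions U" "\<psi> \<in> test_functions U"
  shows "(\<lambda>x. \<phi> x + \<psi> x) \<in> test_functions U"
proof -
  obtain K where K: "compact K" "K \<subseteq> U" "\<And>x. x \<notin> K \<Longrightarrow> \<phi> x = 0" "\<And>n. diff_upto n \<phi>"
    using assms(1) by (rule test_functionsE) blast
  obtain J where J: "compact J" "J \<subseteq> U" "\<And>x. x \<notin> J \<Longrightarrow> \<psi> x = 0" "\<And>n. diff_upto n \<psi>"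
    using assms(2) by (rule test_functionsE) blast
  show ?thesis
    by (rule test_functionsI[of _ "K \<union> J"]) (use K J in \<open>auto intro: diff_upto_add\<close>)
qed

lemma test_functions_scale:
  assumes "\<phi> \<in> test_functions U"
  shows "(\<lambda>x. c * \<phi> x) \<in> test_functions U"
proof -
  obtain K where K: "compact K" "K \<subseteq> U" "\<And>x. x \<notin> K \<Longrightarrow> \<phi> x = 0" "\<And>n. diff_upto n \<phi>"
    using assms(1) by (rule test_functionsE) blast
  show ?thesis
    by (rule test_functionsI[of _ K]) (use K in \<open>auto intro: diff_upto_mult diff_upto_const\<close>)
qed

lemma test_functions_deriv:
  assumes "\<phi> \<in> test_functions U"
  shows "deriv \<phi> \<in> test_functions U"
proof -
  obtain K where K: "compact K" "K \<subseteq> U" "\<And>x. x \<notin> K \<Longrightarrow> \<phi> x = 0" "\<And>n. diff_upto n \<phi>"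
    using assms(1) by (rule test_functionsE) blast
  have "deriv \<phi> x = 0" if "x \<notin> K" for x
  proof -
    have "eventually (\<lambda>y. y \<in> - K) (nhds x)"
      using that K(1) by (intro eventually_nhds_in_open) (auto simp: compact_imp_closed open_Compl)
    then have "eventually (\<lambda>y. \<phi> y = 0) (nhds x)"
      by (rule eventually_mono) (use K(3) in auto)
    then have "deriv \<phi> x = deriv (\<lambda>y. 0) x" by (intro deriv_cong_ev) auto
    then show ?thesis by simp
  qed
  moreover have "diff_upto n (deriv \<phi>)" for n
    using K(4)[of "Suc n"] by (simp add: diff_upto_Suc)
  ultimately show ?thesis using K by (intro test_functionsI[of _ K]) auto
qed

lemma test_functions_affine:
  assumes "\<phi> \<in> test_functions U" "s \<noteq> 0" "\<And>x. s * x + t \<in> U \<Longrightarrow> x \<in> V"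
  shows "(\<lambda>x. \<phi> (s * x + t)) \<in> test_functions V"
proof -
  obtain K where K: "compact K" "K \<subseteq> U" "\<And>x. x \<notin> K \<Longrightarrow> \<phi> x = 0" "\<And>n. diff_upto n \<phi>"
    using assms(1) by (rule test_functionsE) blast
  let ?J = "(\<lambda>y. (y - t) / s) ` K"
  have "x \<in> ?J" if "s * x + t \<in> K" for x
    using that \<open>s \<noteq> 0\<close> by (intro image_eqI[of _ _ "s * x + t"]) (auto simp: field_simps)
  then have "\<phi> (s * x + t) = 0" if "x \<notin> ?J" for x using that K(3) by blast
  moreover have "compact ?J"
    using \<open>s \<noteq> 0\<close> K(1) by (intro compact_continuous_image continuous_intros) auto
  moreover have "?J \<subseteq> V" using K(2) \<open>s \<noteq> 0\<close> by (auto intro!: assms(3))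
  ultimately show ?thesis
    using K(4) by (intro test_functionsI[of _ ?J]) (auto intro: diff_upto_affine)
qed

lemma deriv_affine:
  assumes "\<phi> \<in> test_functions U"
  shows "deriv (\<lambda>x. \<phi> (s * x + t)) x = s * deriv \<phi> (s * x + t)"
proof -
  have "((\<lambda>x. s * x + t) has_field_derivative s) (at x)"
    by (auto intro!: derivative_eq_intros)
  then have "((\<lambda>x. \<phi> (s * x + t)) has_field_derivative deriv \<phi> (s * x + t) * s) (at x)"
    using DERIV_chain2[of \<phi> _ "\<lambda>x. s * x + t"] test_functions_has_deriv[OF assms] by blast
  then show ?thesis by (simp add: DERIV_imp_deriv mult.commute)
qed

lemma test_functions_continuous: "\<phi> \<in> test_functions U \<Longrightarrow> continuous_on S \<phi>"
  by (meson DERIV_isCont continuous_at_imp_continuous_on test_functions_has_deriv)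

lemma test_functions_L2R:
  assumes "\<phi> \<in> test_functions U"
  shows "L2R \<phi>"
proof -
  obtain K where K: "compact K" "K \<subseteq> U" "\<And>x. x \<notin> K \<Longrightarrow> \<phi> x = 0" "\<And>n. diff_upto n \<phi>"
    using assms(1) by (rule test_functionsE) blast
  have "\<phi> \<in> borel_measurable borel"
    using test_functions_continuous[OF assms] by (rule borel_measurable_continuous_onI)
  then have m: "\<phi> \<in> borel_measurable lborel" by simp
  have "integrable lborel (\<lambda>x. indicator K x *\<^sub>R (\<phi> x)\<^sup>2)"
    by (intro borel_integrable_compact K continuous_on_power test_functions_continuous[OF assms])
  moreover have "(\<lambda>x. indicator K x *\<^sub>R (\<phi> x)\<^sup>2) = (\<lambda>x. (\<phi> x)\<^sup>2)"
    using K(3) by (auto simp: indicator_def fun_eq_iff)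
  ultimately have "integrable lborel (\<lambda>x. (\<phi> x)\<^sup>2)" by simp
  then show ?thesis unfolding L2R_def
    using m by (auto simp: integrable_completion intro: measurable_completion)
qed

section \<open>Integration by parts and the sup bound for test functions\<close>

lemma test_functions_FTC:
  assumes "\<phi> \<in> test_functions U" "c \<le> d"
  shows "integrable lebesgue (\<lambda>x. indicator {c..d} x * deriv \<phi> x)"
    and "(LINT x|lebesgue. indicator {c..d} x * deriv \<phi> x) = \<phi> d - \<phi> c"
proof -
  note d = test_functions_deriv[OF assms(1)]
  have *: "has_bochner_integral lborel (\<lambda>x. indicator {c..d} x *\<^sub>R deriv \<phi> x) (\<phi> d - \<phi> c)"
    using assms by (intro has_bochner_integral_FTC_Icc test_functions_continuous[OF d])
      (auto intro: has_vector_derivative_at_within test_functions_has_deriv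
        simp flip: has_real_derivative_iff_has_vector_derivative intro: has_field_derivative_at_within)
  have [measurable]: "deriv \<phi> \<in> borel_measurable borel"
    using test_functions_continuous[OF d] by (rule borel_measurable_continuous_onI)
  show "integrable lebesgue (\<lambda>x. indicator {c..d} x * deriv \<phi> x)"
    using * by (subst integrable_completion) (auto simp: has_bochner_integral_iff)
  show "(LINT x|lebesgue. indicator {c..d} x * deriv \<phi> x) = \<phi> d - \<phi> c"
    using * by (subst integral_completion) (auto simp: has_bochner_integral_iff)
qed

lemma test_functions_by_parts:
  assumes "\<phi> \<in> test_functions U" "\<psi> \<in> test_functions V"
  shows "(LINT x|lebesgue. \<phi> x * deriv \<psi> x) = - (LINT x|lebesgue. deriv \<phi> x * \<psi> x)"
proof -
  obtain K where K: "compact K" "K \<subseteq> U" "\<And>x. x \<notin> K \<Longrightarrow> \<phi> x = 0" "\<And>n. diff_upto n \<phi>"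
    using assms(1) by (rule test_functionsE) blast
  obtain J where J: "\<And>n. diff_upto n \<psi>" using assms(2) by (rule test_functionsE) blast
  \<comment> \<open>The product inherits its compact support from the first factor, so its
    derivative integrates to 0 over the line.\<close>
  have pr: "(\<lambda>x. \<phi> x * \<psi> x) \<in> test_functions UNIV"
    by (rule test_functionsI[of _ K]) (use K J in \<open>auto intro: diff_upto_mult\<close>)
  have dv: "deriv (\<lambda>x. \<phi> x * \<psi> x) x = \<phi> x * deriv \<psi> x + deriv \<phi> x * \<psi> x" for x
    using test_functions_has_deriv[OF assms(1), of x] test_functions_has_deriv[OF assms(2), of x]
    by (intro deriv_mult) (auto simp: field_differentiable_def)
  obtain M where M: "\<And>x. x \<in> K \<Longrightarrow> norm x < M"
    using compact_imp_bounded[OF K(1)] by (metis bounded_normE_less)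
  have z: "\<phi> x = 0" if "\<bar>x\<bar> \<ge> M" for x using K(3) M[of x] that by force
  have dz: "deriv (\<lambda>x. \<phi> x * \<psi> x) x = 0" if "x \<notin> {-\<bar>M\<bar>..\<bar>M\<bar>}" for x
  proof -
    have "\<phi> x = 0" using that by (intro z) auto
    moreover have "deriv \<phi> x = 0"
    proof -
      \<comment> \<open>Regarding \<phi> as a test function of this interval confines its derivative
        to the interval as well.\<close>
      have "\<phi> \<in> test_functions {-\<bar>M\<bar>..\<bar>M\<bar>}"
        by (rule test_functionsI[of _ "{-\<bar>M\<bar>..\<bar>M\<bar>}"]) (auto intro!: K(4) z)
      from test_functions_zero[OF test_functions_deriv[OF this]] that show ?thesis by blast
    qed
    ultimately show ?thesis by (simp add: dv)
  qed
  have "(LINT x|lebesgue. deriv (\<lambda>x. \<phi> x * \<psi> x) x)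
      = (LINT x|lebesgue. indicator {-\<bar>M\<bar>..\<bar>M\<bar>} x * deriv (\<lambda>x. \<phi> x * \<psi> x) x)"
    by (rule Bochner_Integration.integral_cong) (use dz in \<open>auto simp: indicator_def\<close>)
  also have "\<dots> = 0"
    by (subst test_functions_FTC(2)[OF pr]) (auto simp: z)
  finally have "(LINT x|lebesgue. \<phi> x * deriv \<psi> x + deriv \<phi> x * \<psi> x) = 0" by (simp add: dv)
  then show ?thesis
    using L2R_integrable_mult[OF test_functions_L2R test_functions_L2R]
      assms test_functions_deriv[OF assms(1)] test_functions_deriv[OF assms(2)]
    by (subst (asm) Bochner_Integration.integral_add) auto
qed

text \<open>The one-dimensional Sobolev inequality: the value at x is the integral of the derivative
  from the left end to x, and Cauchy-Schwarz against the indicator contributes the factor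
  \<open>x - a\<close>. Later estimates inherit powers of the interval length from it.\<close>

lemma test_functions_sup_bound:
  assumes "\<phi> \<in> test_functions {a<..<b}" "a < b"
  shows "(\<phi> x)\<^sup>2 \<le> (b - a) * nsq (deriv \<phi>)"
proof (cases "x \<in> {a<..<b}")
  case False
  then show ?thesis using test_functions_zero[OF assms(1)] assms(2) by simp
next
  case True
  note d = test_functions_deriv[OF assms(1)]
  have a0: "\<phi> a = 0" using test_functions_zero[OF assms(1), of a] by simp
  have ind: "(\<lambda>x::real. (indicator {a..y} x)\<^sup>2) = (indicator {a..y} :: real \<Rightarrow> real)" for y
    by (auto simp: indicator_def)
  have L: "L2R (indicator {a..x} :: real \<Rightarrow> real)"
    unfolding L2R_def ind
    by (auto intro!: measurable_completion integrable_real_indicator simp: emeasure_lborel_Icc_eq)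
  have n: "nsq (indicator {a..x} :: real \<Rightarrow> real) = x - a"
    unfolding nsq_def ind using True by simp
  have "\<bar>\<phi> x\<bar> \<le> sqrt (x - a) * sqrt (nsq (deriv \<phi>))"
    using L2R_Cauchy_Schwarz[OF L test_functions_L2R[OF d]] test_functions_FTC(2)[OF assms(1), of a x] True a0 n
    by simp
  then have "\<bar>\<phi> x\<bar>\<^sup>2 \<le> (sqrt (x - a) * sqrt (nsq (deriv \<phi>)))\<^sup>2"
    by (intro power_mono) auto
  also have "\<dots> = (x - a) * nsq (deriv \<phi>)" using True by (simp add: power_mult_distrib)
  also have "\<dots> \<le> (b - a) * nsq (deriv \<phi>)" using True by (intro mult_right_mono) auto
  finally show ?thesis by simp
qed

section \<open>Uniqueness of weak derivatives\<close>

text \<open>The family is closed under differentiation, which yields smoothness at 0 by induction.\<close>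

definition flat_exp :: "real poly \<Rightarrow> real \<Rightarrow> real" where
  "flat_exp P x = (if x > 0 then poly P (1 / x) * exp (- (1 / x)) else 0)"

lemma flat_exp_tendsto_0: "(flat_exp P \<longlongrightarrow> 0) (at 0)"
proof -
  have "((\<lambda>y::real. poly P y / exp y) \<longlongrightarrow> 0) at_top"
  proof -
    have "((\<lambda>y::real. \<Sum>i\<le>degree P. coeff P i * (y ^ i / exp y)) \<longlongrightarrow> (\<Sum>i\<le>degree P. coeff P i * 0)) at_top"
      by (intro tendsto_intros tendsto_power_div_exp_0)
    then show ?thesis by (simp add: poly_altdef sum_divide_distrib)
  qed
  then have "((\<lambda>x::real. poly P (inverse x) / exp (inverse x)) \<longlongrightarrow> 0) (at_right 0)"
    using filterlim_inverse_at_top_right by (rule filterlim_compose)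
  then have R: "(flat_exp P \<longlongrightarrow> 0) (at_right 0)"
    by (rule Lim_transform_eventually)
      (auto simp: flat_exp_def eventually_at_filter exp_minus divide_simps)
  have "(flat_exp P \<longlongrightarrow> 0) (at_left 0)"
    by (rule Lim_transform_eventually[OF tendsto_const])
      (auto simp: flat_exp_def eventually_at_filter)
  with R show ?thesis by (simp add: filterlim_split_at)
qed

text \<open>With y = 1 / x one has y' = - y^2, which turns the derivative into y^2 * (P - P')(y) *
  exp (- y); \<open>[:0, 0, 1:]\<close> is the polynomial y^2. At 0 the difference quotient is again
  a member of the family, with polynomial y * P, and tends to 0.\<close>

lemma flat_exp_has_deriv:
  "(flat_exp P has_field_derivative flat_exp ([:0, 0, 1:] * (P - pderiv P)) x) (at x)"
proof -
  consider "x > 0" | "x < 0" | "x = 0" by linarith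
  then show ?thesis
  proof cases
    case 1
    have "((\<lambda>x. poly P (1 / x) * exp (- (1 / x))) has_field_derivative
        flat_exp ([:0, 0, 1:] * (P - pderiv P)) x) (at x)"
      using 1 by (auto intro!: derivative_eq_intros poly_DERIV[THEN DERIV_chain2]
          simp: flat_exp_def field_simps power2_eq_square)
    moreover have "eventually (\<lambda>y. poly P (1 / y) * exp (- (1 / y)) = flat_exp P y) (nhds x)"
      using eventually_nhds_in_open[of "{0<..}" x] 1
      by (auto elim!: eventually_mono simp: flat_exp_def)
    ultimately show ?thesis by (subst (asm) DERIV_cong_ev) auto
  next
    case 2
    have "((\<lambda>x. 0) has_field_derivative flat_exp ([:0, 0, 1:] * (P - pderiv P)) x) (at x)"
      using 2 by (simp add: flat_exp_def)
    moreover have "eventually (\<lambda>y. 0 = flat_exp P y) (nhds x)"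
      using eventually_nhds_in_open[of "{..<0}" x] 2
      by (auto elim!: eventually_mono simp: flat_exp_def)
    ultimately show ?thesis by (subst (asm) DERIV_cong_ev) auto
  next
    case 3
    have "((\<lambda>h. (flat_exp P (0 + h) - flat_exp P 0) / h) \<longlongrightarrow> 0) (at 0)"
      by (rule Lim_transform_eventually[OF flat_exp_tendsto_0[of "[:0, 1:] * P"]])
        (auto simp: flat_exp_def eventually_at_filter)
    then show ?thesis using 3 by (simp add: DERIV_def flat_exp_def)
  qed
qed

lemma diff_upto_flat_exp: "diff_upto n (flat_exp P)"
proof (induction n arbitrary: P)
  case (Suc n)
  have "deriv (flat_exp P) = flat_exp ([:0, 0, 1:] * (P - pderiv P))"
    using flat_exp_has_deriv by (intro ext DERIV_imp_deriv)
  with Suc flat_exp_has_deriv show ?case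
    by (auto simp: diff_upto_Suc field_differentiable_def)
qed simp

text \<open>Dilating the two smooth steps by n sharpens both flanks: the functions stay bounded by
  1, vanish outside the interval and tend pointwise to its indicator, as dominated convergence
  requires.\<close>

definition bump :: "real \<Rightarrow> real \<Rightarrow> nat \<Rightarrow> real \<Rightarrow> real" where
  "bump c d n x = flat_exp 1 (real n * (x - c)) * flat_exp 1 (real n * (d - x))"

lemma bump_zero: "x \<notin> {c<..<d} \<Longrightarrow> bump c d n x = 0"
  by (auto simp: bump_def flat_exp_def zero_less_mult_iff)

lemma bump_bound: "\<bar>bump c d n x\<bar> \<le> 1"
proof -
  have "0 \<le> flat_exp 1 y \<and> flat_exp 1 y \<le> 1" for y by (auto simp: flat_exp_def)
  then show ?thesis unfolding bump_def abs_mult by (auto intro: mult_le_one)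
qed

lemma bump_test_function: "{c..d} \<subseteq> U \<Longrightarrow> bump c d n \<in> test_functions U"
proof (rule test_functionsI[of _ "{c..d}"])
  have *: "bump c d n = (\<lambda>x. flat_exp 1 (real n * x + (- real n * c)) * flat_exp 1 ((- real n) * x + real n * d))"
    by (auto simp: bump_def algebra_simps)
  show "diff_upto m (bump c d n)" for m
    unfolding * by (intro diff_upto_mult diff_upto_affine diff_upto_flat_exp)
qed (auto simp: bump_zero)

lemma bump_tendsto: "(\<lambda>n. bump c d n x) \<longlonglongrightarrow> indicator {c<..<d} x"
proof (cases "x \<in> {c<..<d}")
  case False
  then show ?thesis by (simp add: bump_zero)
next
  case True
  have lim: "(\<lambda>n. flat_exp 1 (real n * y)) \<longlonglongrightarrow> 1" if "y > 0" for y
  proof -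
    have "(\<lambda>n. exp (- (1 / y) * (1 / real n))) \<longlonglongrightarrow> exp (- (1 / y) * 0)"
      by (intro tendsto_intros lim_1_over_n)
    then have "(\<lambda>n. exp (- (1 / y) * (1 / real n))) \<longlonglongrightarrow> 1" by simp
    then show ?thesis
      by (rule Lim_transform_eventually)
        (use that in \<open>auto simp: flat_exp_def eventually_sequentially zero_less_mult_iff intro!: exI[of _ 1]\<close>)
  qed
  have "(\<lambda>n. bump c d n x) \<longlonglongrightarrow> 1 * 1"
    unfolding bump_def using True by (intro tendsto_mult lim) auto
  then show ?thesis using True by simp
qed

text \<open>The positive and negative parts of a Borel version of h are densities of two finite
  measures that agree on all right half-lines, hence coincide. The densities then agree almost
  everywhere, and the two parts of one function can only agree where both vanish.\<close>

lemma AE_zero_if_tail_integrals_zero: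
  fixes h :: "real \<Rightarrow> real"
  assumes h: "integrable lebesgue h" and z: "\<And>x. (LINT y|lebesgue. indicator {x<..} y * h y) = 0"
  shows "AE x in lebesgue. h x = 0"
proof -
  have "h \<in> borel_measurable lebesgue" using h by auto
  then obtain g where g[measurable]: "g \<in> borel_measurable lborel" and gh: "AE x in lborel. h x = g x"
    using completion_ex_borel_measurable_real by blast
  have gh': "AE x in lebesgue. h x = g x" using gh by (rule AE_completion)
  have gi: "integrable lborel g"
    using integrable_cong_AE[of h lebesgue g] h gh' measurable_completion[OF g]
    by (simp add: integrable_completion)
  have gz: "(LINT y|lborel. indicator {x<..} y * g y) = 0" for x
  proof -
    have "(LINT y|lborel. indicator {x<..} y * g y) = (LINT y|lebesgue. indicator {x<..} y * g y)"
      by (subst integral_completion) auto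
    also have "\<dots> = (LINT y|lebesgue. indicator {x<..} y * h y)"
    proof (rule integral_cong_AE)
      show "(\<lambda>y. indicator {x<..} y * g y) \<in> borel_measurable lebesgue"
        by (rule measurable_completion) measurable
      have "(indicator {x<..} :: real \<Rightarrow> real) \<in> borel_measurable lebesgue"
        by (rule measurable_completion) measurable
      then show "(\<lambda>y. indicator {x<..} y * h y) \<in> borel_measurable lebesgue"
        using \<open>h \<in> borel_measurable lebesgue\<close> by (rule borel_measurable_times)
    qed (use gh' in auto)
    finally show ?thesis using z by simp
  qed
  have tl: "emeasure (density lborel (\<lambda>y. ennreal (f y))) {x<..} = ennreal (LINT y|lborel. indicator {x<..} y * f y)"
    if f: "integrable lborel f" "\<And>y. 0 \<le> f y" for f :: "real \<Rightarrow> real" and x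
  proof -
    have "emeasure (density lborel (\<lambda>y. ennreal (f y))) {x<..} = (\<integral>\<^sup>+y. ennreal (indicator {x<..} y * f y) \<partial>lborel)"
      using f by (subst emeasure_density) (auto intro!: nn_integral_cong simp: indicator_def)
    also have "\<dots> = ennreal (LINT y|lborel. indicator {x<..} y * f y)"
      using f integrable_real_mult_indicator[of "{x<..}" lborel f]
      by (intro nn_integral_eq_integral) (auto simp: mult.commute)
    finally show ?thesis .
  qed
  define gp where "gp = (\<lambda>y. max 0 (g y))"
  define gm where "gm = (\<lambda>y. max 0 (- g y))"
  have [measurable]: "gp \<in> borel_measurable lborel" "gm \<in> borel_measurable lborel"
    unfolding gp_def gm_def by measurable
  have gpi: "integrable lborel gp" and gmi: "integrable lborel gm"
    unfolding gp_def gm_def using gi by (auto intro!: integrable_max)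
  have eq: "(LINT y|lborel. indicator {x<..} y * gp y) = (LINT y|lborel. indicator {x<..} y * gm y)" for x
  proof -
    have "(LINT y|lborel. indicator {x<..} y * gp y) - (LINT y|lborel. indicator {x<..} y * gm y)
      = (LINT y|lborel. indicator {x<..} y * gp y - indicator {x<..} y * gm y)"
      using gpi gmi integrable_real_mult_indicator[of "{x<..}" lborel]
      by (intro Bochner_Integration.integral_diff[symmetric]) (auto simp: mult.commute)
    also have "\<dots> = (LINT y|lborel. indicator {x<..} y * g y)"
      by (intro Bochner_Integration.integral_cong) (auto simp: gp_def gm_def indicator_def)
    finally show ?thesis using gz by simp
  qed
  have "density lborel (\<lambda>y. ennreal (gp y)) = density lborel (\<lambda>y. ennreal (gm y))"
  proof (rule measure_eqI_lessThan)
    show "emeasure (density lborel (\<lambda>y. ennreal (gp y))) {x<..} < \<infinity>" for x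
      using gpi by (subst tl) (auto simp: gp_def)
    show "emeasure (density lborel (\<lambda>y. ennreal (gp y))) {x<..} = emeasure (density lborel (\<lambda>y. ennreal (gm y))) {x<..}" for x
      using gpi gmi by (subst (1 2) tl) (auto simp: gp_def gm_def eq[unfolded gp_def gm_def])
  qed auto
  then have "AE y in lborel. ennreal (gp y) = ennreal (gm y)"
    by (intro sigma_finite_measure.density_unique[OF lborel.sigma_finite_measure_axioms]) auto
  then have "AE y in lborel. g y = 0"
    by (rule AE_mp) (auto simp: gp_def gm_def max_def split: if_splits)
  then have "AE y in lebesgue. g y = 0" by (rule AE_completion)
  with gh' show ?thesis by auto
qed

text \<open>The fundamental lemma of the calculus of variations. Bumps approximate indicators of
  intervals compactly inside \<open>{a<..<b}\<close>; exhausting the part of \<open>{a<..<b}\<close>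
  to the right of x by such intervals makes every tail integral vanish.\<close>

lemma AE_zero_if_orthogonal_to_test_functions:
  assumes h: "L2R h" and z: "\<And>x. x \<notin> {a<..<b} \<Longrightarrow> h x = 0"
    and o: "\<And>\<phi>. \<phi> \<in> test_functions {a<..<b} \<Longrightarrow> (LINT x|lebesgue. h x * \<phi> x) = 0"
  shows "AE x in lebesgue. h x = 0"
proof -
  have m[measurable]: "h \<in> borel_measurable lebesgue" using h by (rule L2R_measurable)
  have ind: "(\<lambda>x::real. (indicator {a..b} x)\<^sup>2) = (indicator {a..b} :: real \<Rightarrow> real)"
    by (auto simp: indicator_def)
  have "L2R (indicator {a..b} :: real \<Rightarrow> real)"
    unfolding L2R_def ind
    by (auto intro!: measurable_completion integrable_real_indicator simp: emeasure_lborel_Icc_eq)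
  with h have "integrable lebesgue (\<lambda>x. h x * indicator {a..b} x)"
    by (rule L2R_integrable_mult)
  also have "(\<lambda>x. h x * indicator {a..b} x) = h"
  proof
    show "h x * indicator {a..b} x = h x" for x using z[of x] by (cases "x \<in> {a<..<b}") auto
  qed
  finally have hi: "integrable lebesgue h" .
  have lim: "(LINT y|lebesgue. h y * indicator {c<..<d} y) = 0" if "{c..d} \<subseteq> {a<..<b}" for c d
  proof -
    have "(\<lambda>n. LINT y|lebesgue. h y * bump c d n y) \<longlonglongrightarrow> (LINT y|lebesgue. h y * indicator {c<..<d} y)"
    proof (rule integral_dominated_convergence[of _ _ _ "\<lambda>x. \<bar>h x\<bar>"])
      show "(\<lambda>x. h x * bump c d n x) \<in> borel_measurable lebesgue" for n
        using L2R_measurable[OF test_functions_L2R[OF bump_test_function[OF that]]] by measurable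
      show "AE x in lebesgue. (\<lambda>n. h x * bump c d n x) \<longlonglongrightarrow> h x * indicator {c<..<d} x"
        by (intro AE_I2 tendsto_mult tendsto_const bump_tendsto)
      show "AE x in lebesgue. norm (h x * bump c d n x) \<le> \<bar>h x\<bar>" for n
        by (intro AE_I2) (simp add: abs_mult bump_bound mult_left_le)
      show "(\<lambda>x. h x * indicator {c<..<d} x) \<in> borel_measurable lebesgue"
        by (intro borel_measurable_times m) (auto intro: measurable_completion)
    qed (use hi in auto)
    moreover have "(LINT y|lebesgue. h y * bump c d n y) = 0" for n
      by (rule o[OF bump_test_function[OF that]])
    ultimately show ?thesis by (simp add: LIMSEQ_const_iff)
  qed
  show ?thesis
  proof (rule AE_zero_if_tail_integrals_zero[OF hi])
    fix x
    define c where "c = max a x"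
    show "(LINT y|lebesgue. indicator {x<..} y * h y) = 0"
    proof (cases "c < b")
      case False
      then have "(\<lambda>y. indicator {x<..} y * h y) = (\<lambda>y. 0)"
        using z by (auto simp: c_def indicator_def fun_eq_iff)
      then show ?thesis by simp
    next
      case True
      \<comment> \<open>The summand 3 keeps \<open>e n\<close> at most a third of the length, so the
        trimmed interval is nonempty and its closure lies inside \<open>{a<..<b}\<close>.\<close>
      define e where "e = (\<lambda>n::nat. (b - c) / (real n + 3))"
      have e: "e n > 0" "c + e n < b - e n" for n
      proof -
        show "e n > 0" using True by (simp add: e_def)
        have "e n \<le> (b - c) / 3" unfolding e_def using True by (intro divide_left_mono) auto
        then show "c + e n < b - e n" using True by (simp add: field_simps)
      qed
      have e0: "e \<longlonglongrightarrow> 0" unfolding e_def by real_asymp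
      have "(\<lambda>n. LINT y|lebesgue. h y * indicator {c + e n<..<b - e n} y) \<longlonglongrightarrow> (LINT y|lebesgue. indicator {x<..} y * h y)"
      proof (rule integral_dominated_convergence[of _ _ _ "\<lambda>x. \<bar>h x\<bar>"])
        show "AE y in lebesgue. (\<lambda>n. h y * indicator {c + e n<..<b - e n} y) \<longlonglongrightarrow> indicator {x<..} y * h y"
        proof (rule AE_I2)
          fix y
          show "(\<lambda>n. h y * indicator {c + e n<..<b - e n} y) \<longlonglongrightarrow> indicator {x<..} y * h y"
          proof (cases "c < y \<and> y < b")
            case True
            have "(\<lambda>n. c + e n) \<longlonglongrightarrow> c + 0" "(\<lambda>n. b - e n) \<longlonglongrightarrow> b - 0"
              by (intro tendsto_intros e0)+
            then have "eventually (\<lambda>n. c + e n < y) sequentially" "eventually (\<lambda>n. b - e n > y) sequentially"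
              using True by (auto dest: order_tendstoD)
            then have "eventually (\<lambda>n. h y = h y * indicator {c + e n<..<b - e n} y) sequentially"
              by eventually_elim auto
            then have "(\<lambda>n. h y * indicator {c + e n<..<b - e n} y) \<longlonglongrightarrow> h y"
              by (rule Lim_transform_eventually[OF tendsto_const])
            then show ?thesis using True by (simp add: c_def)
          next
            case False
            have i: "y \<notin> {c + e n<..<b - e n}" for n
              using False e(1)[of n] by auto
            have "indicator {x<..} y * h y = 0"
              using False z[of y] by (cases "y \<le> x") (auto simp: c_def)
            moreover have "(\<lambda>n. h y * indicator {c + e n<..<b - e n} y) = (\<lambda>n. 0)"
              using i by (simp add: fun_eq_iff)
            ultimately show ?thesis by (simp only: tendsto_const)
          qed
        qed
        show "(\<lambda>y. indicator {x<..} y * h y) \<in> borel_measurable lebesgue"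
          by (intro borel_measurable_times m borel_measurable_indicator) simp
        show "(\<lambda>y. h y * indicator {c + e n<..<b - e n} y) \<in> borel_measurable lebesgue" for n
          by (intro borel_measurable_times m borel_measurable_indicator) simp
      qed (use hi in \<open>auto simp: abs_mult indicator_def\<close>)
      moreover have "(LINT y|lebesgue. h y * indicator {c + e n<..<b - e n} y) = 0" for n
        using e[of n] by (intro lim) (auto simp: c_def)
      ultimately show ?thesis by (simp add: LIMSEQ_const_iff)
    qed
  qed
qed

section \<open>The space of functions vanishing at the boundary\<close>

text \<open>The derivative g is an explicit argument and all integrals run over the whole line,
  which sidesteps the choice operator in \<open>weak_deriv\<close> and the restricted measures.
  Since u and g vanish outside U, extension by zero to a larger set is automatic.\<close>

definition sobolev0 :: "real set \<Rightarrow> (real \<Rightarrow> real) \<Rightarrow> (real \<Rightarrow> real) \<Rightarrow> bool" where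
  "sobolev0 U u g \<longleftrightarrow> L2R u \<and> L2R g \<and> (\<forall>x. x \<notin> U \<longrightarrow> u x = 0 \<and> g x = 0) \<and>
     (\<exists>\<phi>. (\<forall>n::nat. \<phi> n \<in> test_functions U) \<and> (\<lambda>n. nsq (\<lambda>x. \<phi> n x - u x)) \<longlonglongrightarrow> 0 \<and>
        (\<lambda>n. nsq (\<lambda>x. deriv (\<phi> n) x - g x)) \<longlonglongrightarrow> 0)"

lemma sobolev0_L2R: "sobolev0 U u g \<Longrightarrow> L2R u" "sobolev0 U u g \<Longrightarrow> L2R g"
  by (auto simp: sobolev0_def)

lemma sobolev0_zero_outside: "sobolev0 U u g \<Longrightarrow> x \<notin> U \<Longrightarrow> u x = 0" "sobolev0 U u g \<Longrightarrow> x \<notin> U \<Longrightarrow> g x = 0"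
  by (auto simp: sobolev0_def)

text \<open>The set V carrying the test function is unrelated to U. Passing to the limit in
  \<open>test_functions_by_parts\<close> thus shows that g remains the weak derivative of the zero
  extension on larger sets.\<close>

lemma sobolev0_by_parts:
  assumes "sobolev0 U u g" "\<theta> \<in> test_functions V"
  shows "(LINT x|lebesgue. u x * deriv \<theta> x) = - (LINT x|lebesgue. g x * \<theta> x)"
proof -
  obtain \<phi> where \<phi>: "\<And>n. \<phi> n \<in> test_functions U" "(\<lambda>n. nsq (\<lambda>x. \<phi> n x - u x)) \<longlonglongrightarrow> 0"
    "(\<lambda>n. nsq (\<lambda>x. deriv (\<phi> n) x - g x)) \<longlonglongrightarrow> 0"
    using assms(1) unfolding sobolev0_def by blast
  note L = sobolev0_L2R[OF assms(1)] test_functions_L2R[OF \<phi>(1)]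
    test_functions_L2R[OF test_functions_deriv[OF \<phi>(1)]]
    test_functions_L2R[OF assms(2)] test_functions_L2R[OF test_functions_deriv[OF assms(2)]]
  have "(\<lambda>n. LINT x|lebesgue. \<phi> n x * deriv \<theta> x) \<longlonglongrightarrow> (LINT x|lebesgue. u x * deriv \<theta> x)"
    by (intro L2_tendsto_integral_mult L \<phi>)
  moreover have "(\<lambda>n. - (LINT x|lebesgue. deriv (\<phi> n) x * \<theta> x)) \<longlonglongrightarrow> - (LINT x|lebesgue. g x * \<theta> x)"
    by (intro tendsto_minus L2_tendsto_integral_mult L \<phi>)
  ultimately show ?thesis
    by (simp add: test_functions_by_parts[OF \<phi>(1) assms(2)] LIMSEQ_unique)
qed

section \<open>Comparison with the weak derivative on an interval\<close>

lemma L2_space_iff: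
  assumes "U \<in> sets lebesgue"
  shows "f \<in> L2_space U \<longleftrightarrow> L2R (\<lambda>x. indicator U x * f x)"
proof -
  have "(\<lambda>x. (indicator U x * f x)\<^sup>2) = (\<lambda>x. indicator U x *\<^sub>R (f x)\<^sup>2)"
    by (auto simp: indicator_def)
  then show ?thesis
    using assms integrable_restrict_space[of U lebesgue "\<lambda>x. (f x)\<^sup>2"]
      borel_measurable_restrict_space_iff[of U lebesgue f]
    by (simp add: L2_space_def L2R_def)
qed

lemma integral_lebesgue_on:
  fixes f :: "real \<Rightarrow> real"
  assumes "U \<in> sets lebesgue"
  shows "integral\<^sup>L (lebesgue_on U) f = (LINT x|lebesgue. indicator U x * f x)"
  using integral_restrict_space[of U lebesgue f] assms by simp

text \<open>The energy differentiates on all of \<Omega> although u lives on one cell. As g is a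
  weak derivative there too, uniqueness identifies the representative picked by
  \<open>weak_deriv\<close> with g almost everywhere.\<close>

lemma sobolev0_weak_deriv:
  assumes s: "sobolev0 U u g" and U: "U \<subseteq> {a<..<b}"
  shows "u \<in> L2_space {a<..<b}"
    and "g \<in> L2_space {a<..<b} \<and> is_weak_deriv {a<..<b} u g"
    and "AE x in lebesgue. indicator {a<..<b} x * weak_deriv {a<..<b} u x = g x"
    and "weak_deriv {a<..<b} u \<in> L2_space {a<..<b}"
proof -
  let ?V = "{a<..<b}"
  have [simp]: "?V \<in> sets lebesgue" by simp
  have iu: "(\<lambda>x. indicator ?V x * u x) = u" and ig: "(\<lambda>x. indicator ?V x * g x) = g"
    using sobolev0_zero_outside[OF s] U by (fastforce simp: indicator_def fun_eq_iff)+
  have wd: "is_weak_deriv ?V u g' \<longleftrightarrow> (\<forall>\<phi>\<in>test_functions ?V.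
      (LINT x|lebesgue. g x * \<phi> x) = (LINT x|lebesgue. indicator ?V x * g' x * \<phi> x))" for g'
  proof -
    have "(LINT x|lebesgue. indicator ?V x * (u x * deriv \<phi> x)) = (LINT x|lebesgue. u x * deriv \<phi> x)" for \<phi>
      using fun_cong[OF iu] by (simp only: flip: mult.assoc)
    then show ?thesis
      unfolding is_weak_deriv_def
      by (simp add: integral_lebesgue_on sobolev0_by_parts[OF s] mult.assoc)
  qed
  show "u \<in> L2_space ?V" by (simp add: L2_space_iff iu sobolev0_L2R[OF s])
  show G: "g \<in> L2_space ?V \<and> is_weak_deriv ?V u g"
    using fun_cong[OF ig] by (simp only: wd L2_space_iff[OF \<open>?V \<in> sets lebesgue\<close>] sobolev0_L2R[OF s]) simp
  define g' where "g' = weak_deriv ?V u"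
  have "g' \<in> L2_space ?V \<and> is_weak_deriv ?V u g'"
    unfolding g'_def weak_deriv_def by (rule someI[of _ g]) (rule G)
  then have g': "L2R (\<lambda>x. indicator ?V x * g' x)" "is_weak_deriv ?V u g'" "g' \<in> L2_space ?V"
    by (auto simp: L2_space_iff)
  show "weak_deriv ?V u \<in> L2_space ?V" using g'(3) by (simp add: g'_def)
  have "AE x in lebesgue. indicator ?V x * g' x - g x = 0"
  proof (rule AE_zero_if_orthogonal_to_test_functions)
    show "L2R (\<lambda>x. indicator ?V x * g' x - g x)"
      using g' sobolev0_L2R[OF s] by (intro L2R_diff)
    show "indicator ?V x * g' x - g x = 0" if "x \<notin> ?V" for x
      using that sobolev0_zero_outside[OF s, of x] U by (cases "x \<in> U") auto
    show "(LINT x|lebesgue. (indicator ?V x * g' x - g x) * \<phi> x) = 0" if "\<phi> \<in> test_functions ?V" for \<phi>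
      using g' that sobolev0_L2R[OF s] test_functions_L2R[OF that] L2R_integrable_mult[OF g'(1), of \<phi>]
      by (simp add: left_diff_distrib L2R_integrable_mult wd)
  qed
  then show "AE x in lebesgue. indicator ?V x * weak_deriv ?V u x = g x"
    by (simp add: g'_def)
qed

text \<open>Forward, g is the chosen weak derivative cut off outside the interval; backward,
  uniqueness allows g to be exchanged for the chosen one inside the norms.\<close>

lemma H10_iff_sobolev0: "u \<in> H10 {c<..<d} \<longleftrightarrow> (\<exists>g. sobolev0 {c<..<d} u g)"
proof
  let ?U = "{c<..<d}"
  have [simp]: "?U \<in> sets lebesgue" by simp
  have on: "integral\<^sup>L (lebesgue_on ?U) (\<lambda>x. (f x)\<^sup>2) = nsq (\<lambda>x. indicator ?U x * f x)" for f :: "real \<Rightarrow> real"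
    unfolding nsq_def integral_lebesgue_on[OF \<open>?U \<in> sets lebesgue\<close>]
    by (intro Bochner_Integration.integral_cong) (auto simp: indicator_def)
  have phi0: "indicator ?U x * \<phi> x = \<phi> x" if "\<phi> \<in> test_functions ?U" for \<phi> x
    using test_functions_zero[OF that, of x] by (auto simp: indicator_def)
  {
    assume u: "u \<in> H10 ?U"
    then have uL: "u \<in> L2_space ?U" and ex: "\<exists>g\<in>L2_space ?U. is_weak_deriv ?U u g"
      and u0: "\<And>x. x \<notin> ?U \<Longrightarrow> u x = 0"
      by (auto simp: H10_def H1_def)
    define g where "g = weak_deriv ?U u"
    have g: "g \<in> L2_space ?U" "is_weak_deriv ?U u g"
      unfolding g_def weak_deriv_def using ex by (metis (mono_tags, lifting) someI_ex)+
    obtain \<phi> where \<phi>: "\<And>n::nat. \<phi> n \<in> test_functions ?U"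
        "(\<lambda>n. nsq (\<lambda>x. indicator ?U x * (\<phi> n x - u x)) + nsq (\<lambda>x. indicator ?U x * (deriv (\<phi> n) x - g x))) \<longlonglongrightarrow> 0"
      using u unfolding H10_def g_def by (auto simp: on)
    have iu: "indicator ?U x * u x = u x" for x using u0[of x] by (auto simp: indicator_def)
    have lim: "(\<lambda>n. nsq (\<lambda>x. \<phi> n x - u x) + nsq (\<lambda>x. deriv (\<phi> n) x - indicator ?U x * g x)) \<longlonglongrightarrow> 0"
      using \<phi>(2) by (simp add: right_diff_distrib iu phi0[OF \<phi>(1)] phi0[OF test_functions_deriv[OF \<phi>(1)]])
    have "(\<lambda>n. nsq (\<lambda>x. \<phi> n x - u x)) \<longlonglongrightarrow> 0" "(\<lambda>n. nsq (\<lambda>x. deriv (\<phi> n) x - indicator ?U x * g x)) \<longlonglongrightarrow> 0"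
      by (rule Lim_null_comparison[OF _ lim]; simp)+
    then have "sobolev0 ?U u (\<lambda>x. indicator ?U x * g x)"
      using uL g(1) u0 \<phi>(1) unfolding sobolev0_def
      by (auto simp: L2_space_iff iu)
    then show "\<exists>g. sobolev0 ?U u g" by blast
  next
    assume "\<exists>g. sobolev0 ?U u g"
    then obtain g where s: "sobolev0 ?U u g" by blast
    note w = sobolev0_weak_deriv[OF s order_refl]
    obtain \<phi> where \<phi>: "\<And>n. \<phi> n \<in> test_functions ?U" "(\<lambda>n. nsq (\<lambda>x. \<phi> n x - u x)) \<longlonglongrightarrow> 0"
      "(\<lambda>n. nsq (\<lambda>x. deriv (\<phi> n) x - g x)) \<longlonglongrightarrow> 0"
      using s unfolding sobolev0_def by blast
    have iu: "indicator ?U x * u x = u x" for x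
      using sobolev0_zero_outside[OF s, of x] by (auto simp: indicator_def)
    have "nsq (\<lambda>x. indicator ?U x * (deriv (\<phi> n) x - weak_deriv ?U u x)) = nsq (\<lambda>x. deriv (\<phi> n) x - g x)" for n
    proof (rule nsq_cong_AE)
      have L: "L2R (\<lambda>x. indicator ?U x * weak_deriv ?U u x)" using w(4) by (simp add: L2_space_iff)
      note d = test_functions_deriv[OF \<phi>(1)]
      show "(\<lambda>x. indicator ?U x * (deriv (\<phi> n) x - weak_deriv ?U u x)) \<in> borel_measurable lebesgue"
        using L2R_diff[OF test_functions_L2R[OF d] L]
        by (simp add: right_diff_distrib phi0[OF d] L2R_measurable)
      show "(\<lambda>x. deriv (\<phi> n) x - g x) \<in> borel_measurable lebesgue"
        using L2R_diff[OF test_functions_L2R[OF d] sobolev0_L2R(2)[OF s]] by (rule L2R_measurable)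
      show "AE x in lebesgue. indicator ?U x * (deriv (\<phi> n) x - weak_deriv ?U u x) = deriv (\<phi> n) x - g x"
        using w(3) by (rule AE_mp) (auto simp: right_diff_distrib phi0[OF d])
    qed
    then have "(\<lambda>n. integral\<^sup>L (lebesgue_on ?U) (\<lambda>x. (\<phi> n x - u x)\<^sup>2)
           + integral\<^sup>L (lebesgue_on ?U) (\<lambda>x. (deriv (\<phi> n) x - weak_deriv ?U u x)\<^sup>2)) \<longlonglongrightarrow> 0 + 0"
      using \<phi>(2,3) unfolding on
      by (intro tendsto_add) (simp_all add: right_diff_distrib iu phi0[OF \<phi>(1)])
    then show "u \<in> H10 ?U"
      using w(1,2) sobolev0_zero_outside(1)[OF s] \<phi>(1) unfolding H10_def H1_def by auto
  }
qed

section \<open>Linear combinations, affine substitution and the sup bound\<close>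

lemma sobolev0_zero: "sobolev0 U (\<lambda>x. 0) (\<lambda>x. 0)"
proof -
  have "(\<lambda>x. 0) \<in> test_functions U"
    by (rule test_functionsI[of _ "{}"]) (auto simp: diff_upto_const)
  then show ?thesis
    unfolding sobolev0_def by (auto intro!: exI[of _ "\<lambda>n x. 0"] simp: nsq_def)
qed

lemma nsq_add_tendsto_0:
  assumes "\<And>n. L2R (f n)" "\<And>n. L2R (g n)" "(\<lambda>n. nsq (f n)) \<longlonglongrightarrow> 0" "(\<lambda>n. nsq (g n)) \<longlonglongrightarrow> 0"
  shows "(\<lambda>n. nsq (\<lambda>x. f n x + c * g n x)) \<longlonglongrightarrow> 0"
proof (rule Lim_null_comparison)
  have "nsq (\<lambda>x. f n x + c * g n x) \<le> nsq (f n) / (1 - 1/2) + nsq (\<lambda>x. c * g n x) / (1/2)" for n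
    using assms(1,2) by (intro nsq_add_le L2R_scale) auto
  then show "\<forall>\<^sub>F n in sequentially. norm (nsq (\<lambda>x. f n x + c * g n x)) \<le> 2 * nsq (f n) + 2 * c\<^sup>2 * nsq (g n)"
    by (intro always_eventually) (simp add: nsq_scale mult_ac)
  have "(\<lambda>n. 2 * nsq (f n) + 2 * c\<^sup>2 * nsq (g n)) \<longlonglongrightarrow> 2 * 0 + 2 * c\<^sup>2 * 0"
    using assms(3,4) by (intro tendsto_intros)
  then show "(\<lambda>n. 2 * nsq (f n) + 2 * c\<^sup>2 * nsq (g n)) \<longlonglongrightarrow> 0" by simp
qed

lemma sobolev0_add_scale:
  assumes "sobolev0 U u g" "sobolev0 U v h"
  shows "sobolev0 U (\<lambda>x. u x + c * v x) (\<lambda>x. g x + c * h x)"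
proof -
  obtain \<phi> where \<phi>: "\<And>n. \<phi> n \<in> test_functions U" "(\<lambda>n. nsq (\<lambda>x. \<phi> n x - u x)) \<longlonglongrightarrow> 0"
    "(\<lambda>n. nsq (\<lambda>x. deriv (\<phi> n) x - g x)) \<longlonglongrightarrow> 0"
    using assms(1) unfolding sobolev0_def by blast
  obtain \<psi> where \<psi>: "\<And>n. \<psi> n \<in> test_functions U" "(\<lambda>n. nsq (\<lambda>x. \<psi> n x - v x)) \<longlonglongrightarrow> 0"
    "(\<lambda>n. nsq (\<lambda>x. deriv (\<psi> n) x - h x)) \<longlonglongrightarrow> 0"
    using assms(2) unfolding sobolev0_def by blast
  note L = sobolev0_L2R[OF assms(1)] sobolev0_L2R[OF assms(2)] test_functions_L2R[OF \<phi>(1)]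
    test_functions_L2R[OF test_functions_deriv[OF \<phi>(1)]] test_functions_L2R[OF \<psi>(1)]
    test_functions_L2R[OF test_functions_deriv[OF \<psi>(1)]]
  have d: "deriv (\<lambda>x. \<phi> n x + c * \<psi> n x) x = deriv (\<phi> n) x + c * deriv (\<psi> n) x" for n x
    using test_functions_has_deriv[OF \<phi>(1)[of n], of x] test_functions_has_deriv[OF \<psi>(1)[of n], of x]
    by (auto intro!: DERIV_imp_deriv derivative_eq_intros)
  show ?thesis
    unfolding sobolev0_def
  proof (intro conjI exI[of _ "\<lambda>n x. \<phi> n x + c * \<psi> n x"] allI impI)
    show "(\<lambda>n. nsq (\<lambda>x. \<phi> n x + c * \<psi> n x - (u x + c * v x))) \<longlonglongrightarrow> 0"
      using nsq_add_tendsto_0[OF L2R_diff[OF L(5,1)] L2R_diff[OF L(7,3)] \<phi>(2) \<psi>(2), of c]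
      by (simp add: algebra_simps)
    show "(\<lambda>n. nsq (\<lambda>x. deriv (\<lambda>x. \<phi> n x + c * \<psi> n x) x - (g x + c * h x))) \<longlonglongrightarrow> 0"
      using nsq_add_tendsto_0[OF L2R_diff[OF L(6,2)] L2R_diff[OF L(8,4)] \<phi>(3) \<psi>(3), of c]
      unfolding d by (simp add: algebra_simps)
  qed (use L sobolev0_zero_outside[OF assms(1)] sobolev0_zero_outside[OF assms(2)] \<phi>(1) \<psi>(1) in
      \<open>auto intro!: L2R_add L2R_scale test_functions_add test_functions_scale\<close>)
qed

lemma nsq_affine:
  assumes "s \<noteq> 0"
  shows "nsq (\<lambda>x. f (s * x + t)) = nsq f / \<bar>s\<bar>"
  using lebesgue_integral_real_affine[OF assms, of "\<lambda>x. (f x)\<^sup>2" t] assms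
  by (simp add: nsq_def add.commute)

lemma L2R_affine:
  assumes "L2R f" "s \<noteq> 0"
  shows "L2R (\<lambda>x. f (s * x + t))"
proof -
  have "(\<lambda>x. t + s * x) \<in> lebesgue \<rightarrow>\<^sub>M lebesgue"
    using lebesgue_affine_measurable[where c = "\<lambda>x::real. s"] assms by simp
  then have "(\<lambda>x. f (s * x + t)) \<in> borel_measurable lebesgue"
    using measurable_compose[OF _ L2R_measurable[OF assms(1)]] by (simp add: add.commute)
  moreover have "integrable lebesgue (\<lambda>x. (f (s * x + t))\<^sup>2)"
    using has_bochner_integral_lebesgue_real_affine_iff[OF assms(2), of "\<lambda>x. (f x)\<^sup>2" "nsq f" t]
      L2R_integrable_sq[OF assms(1)]
    by (auto simp: has_bochner_integral_iff nsq_def add.commute)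
  ultimately show ?thesis by (simp add: L2R_def)
qed

lemma sobolev0_affine:
  assumes "sobolev0 U u g" "s \<noteq> 0" "\<And>x. s * x + t \<in> U \<longleftrightarrow> x \<in> V"
  shows "sobolev0 V (\<lambda>x. u (s * x + t)) (\<lambda>x. s * g (s * x + t))"
proof -
  obtain \<phi> where \<phi>: "\<And>n. \<phi> n \<in> test_functions U" "(\<lambda>n. nsq (\<lambda>x. \<phi> n x - u x)) \<longlonglongrightarrow> 0"
    "(\<lambda>n. nsq (\<lambda>x. deriv (\<phi> n) x - g x)) \<longlonglongrightarrow> 0"
    using assms(1) unfolding sobolev0_def by blast
  show ?thesis
    unfolding sobolev0_def
  proof (intro conjI exI[of _ "\<lambda>n x. \<phi> n (s * x + t)"] allI impI)
    have "(\<lambda>n. nsq (\<lambda>x. \<phi> n x - u x) / \<bar>s\<bar>) \<longlonglongrightarrow> 0 / \<bar>s\<bar>"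
      using assms(2) by (intro tendsto_intros \<phi>(2)) auto
    then show "(\<lambda>n. nsq (\<lambda>x. \<phi> n (s * x + t) - u (s * x + t))) \<longlonglongrightarrow> 0"
      using nsq_affine[OF assms(2), of "\<lambda>x. \<phi> n x - u x" t for n] by simp
    have "(\<lambda>n. s\<^sup>2 * (nsq (\<lambda>x. deriv (\<phi> n) x - g x) / \<bar>s\<bar>)) \<longlonglongrightarrow> s\<^sup>2 * (0 / \<bar>s\<bar>)"
      using assms(2) by (intro tendsto_intros \<phi>(3)) auto
    then show "(\<lambda>n. nsq (\<lambda>x. deriv (\<lambda>x. \<phi> n (s * x + t)) x - s * g (s * x + t))) \<longlonglongrightarrow> 0"
      using nsq_affine[OF assms(2), of "\<lambda>x. deriv (\<phi> n) x - g x" t for n]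
      by (simp add: deriv_affine[OF \<phi>(1)] nsq_scale flip: right_diff_distrib)
    show "(\<lambda>x. \<phi> n (s * x + t)) \<in> test_functions V" for n
      using assms(2,3) by (intro test_functions_affine[OF \<phi>(1)]) auto
  qed (use sobolev0_L2R[OF assms(1)] sobolev0_zero_outside[OF assms(1)] assms(2,3) in
      \<open>auto intro!: L2R_scale L2R_affine\<close>)
qed

text \<open>Mean-square approximation converges almost everywhere only along a subsequence r, which
  is enough to pass the bound for test functions to the limit.\<close>

lemma sobolev0_sup_bound:
  assumes "sobolev0 {c<..<d} u g" "c < d"
  shows "AE x in lebesgue. (u x)\<^sup>2 \<le> (d - c) * nsq g"
proof -
  obtain \<phi> where \<phi>: "\<And>n. \<phi> n \<in> test_functions {c<..<d}" "(\<lambda>n. nsq (\<lambda>x. \<phi> n x - u x)) \<longlonglongrightarrow> 0"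
    "(\<lambda>n. nsq (\<lambda>x. deriv (\<phi> n) x - g x)) \<longlonglongrightarrow> 0"
    using assms(1) unfolding sobolev0_def by blast
  note L = sobolev0_L2R[OF assms(1)] test_functions_L2R[OF \<phi>(1)]
    test_functions_L2R[OF test_functions_deriv[OF \<phi>(1)]]
  have "integrable lebesgue (\<lambda>x. (\<phi> n x - u x)\<^sup>2)" for n
    by (intro L2R_integrable_sq L2R_diff L)
  from tendsto_L1_AE_subseq[of lebesgue "\<lambda>n x. (\<phi> n x - u x)\<^sup>2", OF this]
  obtain r where r: "strict_mono r" "AE x in lebesgue. (\<lambda>n. (\<phi> (r n) x - u x)\<^sup>2) \<longlonglongrightarrow> 0"
    using \<phi>(2) by (auto simp: nsq_def)
  have "(\<lambda>n. (d - c) * nsq (deriv (\<phi> n))) \<longlonglongrightarrow> (d - c) * nsq g"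
    by (intro tendsto_intros L2_tendsto_nsq L \<phi>)
  then have lim: "(\<lambda>n. (d - c) * nsq (deriv (\<phi> (r n)))) \<longlonglongrightarrow> (d - c) * nsq g"
    using r(1) by (rule LIMSEQ_subseq_LIMSEQ[unfolded o_def])
  from r(2) show ?thesis
  proof (rule AE_mp, intro AE_I2 impI)
    fix x assume "(\<lambda>n. (\<phi> (r n) x - u x)\<^sup>2) \<longlonglongrightarrow> 0"
    then have "(\<lambda>n. sqrt ((\<phi> (r n) x - u x)\<^sup>2)) \<longlonglongrightarrow> sqrt 0" by (rule tendsto_real_sqrt)
    then have "(\<lambda>n. \<phi> (r n) x) \<longlonglongrightarrow> u x"
      by (simp add: tendsto_rabs_zero_iff LIM_zero_iff)
    then have "(\<lambda>n. (\<phi> (r n) x)\<^sup>2) \<longlonglongrightarrow> (u x)\<^sup>2" by (rule tendsto_power)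
    then show "(u x)\<^sup>2 \<le> (d - c) * nsq g"
      using lim test_functions_sup_bound[OF \<phi>(1) assms(2)]
      by (intro LIMSEQ_le) auto
  qed
qed

section \<open>Mountain pass levels\<close>

text \<open>The condition on a says that \<open>x powr a\<close> is convex on the positive
  axis.\<close>

lemma powr_above_tangent:
  fixes x y a :: real
  assumes "x > 0" "y > 0" "0 \<le> a * (a - 1)"
  shows "a * x powr (a - 1) * (y - x) \<le> y powr a - x powr a"
proof (rule f''_imp_f'[of "{0<..}" "\<lambda>x. x powr a" "\<lambda>x. a * x powr (a - 1)" "\<lambda>x. a * ((a - 1) * x powr (a - 1 - 1))"])
  show "((\<lambda>x. x powr a) has_real_derivative a * x powr (a - 1)) (at x)" if "x \<in> {0<..}" for x
    using that by (auto intro!: derivative_eq_intros)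
  show "((\<lambda>x. a * x powr (a - 1)) has_real_derivative a * ((a - 1) * x powr (a - 1 - 1))) (at x)" if "x \<in> {0<..}" for x
    using that by (auto intro!: derivative_eq_intros)
  show "0 \<le> a * ((a - 1) * x powr (a - 1 - 1))" if "x \<in> {0<..}" for x
    using assms(3) by (simp flip: mult.assoc)
qed (use assms in auto)

text \<open>Convexity of the power r applied to x + y = (1 - \<theta>) * (x / (1 - \<theta>)) +
  \<theta> * (y / \<theta>). It is the analogue of \<open>nsq_add_le\<close> for general
  powers.\<close>

lemma powr_add_le:
  fixes x y r \<theta> :: real
  assumes "0 \<le> x" "0 \<le> y" "1 \<le> r" "0 < \<theta>" "\<theta> < 1"
  shows "(x + y) powr r \<le> (1 - \<theta>) powr (1 - r) * x powr r + \<theta> powr (1 - r) * y powr r"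
proof -
  have one: "1 \<le> t powr (1 - r)" if "0 < t" "t < 1" for t :: real
    using that assms(3) powr_mono2'[of "1 - r" t 1] by simp
  have sc: "t * (x / t) powr r = t powr (1 - r) * x powr r" if "0 < t" "0 \<le> x" for t x :: real
    using that by (simp add: powr_divide powr_diff)
  consider "x = 0" | "y = 0" | "x > 0" "y > 0" using assms by linarith
  then show ?thesis
  proof cases
    case 1
    then show ?thesis using one[of \<theta>] assms by (simp add: mult_le_cancel_right1)
  next
    case 2
    then show ?thesis using one[of "1 - \<theta>"] assms by (simp add: mult_le_cancel_right1)
  next
    case 3
    have "((1 - \<theta>) *\<^sub>R (x / (1 - \<theta>)) + \<theta> *\<^sub>R (y / \<theta>)) powr r
        \<le> (1 - \<theta>) * (x / (1 - \<theta>)) powr r + \<theta> * (y / \<theta>) powr r"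
      using assms 3 by (intro convex_onD[OF powr_convex[OF assms(3)]]) auto
    then show ?thesis using assms 3 by (simp add: sc)
  qed
qed

text \<open>For positive A and B this is the maximum over t \<ge> 0 of
  \<open>t^2 * A / 2 - t powr (p + 1) * B / (p + 1)\<close>: the unforced energy along a ray whose
  direction has Dirichlet integral A and power integral B. The maximum sits at
  \<open>(A / B) powr (1 / (p - 1))\<close>.\<close>

definition mp_level :: "real \<Rightarrow> real \<Rightarrow> real \<Rightarrow> real" where
  "mp_level p A B = (1 / 2 - 1 / (p + 1)) * (A * (A / B) powr (2 / (p - 1)))"

lemma mp_level_nonneg: "1 < p \<Longrightarrow> 0 \<le> A \<Longrightarrow> 0 \<le> mp_level p A B"
  unfolding mp_level_def by (intro mult_nonneg_nonneg) (auto simp: field_simps)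

lemma mp_level_attained:
  assumes "1 < p" "0 < A" "0 < B"
  shows "\<exists>t\<ge>0. 1 / 2 * (t\<^sup>2 * A) - 1 / (p + 1) * (t powr (p + 1) * B) = mp_level p A B"
proof (intro exI[of _ "(A / B) powr (1 / (p - 1))"] conjI)
  let ?t = "(A / B) powr (1 / (p - 1))"
  have t2: "?t\<^sup>2 = (A / B) powr (2 / (p - 1))"
    using assms by (simp add: powr_powr flip: powr_numeral)
  have "?t powr (p + 1) = ?t powr (p - 1) * ?t powr 2"
    using powr_add[of ?t "p - 1" 2] by (simp add: add.commute)
  also have "?t powr (p - 1) = A / B" using assms by (simp add: powr_powr)
  finally have "?t powr (p + 1) * B = ?t\<^sup>2 * A" using assms by simp
  then show "1 / 2 * (?t\<^sup>2 * A) - 1 / (p + 1) * (?t powr (p + 1) * B) = mp_level p A B"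
    unfolding mp_level_def t2 by (simp add: algebra_simps)
qed simp

text \<open>Once t is divided by the maximizer, the profile depends on \<tau> alone, and the claim
  becomes the tangent inequality at 1 for the power (p + 1) / 2, evaluated at the square of
  \<tau>.\<close>

lemma mp_level_max:
  assumes "1 < p" "0 < A" "0 < B" "0 \<le> t"
  shows "1 / 2 * (t\<^sup>2 * A) - 1 / (p + 1) * (t powr (p + 1) * B) \<le> mp_level p A B"
proof (cases "t = 0")
  case True
  then show ?thesis using mp_level_nonneg assms by simp
next
  case False
  let ?s = "(A / B) powr (1 / (p - 1))"
  define \<tau> where "\<tau> = t / ?s"
  have s: "?s > 0" using assms by simp
  have \<tau>: "\<tau> > 0" and t: "t = \<tau> * ?s" using False assms s by (auto simp: \<tau>_def)
  have s2: "?s\<^sup>2 = (A / B) powr (2 / (p - 1))"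
    using assms by (simp add: powr_powr flip: powr_numeral)
  have "?s powr (p + 1) = ?s powr (p - 1) * ?s powr 2"
    using powr_add[of ?s "p - 1" 2] by (simp add: add.commute)
  also have "?s powr (p - 1) = A / B" using assms by (simp add: powr_powr)
  finally have sp: "?s powr (p + 1) * B = ?s\<^sup>2 * A" using assms by simp
  have "(p + 1) / 2 * (\<tau>\<^sup>2 - 1) \<le> (\<tau>\<^sup>2) powr ((p + 1) / 2) - 1"
    using powr_above_tangent[of 1 "\<tau>\<^sup>2" "(p + 1) / 2"] \<tau> assms by simp
  also have "(\<tau>\<^sup>2) powr ((p + 1) / 2) = \<tau> powr (p + 1)"
    using \<tau> by (simp add: powr_powr add_divide_distrib flip: powr_numeral)
  finally have "1 / (p + 1) * ((p + 1) / 2 * (\<tau>\<^sup>2 - 1)) \<le> 1 / (p + 1) * (\<tau> powr (p + 1) - 1)"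
    using assms by (intro mult_left_mono) auto
  also have "1 / (p + 1) * ((p + 1) / 2 * (\<tau>\<^sup>2 - 1)) = 1 / 2 * (\<tau>\<^sup>2 - 1)" using assms by simp
  finally have "1 / 2 * \<tau>\<^sup>2 - 1 / (p + 1) * \<tau> powr (p + 1) \<le> 1 / 2 - 1 / (p + 1)"
    unfolding right_diff_distrib by linarith
  then have "(1 / 2 * \<tau>\<^sup>2 - 1 / (p + 1) * \<tau> powr (p + 1)) * (?s\<^sup>2 * A) \<le> (1 / 2 - 1 / (p + 1)) * (?s\<^sup>2 * A)"
    using assms by (intro mult_right_mono) auto
  moreover have "t powr (p + 1) * B = \<tau> powr (p + 1) * (?s\<^sup>2 * A)"
    unfolding t using \<tau> s sp by (simp add: powr_mult)
  moreover have "t\<^sup>2 * A = \<tau>\<^sup>2 * (?s\<^sup>2 * A)" by (subst t) (simp add: power_mult_distrib)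
  moreover have "(1 / 2 - 1 / (p + 1)) * (?s\<^sup>2 * A) = mp_level p A B"
    unfolding mp_level_def s2 by (simp add: mult.commute)
  ultimately show ?thesis by (simp only: left_diff_distrib mult.assoc)
qed

lemma mp_level_scale:
  assumes "0 < \<alpha>" "0 < \<beta>" "0 < A" "0 < B"
  shows "mp_level p (\<alpha> * A) (\<beta> * B) = \<alpha> * (\<alpha> / \<beta>) powr (2 / (p - 1)) * mp_level p A B"
proof -
  have "(\<alpha> * A) / (\<beta> * B) = (\<alpha> / \<beta>) * (A / B)" by simp
  then show ?thesis unfolding mp_level_def using assms by (simp only: powr_mult) (simp add: mult_ac)
qed

section \<open>Estimates for the energy\<close>

definition pint :: "real \<Rightarrow> (real \<Rightarrow> real) \<Rightarrow> real" where
  "pint r u = (LINT x|lebesgue. \<bar>u x\<bar> powr r)"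

lemma pint_nonneg [simp]: "0 \<le> pint r u"
  by (simp add: pint_def)

lemma pint_scale: "pint r (\<lambda>x. c * u x) = \<bar>c\<bar> powr r * pint r u"
  by (simp add: pint_def abs_mult powr_mult)

lemma pint_affine:
  assumes "s \<noteq> 0"
  shows "pint r (\<lambda>x. f (s * x + t)) = pint r f / \<bar>s\<bar>"
  using lebesgue_integral_real_affine[OF assms, of "\<lambda>x. \<bar>f x\<bar> powr r" t] assms
  by (simp add: pint_def add.commute)

lemma sobolev0_powr_integrable:
  assumes s: "sobolev0 {c<..<d} u g" and "c < d" "0 < r"
  shows "integrable lebesgue (\<lambda>x. \<bar>u x\<bar> powr r)"
    and "pint r u \<le> (d - c) * ((d - c) * nsq g) powr (r / 2)"
proof -
  let ?M = "((d - c) * nsq g) powr (r / 2)"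
  have "emeasure lborel {c<..<d} < \<infinity>" using \<open>c < d\<close> by simp
  then have ii: "integrable lebesgue (\<lambda>x. indicator {c<..<d} x * ?M)"
    using \<open>c < d\<close> by (intro integrable_mult_left integrable_real_indicator) auto
  have b: "AE x in lebesgue. \<bar>u x\<bar> powr r \<le> indicator {c<..<d} x * ?M"
    using sobolev0_sup_bound[OF s \<open>c < d\<close>]
  proof (rule AE_mp, intro AE_I2 impI)
    fix x assume *: "(u x)\<^sup>2 \<le> (d - c) * nsq g"
    show "\<bar>u x\<bar> powr r \<le> indicator {c<..<d} x * ?M"
    proof (cases "x \<in> {c<..<d}")
      case False
      then show ?thesis using sobolev0_zero_outside(1)[OF s False] by simp
    next
      case True
      have "\<bar>u x\<bar> powr r = (\<bar>u x\<bar> powr 2) powr (r / 2)" by (subst powr_powr) simp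
      also have "\<bar>u x\<bar> powr 2 = (u x)\<^sup>2" by (cases "u x = 0") (auto simp: powr_numeral)
      also have "((u x)\<^sup>2) powr (r / 2) \<le> ?M" using * \<open>0 < r\<close> by (intro powr_mono2) auto
      finally show ?thesis using True by simp
    qed
  qed
  have [measurable]: "u \<in> borel_measurable lebesgue" using sobolev0_L2R(1)[OF s] by (rule L2R_measurable)
  show i: "integrable lebesgue (\<lambda>x. \<bar>u x\<bar> powr r)"
    by (rule Bochner_Integration.integrable_bound[OF ii]) (use b in \<open>auto elim!: AE_mp\<close>)
  have "pint r u \<le> (LINT x|lebesgue. indicator {c<..<d} x * ?M)"
    unfolding pint_def by (rule integral_mono_AE[OF i ii b])
  also have "\<dots> = (d - c) * ?M" using \<open>c < d\<close> by simp
  finally show "pint r u \<le> (d - c) * ?M" .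
qed

lemma sobolev0_nsq_bound:
  assumes s: "sobolev0 {c<..<d} u g" and "c < d"
  shows "nsq u \<le> (d - c)\<^sup>2 * nsq g"
proof -
  have "nsq u = pint 2 u"
    unfolding nsq_def pint_def by (intro Bochner_Integration.integral_cong) (auto simp: powr_numeral)
  also have "\<dots> \<le> (d - c) * ((d - c) * nsq g) powr (2 / 2)"
    by (rule sobolev0_powr_integrable(2)[OF s \<open>c < d\<close>]) simp
  also have "\<dots> = (d - c)\<^sup>2 * nsq g" using \<open>c < d\<close> by (simp add: power2_eq_square)
  finally show ?thesis .
qed

text \<open>A vanishing derivative would force a vanishing power integral through the sup bound.
  Both positivities make the quotient inside \<open>mp_level\<close> meaningful.\<close>

lemma pint_pos:
  assumes s: "sobolev0 {c<..<d} u g" and "c < d" "0 < r" "\<not> (AE x in lebesgue. u x = 0)"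
  shows "0 < pint r u" "0 < nsq g"
proof -
  have "pint r u \<noteq> 0"
  proof
    assume "pint r u = 0"
    then have "AE x in lebesgue. \<bar>u x\<bar> powr r = 0"
      unfolding pint_def
      by (subst (asm) integral_nonneg_eq_0_iff_AE) (auto intro: sobolev0_powr_integrable[OF s] assms)
    then show False using assms(4) by simp
  qed
  then show *: "0 < pint r u" using pint_nonneg[of r u] by linarith
  show "0 < nsq g"
  proof (rule ccontr)
    assume "\<not> 0 < nsq g"
    then have "nsq g = 0" using nsq_nonneg[of g] by linarith
    then show False using sobolev0_powr_integrable(2)[OF s assms(2,3)] * by simp
  qed
qed

lemma pint_add_le:
  assumes "sobolev0 {c<..<d} u g" "sobolev0 {c<..<d} v h" "c < d" "1 \<le> r" "0 < \<theta>" "\<theta> < 1"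
  shows "pint r (\<lambda>x. u x + v x) \<le> (1 - \<theta>) powr (1 - r) * pint r u + \<theta> powr (1 - r) * pint r v"
proof -
  have s: "sobolev0 {c<..<d} (\<lambda>x. u x + v x) (\<lambda>x. g x + h x)"
    using sobolev0_add_scale[OF assms(1,2), of 1] by simp
  have r: "0 < r" using assms by simp
  note i = sobolev0_powr_integrable(1)[OF _ assms(3) r]
  have "pint r (\<lambda>x. u x + v x) \<le>
      (LINT x|lebesgue. (1 - \<theta>) powr (1 - r) * \<bar>u x\<bar> powr r + \<theta> powr (1 - r) * \<bar>v x\<bar> powr r)"
    unfolding pint_def
  proof (rule integral_mono)
    fix x
    have "\<bar>u x + v x\<bar> powr r \<le> (\<bar>u x\<bar> + \<bar>v x\<bar>) powr r" using r by (intro powr_mono2) auto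
    also have "\<dots> \<le> (1 - \<theta>) powr (1 - r) * \<bar>u x\<bar> powr r + \<theta> powr (1 - r) * \<bar>v x\<bar> powr r"
      using assms by (intro powr_add_le) auto
    finally show "\<bar>u x + v x\<bar> powr r \<le> (1 - \<theta>) powr (1 - r) * \<bar>u x\<bar> powr r + \<theta> powr (1 - r) * \<bar>v x\<bar> powr r" .
  qed (use i[OF s] i[OF assms(1)] i[OF assms(2)] in auto)
  also have "\<dots> = (1 - \<theta>) powr (1 - r) * pint r u + \<theta> powr (1 - r) * pint r v"
    unfolding pint_def using i[OF assms(1)] i[OF assms(2)] by simp
  finally show ?thesis .
qed

lemma sobolev0_linear_bound:
  assumes s: "sobolev0 {c<..<d} u g" and "c < d" and w: "L2R w"
  shows "\<bar>LINT x|lebesgue. w x * u x\<bar> \<le> sqrt (nsq w) * (d - c) * sqrt (nsq g)"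
proof -
  have "\<bar>LINT x|lebesgue. w x * u x\<bar> \<le> sqrt (nsq w) * sqrt (nsq u)"
    by (rule L2R_Cauchy_Schwarz[OF w sobolev0_L2R(1)[OF s]])
  also have "sqrt (nsq u) \<le> sqrt ((d - c)\<^sup>2 * nsq g)"
    by (intro real_sqrt_le_mono sobolev0_nsq_bound[OF s \<open>c < d\<close>])
  also have "sqrt ((d - c)\<^sup>2 * nsq g) = (d - c) * sqrt (nsq g)"
    using \<open>c < d\<close> by (simp add: real_sqrt_mult)
  finally show ?thesis by (simp add: mult_left_mono mult.assoc)
qed

lemma sobolev0_linear_bound_Young:
  assumes s: "sobolev0 {c<..<d} u g" and "c < d" and w: "L2R w" and "0 < \<theta>"
  shows "\<bar>LINT x|lebesgue. w x * u x\<bar> \<le> \<theta> / 2 * nsq g + nsq w * (d - c)\<^sup>2 / (2 * \<theta>)"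
proof -
  \<comment> \<open>The weight is placed so that the gradient term receives the small factor
    \<theta> and the forcing term the large factor 1 / \<theta>.\<close>
  have "2 * (sqrt \<theta> * sqrt (nsq g)) * (sqrt (nsq w) * (d - c) / sqrt \<theta>)
      \<le> (sqrt \<theta> * sqrt (nsq g))\<^sup>2 + (sqrt (nsq w) * (d - c) / sqrt \<theta>)\<^sup>2"
    by (rule sum_squares_bound)
  then have "2 * (sqrt (nsq w) * (d - c) * sqrt (nsq g)) \<le> \<theta> * nsq g + nsq w * (d - c)\<^sup>2 / \<theta>"
    using assms(4) by (simp add: power_mult_distrib power_divide mult_ac)
  with sobolev0_linear_bound[OF s \<open>c < d\<close> w] show ?thesis by (simp add: field_simps)
qed

lemma energy_sobolev0:
  assumes s: "sobolev0 U u g" and U: "U \<subseteq> {a<..<b}"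
  shows "energy {a<..<b} p w u = 1 / 2 * nsq g - 1 / (p + 1) * pint (p + 1) u
     - (LINT x|lebesgue. (indicator {a<..<b} x * w x) * u x)"
proof -
  let ?V = "{a<..<b}"
  have V: "?V \<in> sets lebesgue" by simp
  note W = sobolev0_weak_deriv[OF s U]
  have "integral\<^sup>L (lebesgue_on ?V) (\<lambda>x. \<bar>weak_deriv ?V u x\<bar>\<^sup>2)
      = nsq (\<lambda>x. indicator ?V x * weak_deriv ?V u x)"
    unfolding nsq_def integral_lebesgue_on[OF V]
    by (intro Bochner_Integration.integral_cong) (auto simp: indicator_def)
  also have "\<dots> = nsq g"
    using W(3,4) sobolev0_L2R(2)[OF s] by (intro nsq_cong_AE) (auto simp: L2_space_iff L2R_measurable)
  finally have 1: "integral\<^sup>L (lebesgue_on ?V) (\<lambda>x. \<bar>weak_deriv ?V u x\<bar>\<^sup>2) = nsq g" .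
  have u0: "u x = 0" if "x \<notin> ?V" for x using sobolev0_zero_outside(1)[OF s] U that by blast
  have 2: "integral\<^sup>L (lebesgue_on ?V) (\<lambda>x. \<bar>u x\<bar> powr (p + 1)) = pint (p + 1) u"
    unfolding pint_def integral_lebesgue_on[OF V]
    by (intro Bochner_Integration.integral_cong) (use u0 in \<open>auto simp: indicator_def\<close>)
  show ?thesis unfolding energy_def 1 2 integral_lebesgue_on[OF V] by (simp add: mult.assoc)
qed

text \<open>The price of a small \<theta>. The terms stem in turn from the Dirichlet integral A of
  the local minimizer, from Young's inequality for the forcing (W is its squared norm, l the length
  of the interval), and from the power integral B of the local minimizer.\<close>

definition perturbation_bound :: "real \<Rightarrow> real \<Rightarrow> real \<Rightarrow> real \<Rightarrow> real \<Rightarrow> real \<Rightarrow> real" where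
  "perturbation_bound p \<theta> W l A B = A / \<theta> + W * l\<^sup>2 / (2 * \<theta>) + \<theta> powr (- p) * B"

text \<open>Both bounds are pure ray profiles with coefficients distorted by powers of 1 - \<theta>,
  up to an error K independent of t; this independence permits maximizing over t afterwards. Lower
  estimates for the integrals of \<psi> come from the splitting inequalities applied to t * \<delta>
  = \<psi> - v.\<close>

lemma energy_ray_bounds:
  assumes v: "sobolev0 {c<..<d} v g" and \<delta>: "sobolev0 {c<..<d} \<delta> h"
    and U: "{c<..<d} \<subseteq> {a<..<b}" and "c < d" and w: "w \<in> L2_space {a<..<b}"
    and p: "1 < p" and \<theta>: "0 < \<theta>" "\<theta> < 1" and "0 \<le> t"
  defines "K \<equiv> perturbation_bound p \<theta> (nsq (\<lambda>x. indicator {a<..<b} x * w x)) (d - c) (nsq g) (pint (p + 1) v)"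
  shows "energy {a<..<b} p w (\<lambda>x. v x + t * \<delta> x) \<le>
      1 / 2 * (t\<^sup>2 * ((1 - \<theta>) powr (- 2) * nsq h)) - 1 / (p + 1) * (t powr (p + 1) * ((1 - \<theta>) powr p * pint (p + 1) \<delta>)) + K" (is ?upper)
    and "1 / 2 * (t\<^sup>2 * ((1 - \<theta>) powr 2 * nsq h)) - 1 / (p + 1) * (t powr (p + 1) * ((1 - \<theta>) powr (- p) * pint (p + 1) \<delta>)) - K
      \<le> energy {a<..<b} p w (\<lambda>x. v x + t * \<delta> x)" (is ?lower)
proof -
  let ?w = "\<lambda>x. indicator {a<..<b} x * w x"
  define \<psi> where "\<psi> = (\<lambda>x. v x + t * \<delta> x)"
  define k where "k = (\<lambda>x. g x + t * h x)"
  have w': "L2R ?w" using w by (simp add: L2_space_iff)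
  have \<psi>: "sobolev0 {c<..<d} \<psi> k" unfolding \<psi>_def k_def by (rule sobolev0_add_scale[OF v \<delta>])
  have mv: "sobolev0 {c<..<d} (\<lambda>x. (-1) * v x) (\<lambda>x. (-1) * g x)"
    using sobolev0_add_scale[OF sobolev0_zero v, of "-1"] by simp
  have td: "sobolev0 {c<..<d} (\<lambda>x. t * \<delta> x) (\<lambda>x. t * h x)"
    using sobolev0_add_scale[OF sobolev0_zero \<delta>, of t] by simp
  note L = sobolev0_L2R
  define A where "A = nsq g"
  define B where "B = pint (p + 1) v"
  define W where "W = nsq ?w * (d - c)\<^sup>2 / (2 * \<theta>)"
  have nn: "0 \<le> A" "0 \<le> B" "0 \<le> W" using \<theta> by (auto simp: A_def B_def W_def)
  have A1: "nsq k \<le> t\<^sup>2 * nsq h / (1 - \<theta>) + A / \<theta>"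
    using nsq_add_le[OF L(2)[OF td] L(2)[OF v] \<theta>] by (simp add: k_def nsq_scale A_def add.commute)
  have "nsq (\<lambda>x. k x + (-1) * g x) \<le> nsq k / (1 - \<theta>) + nsq (\<lambda>x. (-1) * g x) / \<theta>"
    by (rule nsq_add_le[OF L(2)[OF \<psi>] L(2)[OF mv] \<theta>])
  then have A2: "t\<^sup>2 * nsq h \<le> nsq k / (1 - \<theta>) + A / \<theta>"
    using nsq_scale[of t h] nsq_scale[of "-1" g] by (simp add: k_def A_def)
  have B1: "pint (p + 1) \<psi> \<le> (1 - \<theta>) powr (- p) * (t powr (p + 1) * pint (p + 1) \<delta>) + \<theta> powr (- p) * B"
    using pint_add_le[OF td v \<open>c < d\<close> _ \<theta>, of "p + 1"] p \<open>0 \<le> t\<close>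
    by (simp add: \<psi>_def pint_scale B_def add.commute)
  have B2: "t powr (p + 1) * pint (p + 1) \<delta> \<le> (1 - \<theta>) powr (- p) * pint (p + 1) \<psi> + \<theta> powr (- p) * B"
    using pint_add_le[OF \<psi> mv \<open>c < d\<close> _ \<theta>, of "p + 1"] p \<open>0 \<le> t\<close> pint_scale[of "p + 1" t \<delta>]
      pint_scale[of "p + 1" "-1" v]
    by (simp add: \<psi>_def B_def)
  have lin: "\<bar>LINT x|lebesgue. ?w x * \<psi> x\<bar> \<le> \<theta> / 2 * nsq k + W"
    using sobolev0_linear_bound_Young[OF \<psi> \<open>c < d\<close> w' \<theta>(1)] by (simp add: W_def)
  have E: "energy {a<..<b} p w \<psi> = 1 / 2 * nsq k - 1 / (p + 1) * pint (p + 1) \<psi> - (LINT x|lebesgue. ?w x * \<psi> x)"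
    by (rule energy_sobolev0[OF \<psi> U])
  have K: "K = A / \<theta> + W + \<theta> powr (- p) * B"
    by (simp add: K_def perturbation_bound_def A_def B_def W_def)
  have pp: "(1 - \<theta>) powr p * (1 - \<theta>) powr (- p) = 1" using \<theta> by (simp flip: powr_add)
  have p1: "(1 - \<theta>) powr p \<le> 1" using \<theta> p by (intro powr_le1) auto
  have pf: "1 / (p + 1) \<le> 1" "0 \<le> 1 / (p + 1)" using p by (auto simp: field_simps)
  have bB: "0 \<le> \<theta> powr (- p) * B" using nn by simp
  show ?upper
  proof -
    have "energy {a<..<b} p w \<psi> \<le> (1 + \<theta>) / 2 * nsq k - 1 / (p + 1) * pint (p + 1) \<psi> + W"
      using lin unfolding E by (simp add: field_simps)
    moreover have "(1 + \<theta>) / 2 * nsq k \<le> 1 / 2 * (t\<^sup>2 * ((1 - \<theta>) powr (- 2) * nsq h)) + A / \<theta>"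
    proof -
      have "(1 + \<theta>) / 2 * nsq k \<le> (1 + \<theta>) / 2 * (t\<^sup>2 * nsq h / (1 - \<theta>) + A / \<theta>)"
        using A1 \<theta> by (intro mult_left_mono) auto
      also have "\<dots> = (1 + \<theta>) / 2 * (t\<^sup>2 * nsq h / (1 - \<theta>)) + (1 + \<theta>) / 2 * (A / \<theta>)"
        by (simp add: algebra_simps)
      also have "(1 + \<theta>) / 2 * (A / \<theta>) \<le> 1 * (A / \<theta>)"
        using \<theta> nn by (intro mult_right_mono) auto
      \<comment> \<open>\<open>1 + \<theta> \<le> 1 / (1 - \<theta>)\<close> turns the factor left
        by Young's inequality into a second power of \<open>1 / (1 - \<theta>)\<close>.\<close>
      also have "(1 + \<theta>) / 2 * (t\<^sup>2 * nsq h / (1 - \<theta>)) \<le> (1 / (1 - \<theta>)) / 2 * (t\<^sup>2 * nsq h / (1 - \<theta>))"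
        using \<theta> by (intro mult_right_mono divide_right_mono) (auto simp: field_simps)
      also have "\<dots> = 1 / 2 * (t\<^sup>2 * ((1 - \<theta>) powr (- 2) * nsq h))"
        using \<theta> by (simp add: powr_minus powr_numeral power2_eq_square field_simps)
      finally show ?thesis by simp
    qed
    moreover have "1 / (p + 1) * (t powr (p + 1) * ((1 - \<theta>) powr p * pint (p + 1) \<delta>))
        \<le> 1 / (p + 1) * pint (p + 1) \<psi> + \<theta> powr (- p) * B"
    proof -
      have "(1 - \<theta>) powr p * (t powr (p + 1) * pint (p + 1) \<delta>)
          \<le> (1 - \<theta>) powr p * ((1 - \<theta>) powr (- p) * pint (p + 1) \<psi> + \<theta> powr (- p) * B)"
        using B2 by (intro mult_left_mono) auto
      also have "\<dots> = pint (p + 1) \<psi> + (1 - \<theta>) powr p * (\<theta> powr (- p) * B)"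
        using pp by (simp add: distrib_left flip: mult.assoc)
      also have "\<dots> \<le> pint (p + 1) \<psi> + 1 * (\<theta> powr (- p) * B)"
        using p1 bB by (intro add_left_mono mult_right_mono) auto
      finally have "1 / (p + 1) * ((1 - \<theta>) powr p * (t powr (p + 1) * pint (p + 1) \<delta>))
          \<le> 1 / (p + 1) * (pint (p + 1) \<psi> + 1 * (\<theta> powr (- p) * B))"
        using pf by (intro mult_left_mono) auto
      also have "\<dots> \<le> 1 / (p + 1) * pint (p + 1) \<psi> + 1 * (\<theta> powr (- p) * B)"
        using mult_right_mono[OF pf(1) bB] by (simp add: distrib_left)
      finally show ?thesis by (simp add: mult_ac)
    qed
    ultimately show ?thesis unfolding K \<psi>_def by linarith
  qed
  show ?lower
  proof -
    have "(1 - \<theta>) / 2 * nsq k - 1 / (p + 1) * pint (p + 1) \<psi> - W \<le> energy {a<..<b} p w \<psi>"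
      using lin unfolding E by (simp add: field_simps)
    moreover have "1 / 2 * (t\<^sup>2 * ((1 - \<theta>) powr 2 * nsq h)) \<le> (1 - \<theta>) / 2 * nsq k + A / \<theta>"
    proof -
      have "(1 - \<theta>)\<^sup>2 / 2 * (t\<^sup>2 * nsq h) \<le> (1 - \<theta>)\<^sup>2 / 2 * (nsq k / (1 - \<theta>) + A / \<theta>)"
        using A2 by (intro mult_left_mono) auto
      also have "\<dots> = (1 - \<theta>) / 2 * nsq k + (1 - \<theta>)\<^sup>2 / 2 * (A / \<theta>)"
        using \<theta> by (simp add: field_simps power2_eq_square)
      also have "(1 - \<theta>)\<^sup>2 / 2 * (A / \<theta>) \<le> 1 * (A / \<theta>)"
      proof (rule mult_right_mono)
        have "(1 - \<theta>)\<^sup>2 \<le> 1" using \<theta> by (intro power_le_one) auto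
        then show "(1 - \<theta>)\<^sup>2 / 2 \<le> 1" by simp
      qed (use \<theta> nn in auto)
      finally show ?thesis using \<theta> by (simp add: powr_numeral mult_ac)
    qed
    moreover have "1 / (p + 1) * pint (p + 1) \<psi> \<le>
        1 / (p + 1) * (t powr (p + 1) * ((1 - \<theta>) powr (- p) * pint (p + 1) \<delta>)) + \<theta> powr (- p) * B"
    proof -
      have "1 / (p + 1) * pint (p + 1) \<psi> \<le> 1 / (p + 1) * ((1 - \<theta>) powr (- p) * (t powr (p + 1) * pint (p + 1) \<delta>) + \<theta> powr (- p) * B)"
        using pf B1 by (intro mult_left_mono) auto
      also have "\<dots> \<le> 1 / (p + 1) * ((1 - \<theta>) powr (- p) * (t powr (p + 1) * pint (p + 1) \<delta>)) + 1 * (\<theta> powr (- p) * B)"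
        using mult_right_mono[OF pf(1) bB] by (simp add: distrib_left)
      finally show ?thesis by (simp add: mult_ac)
    qed
    ultimately show ?thesis unfolding K \<psi>_def by linarith
  qed
qed

text \<open>Up to sign, the exponent with which 1 - \<theta> comes out of \<open>mp_level\<close>
  when A is multiplied by \<open>(1 - \<theta>) powr (- 2)\<close> and B by
  \<open>(1 - \<theta>) powr p\<close>.\<close>

definition mp_rate :: "real \<Rightarrow> real" where
  "mp_rate p = 2 + (2 + p) * (2 / (p - 1))"

lemma mp_level_perturbed:
  assumes "0 < \<theta>" "\<theta> < 1" "0 < A" "0 < B"
  shows "mp_level p ((1 - \<theta>) powr (- 2) * A) ((1 - \<theta>) powr p * B) = (1 - \<theta>) powr (- mp_rate p) * mp_level p A B"
    and "mp_level p ((1 - \<theta>) powr 2 * A) ((1 - \<theta>) powr (- p) * B) = (1 - \<theta>) powr (mp_rate p) * mp_level p A B"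
proof -
  have pw: "(1 - \<theta>) powr e * ((1 - \<theta>) powr e / (1 - \<theta>) powr f) powr (2 / (p - 1)) = (1 - \<theta>) powr (e + (e - f) * (2 / (p - 1)))" for e f
    using assms by (simp add: powr_powr powr_add flip: powr_diff)
  have r: "- 2 + (- 2 - p) * (2 / (p - 1)) = - mp_rate p" "2 + (2 - (- p)) * (2 / (p - 1)) = mp_rate p"
    unfolding mp_rate_def by (auto simp: left_diff_distrib distrib_right diff_divide_distrib add_divide_distrib)
  show "mp_level p ((1 - \<theta>) powr (- 2) * A) ((1 - \<theta>) powr p * B) = (1 - \<theta>) powr (- mp_rate p) * mp_level p A B"
    using assms by (subst mp_level_scale) (simp_all only: pw r, simp_all)
  show "mp_level p ((1 - \<theta>) powr 2 * A) ((1 - \<theta>) powr (- p) * B) = (1 - \<theta>) powr (mp_rate p) * mp_level p A B"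
    using assms by (subst mp_level_scale) (simp_all only: pw r, simp_all)
qed

lemma ray_max_bounds:
  assumes v: "sobolev0 {c<..<d} v g" and u: "sobolev0 {c<..<d} (\<lambda>x. u x - v x) h"
    and ne: "\<not> (AE x in lebesgue. u x - v x = 0)"
    and U: "{c<..<d} \<subseteq> {a<..<b}" and "c < d" and w: "w \<in> L2_space {a<..<b}"
    and p: "1 < p" and \<theta>: "0 < \<theta>" "\<theta> < 1"
  defines "K \<equiv> perturbation_bound p \<theta> (nsq (\<lambda>x. indicator {a<..<b} x * w x)) (d - c) (nsq g) (pint (p + 1) v)"
  shows "ray_max {a<..<b} p w v u \<le> (1 - \<theta>) powr (- mp_rate p) * mp_level p (nsq h) (pint (p + 1) (\<lambda>x. u x - v x)) + K"
    and "(1 - \<theta>) powr (mp_rate p) * mp_level p (nsq h) (pint (p + 1) (\<lambda>x. u x - v x)) - K \<le> ray_max {a<..<b} p w v u"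
proof -
  let ?B = "pint (p + 1) (\<lambda>x. u x - v x)"
  let ?E = "\<lambda>t. energy {a<..<b} p w (\<lambda>x. v x + t * (u x - v x))"
  note b = energy_ray_bounds[OF v u U \<open>c < d\<close> w p \<theta>, folded K_def]
  have pos: "0 < ?B" "0 < nsq h" using pint_pos[OF u \<open>c < d\<close> _ ne, of "p + 1"] p by auto
  have up: "?E t \<le> (1 - \<theta>) powr (- mp_rate p) * mp_level p (nsq h) ?B + K" if "t \<in> {0..}" for t
  proof -
    have "1 / 2 * (t\<^sup>2 * ((1 - \<theta>) powr (- 2) * nsq h)) - 1 / (p + 1) * (t powr (p + 1) * ((1 - \<theta>) powr p * ?B))
      \<le> mp_level p ((1 - \<theta>) powr (- 2) * nsq h) ((1 - \<theta>) powr p * ?B)"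
      using that pos \<theta> p by (intro mp_level_max) auto
    then show ?thesis using b(1)[of t] that mp_level_perturbed(1)[OF \<theta> pos(2,1), of p] by simp
  qed
  then show "ray_max {a<..<b} p w v u \<le> (1 - \<theta>) powr (- mp_rate p) * mp_level p (nsq h) ?B + K"
    unfolding ray_max_def by (intro cSUP_least) auto
  \<comment> \<open>The lower bound evaluates the energy at the t that maximizes the distorted
    profile.\<close>
  obtain t where t: "0 \<le> t" "1 / 2 * (t\<^sup>2 * ((1 - \<theta>) powr 2 * nsq h)) - 1 / (p + 1) * (t powr (p + 1) * ((1 - \<theta>) powr (- p) * ?B))
      = mp_level p ((1 - \<theta>) powr 2 * nsq h) ((1 - \<theta>) powr (- p) * ?B)"
    using mp_level_attained[of p "(1 - \<theta>) powr 2 * nsq h" "(1 - \<theta>) powr (- p) * ?B"] p pos \<theta> by auto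
  then have "(1 - \<theta>) powr (mp_rate p) * mp_level p (nsq h) ?B - K \<le> ?E t"
    using b(2)[of t] mp_level_perturbed(2)[OF \<theta> pos(2,1), of p] by simp
  \<comment> \<open>The uniform upper bound also supplies the boundedness that the supremum
    requires.\<close>
  also have "?E t \<le> ray_max {a<..<b} p w v u"
    unfolding ray_max_def using up t(1) by (intro cSUP_upper bdd_aboveI2) auto
  finally show "(1 - \<theta>) powr (mp_rate p) * mp_level p (nsq h) ?B - K \<le> ray_max {a<..<b} p w v u" .
qed

section \<open>The energy of one cell\<close>

text \<open>Levels of the unforced problem on the unit interval. Nonnegative profiles cover both
  cell signs, because multiplication by the sign changes neither integral.\<close>

definition unit_levels :: "real \<Rightarrow> real set" where
  "unit_levels p = {mp_level p (nsq g) (pint (p + 1) \<phi>) |\<phi> g. sobolev0 {0<..<1} \<phi> g \<and>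
     (AE x in lebesgue. 0 \<le> \<phi> x) \<and> \<not> (AE x in lebesgue. \<phi> x = 0)}"

definition cell_exponent :: "real \<Rightarrow> real" where
  "cell_exponent p = (p + 3) / (p - 1)"

text \<open>On the unit interval the sup bound gives B \<le> A^((p + 1) / 2), and for that extreme
  value of B the product A * (A / B)^(2 / (p - 1)) equals 1. The infimum of the levels is therefore
  positive, which later allows division by it.\<close>

lemma unit_levels_lower_bound:
  assumes "1 < p" "m \<in> unit_levels p"
  shows "1 / 2 - 1 / (p + 1) \<le> m"
proof -
  obtain \<phi> g where s: "sobolev0 {0<..<1} \<phi> g" and ne: "\<not> (AE x in lebesgue. \<phi> x = 0)"
    and m: "m = mp_level p (nsq g) (pint (p + 1) \<phi>)"
    using assms(2) unfolding unit_levels_def by blast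
  have pos: "0 < pint (p + 1) \<phi>" "0 < nsq g" using pint_pos[OF s _ _ ne, of "p + 1"] assms by auto
  have B: "pint (p + 1) \<phi> \<le> nsq g powr ((p + 1) / 2)"
    using sobolev0_powr_integrable(2)[OF s, of "p + 1"] assms by simp
  have "nsq g powr (1 - (p + 1) / 2) = nsq g / nsq g powr ((p + 1) / 2)" using pos by (simp add: powr_diff)
  also have "\<dots> \<le> nsq g / pint (p + 1) \<phi>" using B pos by (intro divide_left_mono) auto
  finally have "(nsq g powr (1 - (p + 1) / 2)) powr (2 / (p - 1)) \<le> (nsq g / pint (p + 1) \<phi>) powr (2 / (p - 1))"
    using assms by (intro powr_mono2) auto
  moreover have "(1 - (p + 1) / 2) * (2 / (p - 1)) = -1" using assms by (simp add: field_simps)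
  ultimately have "nsq g powr (-1) \<le> (nsq g / pint (p + 1) \<phi>) powr (2 / (p - 1))"
    by (simp only: powr_powr)
  then have "nsq g * nsq g powr (-1) \<le> nsq g * (nsq g / pint (p + 1) \<phi>) powr (2 / (p - 1))"
    by (intro mult_left_mono) auto
  then have "1 \<le> nsq g * (nsq g / pint (p + 1) \<phi>) powr (2 / (p - 1))"
    using pos by (simp add: powr_minus)
  then have "(1 / 2 - 1 / (p + 1)) * 1 \<le> m"
    unfolding m mp_level_def using assms by (intro mult_left_mono) (auto simp: field_simps)
  then show ?thesis by simp
qed

lemma AE_lebesgue_affine:
  assumes "AE x in lebesgue. P x" "s \<noteq> (0::real)"
  shows "AE x in lebesgue. P (s * x + t)"
proof -
  have m: "(\<lambda>x. t + s * x) \<in> lebesgue \<rightarrow>\<^sub>M lebesgue"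
    using lebesgue_affine_measurable[where c = "\<lambda>x::real. s"] assms by simp
  have "AE x in density (distr lebesgue lebesgue (\<lambda>x. t + s * x)) (\<lambda>_. ennreal \<bar>s\<bar>). P x"
    using assms(1) by (subst (asm) lebesgue_real_affine[OF assms(2), of t])
  then have "AE x in distr lebesgue lebesgue (\<lambda>x. t + s * x). P x"
    using assms(2) by (subst (asm) AE_density) (auto simp: ennreal_zero_less_mult_iff)
  then have "AE x in lebesgue. P (t + s * x)"
  proof -
    assume *: "AE x in distr lebesgue lebesgue (\<lambda>x. t + s * x). P x"
    from AE_distrD[OF m *] show ?thesis .
  qed
  then show ?thesis by (simp add: add.commute)
qed

text \<open>The substitution multiplies the Dirichlet integral by s and the power integral by 1 / s,
  hence the level by \<open>s * (s^2) powr (2 / (p - 1))\<close>, which is where the exponent (p +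
  3) / (p - 1) comes from.\<close>

lemma sobolev0_rescale:
  assumes \<phi>: "sobolev0 {c<..<d} \<phi> g" and "1 < p" "s > 0" "\<And>x. s * x + t \<in> {c<..<d} \<longleftrightarrow> x \<in> V" "c < d"
    and nn: "AE x in lebesgue. 0 \<le> \<phi> x" and ne: "\<not> (AE x in lebesgue. \<phi> x = 0)"
  shows "sobolev0 V (\<lambda>x. \<phi> (s * x + t)) (\<lambda>x. s * g (s * x + t))"
    and "AE x in lebesgue. 0 \<le> \<phi> (s * x + t)" and "\<not> (AE x in lebesgue. \<phi> (s * x + t) = 0)"
    and "mp_level p (nsq (\<lambda>x. s * g (s * x + t))) (pint (p + 1) (\<lambda>x. \<phi> (s * x + t)))
       = s powr (cell_exponent p) * mp_level p (nsq g) (pint (p + 1) \<phi>)"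
proof -
  show "sobolev0 V (\<lambda>x. \<phi> (s * x + t)) (\<lambda>x. s * g (s * x + t))"
    using assms by (intro sobolev0_affine[OF \<phi>]) auto
  show "AE x in lebesgue. 0 \<le> \<phi> (s * x + t)"
    using assms(3) by (intro AE_lebesgue_affine[OF nn]) auto
  show "\<not> (AE x in lebesgue. \<phi> (s * x + t) = 0)"
  proof
    assume "AE x in lebesgue. \<phi> (s * x + t) = 0"
    from AE_lebesgue_affine[OF this, of "1 / s" "- t / s"] have "AE x in lebesgue. \<phi> x = 0"
      using assms(3) by (simp add: field_simps)
    with ne show False ..
  qed
  have pos: "0 < pint (p + 1) \<phi>" "0 < nsq g" using pint_pos[OF \<phi> _ _ ne, of "p + 1"] assms by auto
  have "nsq (\<lambda>x. s * g (s * x + t)) = s * nsq g"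
    using assms(3) by (simp add: nsq_scale nsq_affine power2_eq_square)
  moreover have "pint (p + 1) (\<lambda>x. \<phi> (s * x + t)) = (1 / s) * pint (p + 1) \<phi>"
    using assms(3) by (simp add: pint_affine)
  moreover have "s * (s / (1 / s)) powr (2 / (p - 1)) = s powr (cell_exponent p)"
  proof -
    have e: "cell_exponent p = 1 + 2 * (2 / (p - 1))" using assms(2) by (simp add: cell_exponent_def field_simps)
    have "s / (1 / s) = s powr 2" using assms(3) by (simp add: power2_eq_square powr_numeral)
    then show ?thesis using assms(3) unfolding e by (simp add: powr_add powr_powr del: powr_numeral)
  qed
  ultimately show "mp_level p (nsq (\<lambda>x. s * g (s * x + t))) (pint (p + 1) (\<lambda>x. \<phi> (s * x + t)))
       = s powr (cell_exponent p) * mp_level p (nsq g) (pint (p + 1) \<phi>)"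
    using mp_level_scale[of s "1 / s" "nsq g" "pint (p + 1) \<phi>" p] pos assms(3) by simp
qed

lemma AE_lebesgue_on_iff:
  assumes "U \<in> sets lebesgue" "\<And>x. x \<notin> U \<Longrightarrow> P x"
  shows "(AE x in lebesgue_on U. P x) \<longleftrightarrow> (AE x in lebesgue. P x)"
  using assms by (subst AE_restrict_space_iff) (auto intro!: AE_cong)

text \<open>For the lower bound \<open>u - v\<close> itself is transported to the unit interval. For
  the upper bound every unit profile is transported into the cell and added to v as a competitor,
  and the infimum over profiles is taken only afterwards. The existence of u is what makes
  \<open>unit_levels p\<close> nonempty.\<close>

lemma minimax_energy_bounds:
  assumes v: "sobolev0 {c<..<d} v g" and mm: "is_minimax {a<..<b} p w {c<..<d} \<sigma> v u"
    and \<sigma>: "\<bar>\<sigma>\<bar> = 1"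
    and U: "{c<..<d} \<subseteq> {a<..<b}" and "c < d" and w: "w \<in> L2_space {a<..<b}"
    and p: "1 < p" and \<theta>: "0 < \<theta>" "\<theta> < 1"
  defines "K \<equiv> perturbation_bound p \<theta> (nsq (\<lambda>x. indicator {a<..<b} x * w x)) (d - c) (nsq g) (pint (p + 1) v)"
  shows "(1 - \<theta>) powr (mp_rate p) * (Inf (unit_levels p) * (d - c) powr (- cell_exponent p)) - K \<le> energy {a<..<b} p w u"
    and "energy {a<..<b} p w u \<le> (1 - \<theta>) powr (- mp_rate p) * (Inf (unit_levels p) * (d - c) powr (- cell_exponent p)) + K"
    and "unit_levels p \<noteq> {}"
proof -
  let ?U = "{c<..<d}"
  let ?l = "d - c"
  have Us: "?U \<in> sets lebesgue" by simp
  have uc: "u \<in> signed_competitors ?U \<sigma> v" and Eu: "energy {a<..<b} p w u = ray_max {a<..<b} p w v u"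
    and min: "\<And>u'. u' \<in> signed_competitors ?U \<sigma> v \<Longrightarrow> ray_max {a<..<b} p w v u \<le> ray_max {a<..<b} p w v u'"
    using mm unfolding is_minimax_def by auto
  have \<sigma>2: "\<sigma> * \<sigma> = 1" using \<sigma> by (metis abs_mult_self_eq mult_1)
  obtain k where k: "sobolev0 ?U u k" using uc H10_iff_sobolev0 unfolding signed_competitors_def by blast
  have z: "u x = 0" "v x = 0" if "x \<notin> ?U" for x
    using sobolev0_zero_outside(1)[OF k that] sobolev0_zero_outside(1)[OF v that] by auto
  define \<delta> where "\<delta> = (\<lambda>x. u x - v x)"
  define h where "h = (\<lambda>x. k x - g x)"
  have \<delta>: "sobolev0 ?U \<delta> h" using sobolev0_add_scale[OF k v, of "-1"] by (simp add: \<delta>_def h_def)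
  have ne: "\<not> (AE x in lebesgue. \<delta> x = 0)"
  proof
    assume "AE x in lebesgue. \<delta> x = 0"
    then have "AE x in lebesgue_on ?U. \<delta> x = 0"
      by (subst AE_lebesgue_on_iff) (auto simp: \<delta>_def z)
    then show False using uc by (simp add: signed_competitors_def eq_ae_def \<delta>_def)
  qed
  have nn: "AE x in lebesgue. 0 \<le> \<sigma> * \<delta> x"
    using uc by (subst AE_lebesgue_on_iff[of ?U, symmetric]) (auto simp: signed_competitors_def \<delta>_def z)
  have \<sigma>\<delta>: "sobolev0 ?U (\<lambda>x. \<sigma> * \<delta> x) (\<lambda>x. \<sigma> * h x)"
    using sobolev0_add_scale[OF sobolev0_zero \<delta>, of \<sigma>] by simp
  have ne': "\<not> (AE x in lebesgue. \<sigma> * \<delta> x = 0)" using ne \<sigma> by auto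
  have into: "?l * x + c \<in> {c<..<d} \<longleftrightarrow> x \<in> {0<..<1}" for x
  proof -
    have "?l * x + c < d \<longleftrightarrow> ?l * x < ?l * 1" by auto
    moreover have "c < ?l * x + c \<longleftrightarrow> ?l * 0 < ?l * x" by auto
    ultimately show ?thesis
      using \<open>c < d\<close> by (simp only: greaterThanLessThan_iff mult_less_cancel_left_pos diff_gt_0_iff_gt)
  qed
  have outof: "(1 / ?l) * x + (- c / ?l) \<in> {0<..<1} \<longleftrightarrow> x \<in> {c<..<d}" for x
  proof -
    have "(1 / ?l) * x + (- c / ?l) = (x - c) / ?l" by (simp add: diff_divide_distrib)
    then show ?thesis using \<open>c < d\<close>
      by (simp add: pos_less_divide_eq pos_divide_less_eq del: divide_less_eq_1_pos zero_less_divide_iff)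
  qed
  have l: "?l > 0" using \<open>c < d\<close> by simp
  note r = sobolev0_rescale[OF \<sigma>\<delta> p l into \<open>c < d\<close> nn ne']
  have "mp_level p (nsq (\<lambda>x. \<sigma> * h x)) (pint (p + 1) (\<lambda>x. \<sigma> * \<delta> x)) = mp_level p (nsq h) (pint (p + 1) \<delta>)"
    using \<sigma> \<sigma>2 by (simp add: nsq_scale pint_scale power2_eq_square)
  then have mem: "?l powr (cell_exponent p) * mp_level p (nsq h) (pint (p + 1) \<delta>) \<in> unit_levels p"
    unfolding unit_levels_def
    by (intro CollectI exI[of _ "\<lambda>x. \<sigma> * \<delta> (?l * x + c)"] exI[of _ "\<lambda>x. ?l * (\<sigma> * h (?l * x + c))"] conjI r(1,2,3))
      (simp only: r(4))
  then show ne_levels: "unit_levels p \<noteq> {}" by auto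
  have bdd: "bdd_below (unit_levels p)"
    using unit_levels_lower_bound[OF p] by (intro bdd_belowI)
  have lp: "?l powr (cell_exponent p) * ?l powr (- cell_exponent p) = 1" using l by (simp flip: powr_add)
  have "Inf (unit_levels p) \<le> ?l powr (cell_exponent p) * mp_level p (nsq h) (pint (p + 1) \<delta>)"
    using mem bdd by (rule cInf_lower)
  then have "Inf (unit_levels p) * ?l powr (- cell_exponent p)
      \<le> ?l powr (cell_exponent p) * mp_level p (nsq h) (pint (p + 1) \<delta>) * ?l powr (- cell_exponent p)"
    by (intro mult_right_mono) auto
  also have "\<dots> = mp_level p (nsq h) (pint (p + 1) \<delta>)" using lp by (simp add: mult_ac)
  finally have "(1 - \<theta>) powr (mp_rate p) * (Inf (unit_levels p) * ?l powr (- cell_exponent p))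
      \<le> (1 - \<theta>) powr (mp_rate p) * mp_level p (nsq h) (pint (p + 1) \<delta>)"
    by (intro mult_left_mono) auto
  with ray_max_bounds(2)[OF v \<delta>[unfolded \<delta>_def] ne[unfolded \<delta>_def] U \<open>c < d\<close> w p \<theta>, folded K_def]
  show "(1 - \<theta>) powr (mp_rate p) * (Inf (unit_levels p) * ?l powr (- cell_exponent p)) - K \<le> energy {a<..<b} p w u"
    unfolding Eu \<delta>_def by linarith
  \<comment> \<open>Everything but m is moved to the left, so that the infimum over all levels m can
    be taken.\<close>
  have "(energy {a<..<b} p w u - K) * (1 - \<theta>) powr (mp_rate p) * ?l powr (cell_exponent p) \<le> m"
    if "m \<in> unit_levels p" for m
  proof -
    obtain \<phi> f where \<phi>: "sobolev0 {0<..<1} \<phi> f" "AE x in lebesgue. 0 \<le> \<phi> x" "\<not> (AE x in lebesgue. \<phi> x = 0)"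
      and m: "m = mp_level p (nsq f) (pint (p + 1) \<phi>)"
      using \<open>m \<in> unit_levels p\<close> unfolding unit_levels_def by blast
    have l': "0 < 1 / ?l" using l by simp
    note r = sobolev0_rescale[OF \<phi>(1) p l' outof zero_less_one \<phi>(2,3)]
    define \<xi> where "\<xi> = (\<lambda>x. \<sigma> * \<phi> (1 / ?l * x + - c / ?l))"
    define k where "k = (\<lambda>x. \<sigma> * (1 / ?l * f (1 / ?l * x + - c / ?l)))"
    have \<xi>: "sobolev0 ?U \<xi> k"
      using sobolev0_add_scale[OF sobolev0_zero r(1), of \<sigma>] by (simp add: \<xi>_def k_def)
    have ne\<xi>: "\<not> (AE x in lebesgue. \<xi> x = 0)" using r(3) \<sigma> by (auto simp: \<xi>_def)
    have nn\<xi>: "AE x in lebesgue. 0 \<le> \<sigma> * \<xi> x"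
      using r(2) \<sigma>2 by (simp add: \<xi>_def flip: mult.assoc)
    define u' where "u' = (\<lambda>x. v x + \<xi> x)"
    have u'd: "(\<lambda>x. u' x - v x) = \<xi>" by (simp add: u'_def)
    have u': "sobolev0 ?U u' (\<lambda>x. g x + k x)"
      using sobolev0_add_scale[OF v \<xi>, of 1] by (simp add: u'_def)
    have "u' \<in> signed_competitors ?U \<sigma> v"
      unfolding signed_competitors_def
    proof (intro CollectI conjI)
      show "u' \<in> H10 ?U" using u' H10_iff_sobolev0 by blast
      show "\<not> eq_ae ?U u' v"
      proof
        assume "eq_ae ?U u' v"
        then have "AE x in lebesgue_on ?U. \<xi> x = 0" by (simp add: eq_ae_def u'_def)
        then show False using ne\<xi> sobolev0_zero_outside(1)[OF \<xi>] by (subst (asm) AE_lebesgue_on_iff) auto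
      qed
      show "AE x in lebesgue_on ?U. 0 \<le> \<sigma> * (u' x - v x)"
        using nn\<xi> sobolev0_zero_outside(1)[OF \<xi>] by (subst AE_lebesgue_on_iff) (auto simp: u'_def)
    qed
    from min[OF this] have "energy {a<..<b} p w u \<le> ray_max {a<..<b} p w v u'" by (simp add: Eu)
    also have "\<dots> \<le> (1 - \<theta>) powr (- mp_rate p) * mp_level p (nsq k) (pint (p + 1) \<xi>) + K"
    proof -
      have "sobolev0 ?U (\<lambda>x. u' x - v x) k" "\<not> (AE x in lebesgue. u' x - v x = 0)"
        using \<xi> ne\<xi> u'd by (simp_all add: fun_eq_iff)
      from ray_max_bounds(1)[OF v this U \<open>c < d\<close> w p \<theta>, folded K_def]
      show ?thesis by (simp only: u'd)
    qed
    also have "mp_level p (nsq k) (pint (p + 1) \<xi>) = (1 / ?l) powr (cell_exponent p) * m"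
      using r(4) \<sigma> \<sigma>2 unfolding k_def \<xi>_def nsq_scale[of \<sigma>] pint_scale[of _ \<sigma>] m
      by (simp add: power2_eq_square)
    also have "(1 / ?l) powr (cell_exponent p) = ?l powr (- cell_exponent p)"
      using l by (simp add: powr_minus_divide powr_divide)
    finally have "energy {a<..<b} p w u - K \<le> (1 - \<theta>) powr (- mp_rate p) * (?l powr (- cell_exponent p) * m)"
      by simp
    then have "(energy {a<..<b} p w u - K) * ((1 - \<theta>) powr (mp_rate p) * ?l powr (cell_exponent p))
       \<le> (1 - \<theta>) powr (- mp_rate p) * (?l powr (- cell_exponent p) * m) * ((1 - \<theta>) powr (mp_rate p) * ?l powr (cell_exponent p))"
      by (intro mult_right_mono) auto
    also have "\<dots> = ((1 - \<theta>) powr (- mp_rate p) * (1 - \<theta>) powr (mp_rate p)) * (?l powr (cell_exponent p) * ?l powr (- cell_exponent p)) * m"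
      by (simp only: mult_ac)
    also have "\<dots> = m" using lp \<theta> by (simp flip: powr_add)
    finally show ?thesis by (simp add: mult.assoc)
  qed
  then have "(energy {a<..<b} p w u - K) * (1 - \<theta>) powr (mp_rate p) * ?l powr (cell_exponent p) \<le> Inf (unit_levels p)"
    using ne_levels by (intro cInf_greatest)
  then have "(energy {a<..<b} p w u - K) * (1 - \<theta>) powr (mp_rate p) * ?l powr (cell_exponent p) * ((1 - \<theta>) powr (- mp_rate p) * ?l powr (- cell_exponent p))
     \<le> Inf (unit_levels p) * ((1 - \<theta>) powr (- mp_rate p) * ?l powr (- cell_exponent p))"
    by (intro mult_right_mono) auto
  also have "(energy {a<..<b} p w u - K) * (1 - \<theta>) powr (mp_rate p) * ?l powr (cell_exponent p) * ((1 - \<theta>) powr (- mp_rate p) * ?l powr (- cell_exponent p))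
     = (energy {a<..<b} p w u - K) * ((1 - \<theta>) powr (mp_rate p) * (1 - \<theta>) powr (- mp_rate p)) * (?l powr (cell_exponent p) * ?l powr (- cell_exponent p))"
    by (simp only: mult_ac)
  also have "\<dots> = energy {a<..<b} p w u - K" using lp \<theta> by (simp flip: powr_add)
  finally show "energy {a<..<b} p w u \<le> (1 - \<theta>) powr (- mp_rate p) * (Inf (unit_levels p) * ?l powr (- cell_exponent p)) + K"
    by (simp add: mult_ac)
qed

text \<open>The smallness condition on \<open>d - c\<close> lets the quadratic term absorb the superlinear one.\<close>

lemma local_min_small:
  assumes lm: "is_local_min {a<..<b} p w {c<..<d} v" and v: "sobolev0 {c<..<d} v g"
    and U: "{c<..<d} \<subseteq> {a<..<b}" and "c < d" and w: "w \<in> L2_space {a<..<b}" and p: "1 < p"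
  defines "W \<equiv> sqrt (nsq (\<lambda>x. indicator {a<..<b} x * w x))"
  assumes small: "(d - c) powr ((p + 3) / 2) * (1 + 2 * W * (d - c)) powr (p - 1) \<le> 1 / 4"
  shows "sqrt (nsq g) \<le> 4 * W * (d - c)"
    and "pint (p + 1) v \<le> (d - c) * ((d - c) * (4 * W * (d - c))\<^sup>2) powr ((p + 1) / 2)"
proof -
  let ?U = "{c<..<d}"
  let ?l = "d - c"
  let ?w = "\<lambda>x. indicator {a<..<b} x * w x"
  have Us: "?U \<in> sets lebesgue" by simp
  have w': "L2R ?w" using w by (simp add: L2_space_iff)
  have pv: "integral\<^sup>L (lebesgue_on ?U) (\<lambda>x. \<bar>f x\<bar> powr (p + 1)) = pint (p + 1) f"
    if "sobolev0 ?U f f'" for f f'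
    unfolding pint_def integral_lebesgue_on[OF Us] using sobolev0_zero_outside(1)[OF that]
    by (intro Bochner_Integration.integral_cong) (auto simp: indicator_def)
  have v1: "pint (p + 1) v < 1" using lm pv[OF v] by (simp add: is_local_min_def)
  \<comment> \<open>The zero function is admissible, so the minimal energy is not positive.\<close>
  have "(\<lambda>x. 0) \<in> H10 ?U" using H10_iff_sobolev0 sobolev0_zero by blast
  then have "energy {a<..<b} p w v \<le> energy {a<..<b} p w (\<lambda>x. 0)"
    using lm unfolding is_local_min_def by simp
  also have "\<dots> = 0" using energy_sobolev0[OF sobolev0_zero U, of p w] by (simp add: nsq_def pint_def)
  finally have E: "energy {a<..<b} p w v \<le> 0" .
  define x where "x = sqrt (nsq g)"
  have x: "0 \<le> x" "nsq g = x\<^sup>2" by (auto simp: x_def)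
  have W: "0 \<le> W" by (simp add: W_def)
  have l: "0 < ?l" using \<open>c < d\<close> by simp
  have "(LINT x|lebesgue. ?w x * v x) \<le> W * ?l * x"
    using sobolev0_linear_bound[OF v \<open>c < d\<close> w'] by (simp add: W_def x_def)
  then have e: "1 / 2 * x\<^sup>2 \<le> 1 / (p + 1) * pint (p + 1) v + W * ?l * x"
    using E unfolding energy_sobolev0[OF v U] x(2) by linarith
  have p1: "1 / (p + 1) * B \<le> 1 / 2 * B" if "0 \<le> B" for B
    using p that by (intro mult_right_mono) (auto simp: field_simps)
  have e2: "x\<^sup>2 \<le> pint (p + 1) v + 2 * W * ?l * x" using e p1[OF pint_nonneg, of "p + 1" v] by simp
  \<comment> \<open>A first crude bound, from the constraint that keeps the power integral below 1.
    It controls the factor \<open>x powr (p - 1)\<close> further down.\<close>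
  have x1: "x \<le> 1 + 2 * W * ?l"
  proof (rule ccontr)
    assume c: "\<not> x \<le> 1 + 2 * W * ?l"
    have "0 \<le> 2 * W * ?l" using W l by simp
    with c have "1 \<le> x" by linarith
    have "x * x \<le> 1 + 2 * W * ?l * x" using e2 v1 by (simp add: power2_eq_square)
    also have "\<dots> \<le> x + 2 * W * ?l * x" using \<open>1 \<le> x\<close> by simp
    also have "\<dots> = (1 + 2 * W * ?l) * x" by (simp add: algebra_simps)
    also have "\<dots> < x * x" using c \<open>1 \<le> x\<close> by (intro mult_strict_right_mono) auto
    finally show False by simp
  qed
  have pw: "pint (p + 1) v \<le> ?l * (?l * x\<^sup>2) powr ((p + 1) / 2)"
    using sobolev0_powr_integrable(2)[OF v \<open>c < d\<close>, of "p + 1"] p x(2) by simp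
  show g: "sqrt (nsq g) \<le> 4 * W * ?l"
  proof (cases "x = 0")
    case True
    then show ?thesis using W l by (simp add: x_def)
  next
    case False
    then have xp: "0 < x" using x by simp
    have "?l * (?l * x\<^sup>2) powr ((p + 1) / 2) = (?l * ?l powr ((p + 1) / 2)) * (x\<^sup>2) powr ((p + 1) / 2)"
      using l by (simp add: powr_mult)
    also have "?l * ?l powr ((p + 1) / 2) = ?l powr ((p + 3) / 2)"
    proof -
      have e: "(p + 3) / 2 = 1 + (p + 1) / 2" by (simp add: field_simps)
      show ?thesis using l by (simp only: e powr_add) simp
    qed
    also have "(x\<^sup>2) powr ((p + 1) / 2) = x powr (p - 1) * x\<^sup>2"
    proof -
      have "(x\<^sup>2) powr ((p + 1) / 2) = x powr (p + 1)" using xp by (simp add: powr_powr add_divide_distrib flip: powr_numeral)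
      also have "\<dots> = x powr (p - 1) * x powr 2"
        using powr_add[of x "p - 1" 2] by (simp add: add.commute)
      finally show ?thesis using xp by simp
    qed
    finally have "pint (p + 1) v \<le> ?l powr ((p + 3) / 2) * (x powr (p - 1) * x\<^sup>2)" using pw by simp
    also have "\<dots> \<le> ?l powr ((p + 3) / 2) * ((1 + 2 * W * ?l) powr (p - 1) * x\<^sup>2)"
      using x1 xp p by (intro mult_left_mono mult_right_mono powr_mono2) auto
    also have "\<dots> \<le> 1 / 4 * x\<^sup>2"
      using mult_right_mono[OF small, of "x\<^sup>2"] by (simp add: mult.assoc)
    \<comment> \<open>Three quarters of the square remain on the left; the resulting factor 8 / 3 is
      rounded up to 4.\<close>
    finally have "x\<^sup>2 \<le> 1 / 4 * x\<^sup>2 + 2 * W * ?l * x" using e2 by simp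
    then have "x * x \<le> (8 / 3 * W * ?l) * x" by (simp add: power2_eq_square)
    then have "x \<le> 8 / 3 * W * ?l" using xp by (simp only: mult_le_cancel_right_pos)
    also have "\<dots> \<le> 4 * W * ?l" using W l by (intro mult_right_mono) auto
    finally show ?thesis by (simp add: x_def)
  qed
  have "x\<^sup>2 \<le> (4 * W * ?l)\<^sup>2" using g x(1) unfolding x_def by (rule power_mono)
  from mult_left_mono[OF this less_imp_le[OF l]]
  have "(?l * x\<^sup>2) powr ((p + 1) / 2) \<le> (?l * (4 * W * ?l)\<^sup>2) powr ((p + 1) / 2)"
    using l p by (intro powr_mono2) (simp_all del: power_mult_distrib)
  from mult_left_mono[OF this less_imp_le[OF l]] pw show "pint (p + 1) v \<le> ?l * (?l * (4 * W * ?l)\<^sup>2) powr ((p + 1) / 2)" by linarith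
qed

section \<open>Cells and piecewise affine maps\<close>

lemma open_interval_eq:
  fixes \<Omega> :: "real set"
  assumes "\<Omega> \<noteq> {}" "open \<Omega>" "bounded \<Omega>" "is_interval \<Omega>"
  obtains a b where "a < b" "\<Omega> = {a<..<b}"
proof -
  have bb: "bdd_below \<Omega>" "bdd_above \<Omega>"
    using assms(3) by (auto intro: bounded_imp_bdd_below bounded_imp_bdd_above)
  have ex: "\<exists>y\<in>\<Omega>. y < x" "\<exists>y\<in>\<Omega>. x < y" if x: "x \<in> \<Omega>" for x
  proof -
    obtain e where e: "e > 0" "ball x e \<subseteq> \<Omega>" using assms(2) x by (rule openE)
    have "x - e / 2 \<in> \<Omega>" "x + e / 2 \<in> \<Omega>" using e by (auto simp: dist_real_def)
    moreover have "x - e / 2 < x" "x < x + e / 2" using e(1) by auto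
    ultimately show "\<exists>y\<in>\<Omega>. y < x" "\<exists>y\<in>\<Omega>. x < y" by blast+
  qed
  have eq: "\<Omega> = {Inf \<Omega><..<Sup \<Omega>}"
  proof (intro set_eqI iffI)
    fix x assume "x \<in> \<Omega>"
    with ex[OF this] show "x \<in> {Inf \<Omega><..<Sup \<Omega>}"
      using bb by (auto intro: le_less_trans[OF cInf_lower] less_le_trans[OF _ cSup_upper])
  next
    fix x assume "x \<in> {Inf \<Omega><..<Sup \<Omega>}"
    then obtain y z where "y \<in> \<Omega>" "y < x" "z \<in> \<Omega>" "x < z"
      using cInf_less_iff[OF assms(1) bb(1)] less_cSup_iff[OF assms(1) bb(2)] by auto
    then show "x \<in> \<Omega>" using assms(4) unfolding is_interval_1 by (meson less_imp_le)
  qed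
  then have "Inf \<Omega> < Sup \<Omega>" using assms(1) by (metis greaterThanLessThan_empty_iff not_less)
  with eq show thesis using that by blast
qed

section \<open>Cells and their union as explicit intervals\<close>

lemma unit_cell_eq: "unit_cell z = {of_int z<..<of_int z + 1}"
proof (intro set_eqI iffI)
  fix x :: real assume "x \<in> {of_int z<..<of_int z + 1}"
  then show "x \<in> unit_cell z"
    unfolding unit_cell_def by (intro image_eqI[of _ _ "x - of_int z"]) auto
qed (auto simp: unit_cell_def)

lemma cell_eq:
  assumes "0 < k"
  shows "cell k z = {of_int z / real k<..<(of_int z + 1) / real k}"
proof (intro set_eqI iffI)
  fix x assume "x \<in> {of_int z / real k<..<(of_int z + 1) / real k}"
  then show "x \<in> cell k z"
    unfolding cell_def unit_cell_eq using assms
    by (intro image_eqI[of _ _ "x * real k"]) (auto simp: pos_divide_less_eq pos_less_divide_eq)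
qed (use assms in \<open>auto simp: cell_def unit_cell_eq divide_strict_right_mono\<close>)

text \<open>The index of a cell is its left endpoint in units of 1 / k, so the last admissible index
  lies one below the floor.\<close>

lemma cell_indices_eq:
  assumes "0 < k"
  shows "cell_indices {a<..<b} k = {\<lceil>real k * a\<rceil>..<\<lfloor>real k * b\<rfloor>}"
proof -
  have "cell k z \<subseteq> {a<..<b} \<longleftrightarrow> \<lceil>real k * a\<rceil> \<le> z \<and> z < \<lfloor>real k * b\<rfloor>" for z
  proof -
    have "cell k z \<subseteq> {a<..<b} \<longleftrightarrow> a \<le> of_int z / real k \<and> (of_int z + 1) / real k \<le> b"
      unfolding cell_eq[OF assms] greaterThanLessThan_subseteq_greaterThanLessThan
      using assms by (auto simp: divide_strict_right_mono)
    also have "\<dots> \<longleftrightarrow> real k * a \<le> of_int z \<and> of_int (z + 1) \<le> real k * b"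
      using assms by (auto simp: field_simps)
    also have "\<dots> \<longleftrightarrow> \<lceil>real k * a\<rceil> \<le> z \<and> z + 1 \<le> \<lfloor>real k * b\<rfloor>"
      by (simp only: ceiling_le_iff le_floor_iff)
    finally show ?thesis by auto
  qed
  then show ?thesis unfolding cell_indices_def by auto
qed

lemma cell_union_eq:
  assumes "0 < k" and I: "cell_indices \<Omega> k = {m..<n}" and "m < n"
  shows "cell_union \<Omega> k = {of_int m / real k..of_int n / real k}"
proof -
  have "(\<lambda>x. 1 / real k * x) ` closure (unit_cell z) = {of_int z / real k..(of_int z + 1) / real k}" for z
  proof (intro set_eqI iffI)
    fix x assume "x \<in> {of_int z / real k..(of_int z + 1) / real k}"
    then show "x \<in> (\<lambda>x. 1 / real k * x) ` closure (unit_cell z)"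
      unfolding unit_cell_eq using assms(1)
      by (intro image_eqI[of _ _ "x * real k"]) (auto simp: pos_divide_le_eq pos_le_divide_eq)
  qed (auto simp: unit_cell_eq divide_right_mono)
  then have "cell_union \<Omega> k = (\<Union>z\<in>{m..<n}. {of_int z / real k..(of_int z + 1) / real k})"
    by (simp add: cell_union_def I)
  also have "\<dots> = {of_int m / real k..of_int n / real k}"
  proof (intro set_eqI iffI)
    fix x assume "x \<in> (\<Union>z\<in>{m..<n}. {of_int z / real k..(of_int z + 1) / real k})"
    then obtain z where z: "m \<le> z" "z < n" "of_int z / real k \<le> x" "x \<le> (of_int z + 1) / real k" by auto
    have "(of_int m :: real) \<le> of_int z" "(of_int z :: real) + 1 \<le> of_int n" using z(1,2) by linarith+
    then have "of_int m / real k \<le> of_int z / real k" "(of_int z + 1) / real k \<le> of_int n / real k"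
      by (auto intro: divide_right_mono)
    with z show "x \<in> {of_int m / real k..of_int n / real k}" by simp
  next
    fix x assume "x \<in> {of_int m / real k..of_int n / real k}"
    then have x: "of_int m \<le> real k * x" "real k * x \<le> of_int n" using assms(1) by (auto simp: field_simps)
    \<comment> \<open>At the right end of the union the floor is n, one beyond the last index; the
      minimum assigns that point to the last cell.\<close>
    define z where "z = min \<lfloor>real k * x\<rfloor> (n - 1)"
    have "m \<le> \<lfloor>real k * x\<rfloor>" using x(1) by (simp add: le_floor_iff)
    then have 1: "z \<in> {m..<n}" using assms(3) by (auto simp: z_def)
    have "of_int z \<le> real k * x" unfolding z_def by linarith
    moreover have "real k * x \<le> of_int z + 1"
    proof (cases "\<lfloor>real k * x\<rfloor> \<le> n - 1")
      case True then show ?thesis unfolding z_def by linarith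
    next
      case False then show ?thesis using x(2) by (simp add: z_def)
    qed
    ultimately have "x \<in> {of_int z / real k..(of_int z + 1) / real k}"
      using assms(1) by (auto simp: field_simps)
    with 1 show "x \<in> (\<Union>z\<in>{m..<n}. {of_int z / real k..(of_int z + 1) / real k})" by blast
  qed
  finally show ?thesis .
qed

text \<open>A continuous injection on an interval is strictly monotone. The sign \<epsilon> records
  the orientation, so that increasing and decreasing maps can be treated together.\<close>

lemma bilipschitz_on_interval_monotone:
  assumes T: "bilipschitz_on L {A..B} T" and "0 < L"
  obtains \<epsilon> :: real where "\<bar>\<epsilon>\<bar> = 1" "strict_mono_on {A..B} (\<lambda>x. \<epsilon> * T x)" "continuous_on {A..B} (\<lambda>x. \<epsilon> * T x)"
proof -
  have "L-lipschitz_on {A..B} T"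
    using T \<open>0 < L\<close> by (intro lipschitz_onI) (auto simp: bilipschitz_on_def dist_real_def)
  then have c: "continuous_on {A..B} T" by (rule lipschitz_on_continuous_on)
  have "inj_on T {A..B}"
  proof (rule inj_onI)
    fix x y assume "x \<in> {A..B}" "y \<in> {A..B}" "T x = T y"
    then have "1 / L * \<bar>x - y\<bar> \<le> 0" using T unfolding bilipschitz_on_def by fastforce
    then show "x = y" using \<open>0 < L\<close> by (simp add: divide_le_0_iff)
  qed
  then consider "strict_mono_on {A..B} T" | "strict_antimono_on {A..B} T"
    using injective_eq_monotone_map[of "{A..B}" T] c is_interval_cc by blast
  then show thesis
  proof cases
    case 1
    then show thesis using that[of 1] c by simp
  next
    case 2
    then have "strict_mono_on {A..B} (\<lambda>x. (-1) * T x)"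
      by (auto simp: monotone_on_def)
    then show thesis using that[of "-1"] c by (auto intro!: continuous_intros)
  qed
qed

lemma strict_mono_image_open_interval:
  fixes F :: "real \<Rightarrow> real"
  assumes "strict_mono_on {A..B} F" "continuous_on {A..B} F" "A \<le> x" "x < y" "y \<le> B"
  shows "F ` {x<..<y} = {F x<..<F y}"
proof (intro set_eqI iffI)
  fix v assume "v \<in> F ` {x<..<y}"
  then show "v \<in> {F x<..<F y}"
    using assms by (auto intro!: strict_mono_onD[OF assms(1)])
next
  fix v assume v: "v \<in> {F x<..<F y}"
  have "continuous_on {x..y} F" using assms by (auto intro: continuous_on_subset)
  then obtain t where t: "x \<le> t" "t \<le> y" "F t = v"
    using IVT'[of F x v y] v assms(4) by auto
  then have "t \<noteq> x" "t \<noteq> y" using v by auto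
  with t show "v \<in> F ` {x<..<y}" by (intro image_eqI[of _ _ t]) auto
qed

lemma bilipschitz_image_open_interval:
  assumes T: "bilipschitz_on L {A..B} T" and "0 < L" "A \<le> x" "x < y" "y \<le> B"
  shows "T ` {x<..<y} = {min (T x) (T y)<..<max (T x) (T y)}"
proof -
  obtain \<epsilon> :: real where \<epsilon>: "\<bar>\<epsilon>\<bar> = 1" "strict_mono_on {A..B} (\<lambda>x. \<epsilon> * T x)" "continuous_on {A..B} (\<lambda>x. \<epsilon> * T x)"
    using bilipschitz_on_interval_monotone[OF T \<open>0 < L\<close>] .
  have im: "(\<lambda>x. \<epsilon> * T x) ` {x<..<y} = {\<epsilon> * T x<..<\<epsilon> * T y}"
    using assms by (intro strict_mono_image_open_interval[OF \<epsilon>(2,3)])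
  have lt: "\<epsilon> * T x < \<epsilon> * T y" using assms by (intro strict_mono_onD[OF \<epsilon>(2)]) auto
  have "\<epsilon> * \<epsilon> = 1" using \<epsilon>(1) by (metis abs_mult_self_eq mult_1)
  then have "T ` {x<..<y} = (\<lambda>v. \<epsilon> * v) ` (\<lambda>x. \<epsilon> * T x) ` {x<..<y}"
    by (simp add: image_image flip: mult.assoc)
  also have "\<dots> = (\<lambda>v. \<epsilon> * v) ` {\<epsilon> * T x<..<\<epsilon> * T y}" by (simp only: im)
  also have "\<dots> = {min (T x) (T y)<..<max (T x) (T y)}"
  proof (cases "\<epsilon> = 1")
    case True
    then show ?thesis using lt by simp
  next
    case False
    then have "\<epsilon> = -1" using \<epsilon>(1) by auto
    then show ?thesis using lt by simp
  qed
  finally show ?thesis .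
qed

section \<open>Telescoping sums and piecewise affine interpolation\<close>

lemma sum_int_telescope:
  fixes f :: "int \<Rightarrow> real"
  assumes "m \<le> n"
  shows "(\<Sum>z\<in>{m..<n}. f (z + 1) - f z) = f n - f m"
  using assms
proof (induction n rule: int_ge_induct)
  case (step i)
  have "{m..<i + 1} = insert i {m..<i}" using step.hyps by auto
  then show ?case using step by simp
qed simp

text \<open>
  As a function of \<open>x\<close>, the value \<open>clamp01 (k * x - z)\<close> climbs from 0 to 1 across the cell \<open>z\<close> and is
  constant on all other cells.
\<close>

definition clamp01 :: "real \<Rightarrow> real" where
  "clamp01 t = max 0 (min 1 t)"

definition affine_interpolation :: "nat \<Rightarrow> int \<Rightarrow> int \<Rightarrow> (real \<Rightarrow> real) \<Rightarrow> real \<Rightarrow> real" where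
  "affine_interpolation k m n T x = T (of_int m / real k) +
     (\<Sum>z\<in>{m..<n}. (T ((of_int z + 1) / real k) - T (of_int z / real k)) * clamp01 (real k * x - of_int z))"

lemma sum_clamp01:
  assumes "m \<le> n" "of_int m \<le> t" "t \<le> of_int n"
  shows "(\<Sum>z\<in>{m..<n}. clamp01 (t - of_int z)) = t - of_int m"
proof -
  have "clamp01 (t - of_int z) = min t (of_int (z + 1)) - min t (of_int z)" for z
    by (auto simp: clamp01_def min_def max_def)
  then show ?thesis
    using sum_int_telescope[OF assms(1), of "\<lambda>z. min t (of_int z)"] assms by simp
qed

text \<open>At a node every clamp is 0 or 1, so exactly the increments to the left of the node
  survive and telescope.\<close>

lemma affine_interpolation_node:
  assumes "0 < k" "m \<le> y" "y \<le> n"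
  shows "affine_interpolation k m n T (of_int y / real k) = T (of_int y / real k)"
proof -
  let ?f = "\<lambda>z::int. T (of_int z / real k)"
  have cl: "clamp01 (real k * (of_int y / real k) - of_int z) = (if z < y then 1 else 0)" for z
    using assms(1) by (auto simp: clamp01_def min_def max_def)
  have "(\<Sum>z\<in>{m..<n}. (T ((of_int z + 1) / real k) - ?f z) * clamp01 (real k * (of_int y / real k) - of_int z))
      = (\<Sum>z\<in>{m..<n}. if z < y then ?f (z + 1) - ?f z else 0)"
    by (intro sum.cong refl) (simp only: cl, simp)
  also have "\<dots> = (\<Sum>z\<in>{z \<in> {m..<n}. z < y}. ?f (z + 1) - ?f z)"
    by (subst sum.inter_filter) auto
  also have "{z \<in> {m..<n}. z < y} = {m..<y}" using assms by auto
  also have "(\<Sum>z\<in>{m..<y}. ?f (z + 1) - ?f z) = ?f y - ?f m" by (rule sum_int_telescope[OF assms(2)])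
  finally show ?thesis by (simp add: affine_interpolation_def)
qed

text \<open>An increment of the interpolation is a combination of the cell increments with
  nonnegative weights \<open>?c z\<close> that sum to \<open>k * (y - x)\<close>. Bounds on the cell
  increments thus carry over directly, without asking which cells contain x and y.\<close>

lemma affine_interpolation_increment:
  assumes "0 < k" "m < n" "0 < l"
    and inc: "\<And>z. z \<in> {m..<n} \<Longrightarrow> 1 / l / real k \<le> \<epsilon> * (T ((of_int z + 1) / real k) - T (of_int z / real k)) \<and>
          \<epsilon> * (T ((of_int z + 1) / real k) - T (of_int z / real k)) \<le> l / real k"
    and xy: "of_int m / real k \<le> x" "x \<le> y" "y \<le> of_int n / real k"
  shows "1 / l * (y - x) \<le> \<epsilon> * (affine_interpolation k m n T y - affine_interpolation k m n T x)"
    and "\<epsilon> * (affine_interpolation k m n T y - affine_interpolation k m n T x) \<le> l * (y - x)"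
proof -
  let ?d = "\<lambda>z. T ((of_int z + 1) / real k) - T (of_int z / real k)"
  let ?c = "\<lambda>z. clamp01 (real k * y - of_int z) - clamp01 (real k * x - of_int z)"
  have "real k * x \<le> real k * y" using xy by (intro mult_left_mono) auto
  then have c: "0 \<le> ?c z" for z by (auto simp: clamp01_def)
  have b: "of_int m \<le> real k * x" "real k * x \<le> of_int n" "of_int m \<le> real k * y" "real k * y \<le> of_int n"
  proof -
    have "real k * (of_int m / real k) \<le> real k * x" "real k * y \<le> real k * (of_int n / real k)"
      using xy by (intro mult_left_mono; simp)+
    then show "of_int m \<le> real k * x" "real k * y \<le> of_int n" using assms(1) by auto
    with \<open>real k * x \<le> real k * y\<close> show "real k * x \<le> of_int n" "of_int m \<le> real k * y" by linarith+
  qed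
  have sc: "(\<Sum>z\<in>{m..<n}. ?c z) = real k * (y - x)"
    using sum_clamp01[OF _ b(1,2)] sum_clamp01[OF _ b(3,4)] assms(2)
    by (simp add: sum_subtractf right_diff_distrib)
  have eq: "\<epsilon> * (affine_interpolation k m n T y - affine_interpolation k m n T x) = (\<Sum>z\<in>{m..<n}. (\<epsilon> * ?d z) * ?c z)"
    unfolding affine_interpolation_def
    by (simp add: sum_subtractf sum_distrib_left algebra_simps flip: sum.distrib)
  have "1 / l * (y - x) = (\<Sum>z\<in>{m..<n}. 1 / l / real k * ?c z)"
    using assms(1) by (simp only: sc flip: sum_distrib_left) simp
  also have "\<dots> \<le> (\<Sum>z\<in>{m..<n}. (\<epsilon> * ?d z) * ?c z)"
    using inc c by (intro sum_mono mult_right_mono) auto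
  finally show "1 / l * (y - x) \<le> \<epsilon> * (affine_interpolation k m n T y - affine_interpolation k m n T x)"
    by (simp only: eq)
  have "(\<Sum>z\<in>{m..<n}. (\<epsilon> * ?d z) * ?c z) \<le> (\<Sum>z\<in>{m..<n}. l / real k * ?c z)"
    using inc c by (intro sum_mono mult_right_mono) auto
  also have "\<dots> = l * (y - x)"
    using assms(1) by (simp only: sc flip: sum_distrib_left) simp
  finally show "\<epsilon> * (affine_interpolation k m n T y - affine_interpolation k m n T x) \<le> l * (y - x)"
    by (simp only: eq)
qed

lemma affine_interpolation_bilipschitz:
  assumes "0 < k" "m < n" "0 < l" "\<bar>\<epsilon>\<bar> = 1"
    and inc: "\<And>z. z \<in> {m..<n} \<Longrightarrow> 1 / l / real k \<le> \<epsilon> * (T ((of_int z + 1) / real k) - T (of_int z / real k)) \<and>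
          \<epsilon> * (T ((of_int z + 1) / real k) - T (of_int z / real k)) \<le> l / real k"
  shows "bilipschitz_on l {of_int m / real k..of_int n / real k} (affine_interpolation k m n T)"
proof -
  let ?S = "affine_interpolation k m n T"
  have *: "1 / l * \<bar>x - y\<bar> \<le> \<bar>?S x - ?S y\<bar> \<and> \<bar>?S x - ?S y\<bar> \<le> l * \<bar>x - y\<bar>"
    if "of_int m / real k \<le> x" "x \<le> y" "y \<le> of_int n / real k" for x y
  proof -
    note i = affine_interpolation_increment[OF assms(1-3) inc that]
    have "0 \<le> 1 / l * (y - x)" using that assms(3) by simp
    with i(1) have "\<bar>\<epsilon> * (?S y - ?S x)\<bar> = \<epsilon> * (?S y - ?S x)" by linarith
    then have "\<bar>?S x - ?S y\<bar> = \<epsilon> * (?S y - ?S x)" using assms(4) by (simp add: abs_mult abs_minus_commute)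
    with i that show ?thesis by (simp add: abs_minus_commute)
  qed
  show ?thesis
    unfolding bilipschitz_on_def
  proof (intro ballI)
    fix x y assume "x \<in> {of_int m / real k..of_int n / real k}" "y \<in> {of_int m / real k..of_int n / real k}"
    then show "1 / l * \<bar>x - y\<bar> \<le> \<bar>?S x - ?S y\<bar> \<and> \<bar>?S x - ?S y\<bar> \<le> l * \<bar>x - y\<bar>"
      using *[of x y] *[of y x] by (cases "x \<le> y") (auto simp: abs_minus_commute)
  qed
qed

section \<open>Bi-Lipschitz constants and cell lengths\<close>

lemma bilipschitz_on_cong:
  "(\<And>x. x \<in> P \<Longrightarrow> S x = T x) \<Longrightarrow> bilipschitz_on l P S \<longleftrightarrow> bilipschitz_on l P T"
  by (simp add: bilipschitz_on_def)

lemma bilip_const_le: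
  assumes "1 \<le> l" "bilipschitz_on l P T"
  shows "bilip_const P T \<le> l"
  unfolding bilip_const_def using assms by (intro cInf_lower bdd_belowI[of _ 1]) auto

lemma bilip_const_ge_1:
  assumes "1 \<le> l" "bilipschitz_on l P T"
  shows "1 \<le> bilip_const P T"
  unfolding bilip_const_def using assms by (intro cInf_greatest) auto

text \<open>For maps in \<open>cell_maps\<close>, which are monotone on the union of the cells, this
  is the length of the image of the cell.\<close>

definition cell_length :: "nat \<Rightarrow> (real \<Rightarrow> real) \<Rightarrow> int \<Rightarrow> real" where
  "cell_length k T z = \<bar>T ((of_int z + 1) / real k) - T (of_int z / real k)\<bar>"

lemma cell_maps_cell:
  assumes "0 < k" "a < b" "0 < L" and I: "cell_indices {a<..<b} k = {m..<n}" and T: "T \<in> cell_maps {a<..<b} L k"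
    and z: "z \<in> {m..<n}"
  obtains c d where "T ` cell k z = {c<..<d}" "c < d" "{c<..<d} \<subseteq> {a<..<b}" "d - c = cell_length k T z"
    "1 / L / real k \<le> d - c" "d - c \<le> L / real k" "c = min (T (of_int z / real k)) (T ((of_int z + 1) / real k))"
    "d = max (T (of_int z / real k)) (T ((of_int z + 1) / real k))"
proof -
  have mn: "m < n" using z by auto
  note P = cell_union_eq[OF \<open>0 < k\<close> I mn]
  let ?x = "of_int z / real k" and ?y = "(of_int z + 1) / real k"
  have T': "bilipschitz_on L {of_int m / real k..of_int n / real k} T"
    "\<And>x. x \<in> {of_int m / real k..of_int n / real k} \<Longrightarrow> T x \<in> {a..b}"
    using T \<open>a < b\<close> by (auto simp: cell_maps_def bilip_maps_def P PiE_def Pi_def)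
  have "(of_int m :: real) \<le> of_int z" "(of_int z :: real) + 1 \<le> of_int n" using z by auto
  then have xy: "of_int m / real k \<le> ?x" "?x < ?y" "?y \<le> of_int n / real k"
    using \<open>0 < k\<close> by (auto intro: divide_right_mono divide_strict_right_mono)
  define c where "c = min (T ?x) (T ?y)"
  define d where "d = max (T ?x) (T ?y)"
  have im: "T ` cell k z = {c<..<d}"
    unfolding cell_eq[OF \<open>0 < k\<close>] c_def d_def by (rule bilipschitz_image_open_interval[OF T'(1) \<open>0 < L\<close> xy])
  have dc: "d - c = cell_length k T z" by (auto simp: c_def d_def cell_length_def)
  have yx: "?y - ?x = 1 / real k" by (simp add: diff_divide_distrib[symmetric])
  have "?x \<in> {of_int m / real k..of_int n / real k}" "?y \<in> {of_int m / real k..of_int n / real k}"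
    using xy by auto
  then have "1 / L * \<bar>?y - ?x\<bar> \<le> cell_length k T z \<and> cell_length k T z \<le> L * \<bar>?y - ?x\<bar>"
    using T'(1) unfolding bilipschitz_on_def cell_length_def by blast
  then have le: "1 / L / real k \<le> d - c" "d - c \<le> L / real k" unfolding yx dc by auto
  have "0 < 1 / L / real k" using \<open>0 < k\<close> \<open>0 < L\<close> by simp
  with le(1) have cd: "c < d" by linarith
  have sub: "{c<..<d} \<subseteq> {a<..<b}"
  proof -
    have "a \<le> c" "d \<le> b" using T'(2)[of ?x] T'(2)[of ?y] xy by (auto simp: c_def d_def)
    then show ?thesis by auto
  qed
  show thesis by (rule that[OF im cd sub dc le c_def d_def])
qed

text \<open>By monotonicity all increments have the sign \<epsilon>, so the lengths telescope to the
  oriented difference of the two end values; surjectivity forces these end values to be a and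
  b.\<close>

lemma onto_cell_maps_length_sum:
  assumes "0 < k" "a < b" "0 < L" and I: "cell_indices {a<..<b} k = {m..<n}" and "m < n"
    and T: "T \<in> onto_cell_maps {a<..<b} L k"
  obtains \<epsilon> :: real where "\<bar>\<epsilon>\<bar> = 1"
    "\<And>z. z \<in> {m..<n} \<Longrightarrow> \<epsilon> * (T ((of_int z + 1) / real k) - T (of_int z / real k)) = cell_length k T z"
    "(\<Sum>z\<in>{m..<n}. cell_length k T z) = b - a"
proof -
  note P = cell_union_eq[OF \<open>0 < k\<close> I \<open>m < n\<close>]
  let ?A = "of_int m / real k" and ?B = "of_int n / real k"
  have T': "bilipschitz_on L {?A..?B} T" "T ` {?A..?B} = {a..b}"
    using T \<open>a < b\<close> by (auto simp: onto_cell_maps_def cell_maps_def bilip_maps_def P)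
  obtain \<epsilon> :: real where \<epsilon>: "\<bar>\<epsilon>\<bar> = 1" "strict_mono_on {?A..?B} (\<lambda>x. \<epsilon> * T x)"
    using bilipschitz_on_interval_monotone[OF T'(1) \<open>0 < L\<close>] .
  have len: "\<epsilon> * (T ((of_int z + 1) / real k) - T (of_int z / real k)) = cell_length k T z" if "z \<in> {m..<n}" for z
  proof -
    have "(of_int m :: real) \<le> of_int z" "(of_int z :: real) + 1 \<le> of_int n" using that by auto
    then have "?A \<le> of_int z / real k" "(of_int z :: real) / real k < (of_int z + 1) / real k" "(of_int z + 1) / real k \<le> ?B"
      using \<open>0 < k\<close> by (auto intro: divide_right_mono divide_strict_right_mono)
    then have "\<epsilon> * T (of_int z / real k) < \<epsilon> * T ((of_int z + 1) / real k)"
      by (intro strict_mono_onD[OF \<epsilon>(2)]) auto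
    then have "\<epsilon> * (T ((of_int z + 1) / real k) - T (of_int z / real k)) = \<bar>\<epsilon> * (T ((of_int z + 1) / real k) - T (of_int z / real k))\<bar>"
      by (simp add: right_diff_distrib)
    also have "\<dots> = cell_length k T z" using \<epsilon>(1) by (simp add: abs_mult cell_length_def)
    finally show ?thesis .
  qed
  have AB: "?A < ?B" using \<open>m < n\<close> \<open>0 < k\<close> by (simp add: divide_strict_right_mono)
  have "(\<Sum>z\<in>{m..<n}. cell_length k T z) = (\<Sum>z\<in>{m..<n}. \<epsilon> * T (of_int (z + 1) / real k) - \<epsilon> * T (of_int z / real k))"
    by (intro sum.cong refl) (simp add: len[symmetric] right_diff_distrib)
  also have "\<dots> = \<epsilon> * T ?B - \<epsilon> * T ?A"
    using sum_int_telescope[of m n "\<lambda>z. \<epsilon> * T (of_int z / real k)"] \<open>m < n\<close> by simp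
  also have "\<dots> = b - a"
  proof -
    have mo: "\<epsilon> * T ?A \<le> \<epsilon> * T x \<and> \<epsilon> * T x \<le> \<epsilon> * T ?B" if "x \<in> {?A..?B}" for x
      using that AB strict_mono_on_leD[OF \<epsilon>(2), of ?A x] strict_mono_on_leD[OF \<epsilon>(2), of x ?B] by auto
    obtain xa xb where x: "xa \<in> {?A..?B}" "T xa = a" "xb \<in> {?A..?B}" "T xb = b"
    proof -
      have "a \<in> T ` {?A..?B}" "b \<in> T ` {?A..?B}" using T'(2) \<open>a < b\<close> by auto
      then show thesis using that by blast
    qed
    have "T ?A \<in> {a..b}" "T ?B \<in> {a..b}" using T'(2) AB by auto
    moreover have "\<epsilon> = 1 \<or> \<epsilon> = -1" using \<epsilon>(1) by auto
    ultimately show ?thesis using mo[OF x(1)] mo[OF x(3)] x(2,4) by auto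
  qed
  finally have "(\<Sum>z\<in>{m..<n}. cell_length k T z) = b - a" .
  with len show thesis by (intro that[OF \<epsilon>(1)])
qed

text \<open>Agreement with T at the nodes fixes the images of the cells, which makes S a competitor
  in the minimization of the bi-Lipschitz constant. For S that constant is governed by the cell
  lengths alone, whereas T may oscillate inside its cells.\<close>

lemma affine_interpolation_cell_map:
  assumes "0 < k" "a < b" "1 < L" and I: "cell_indices {a<..<b} k = {m..<n}" and "m < n"
    and T: "T \<in> onto_cell_maps {a<..<b} L k"
  defines "S \<equiv> restrict (affine_interpolation k m n T) (cell_union {a<..<b} k)"
  shows "S \<in> cell_maps {a<..<b} L k" "\<And>z. z \<in> {m..<n} \<Longrightarrow> S ` cell k z = T ` cell k z"
    "\<And>l. 0 < l \<Longrightarrow> (\<And>z. z \<in> {m..<n} \<Longrightarrow> 1 / l / real k \<le> cell_length k T z \<and> cell_length k T z \<le> l / real k)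
      \<Longrightarrow> bilipschitz_on l (cell_union {a<..<b} k) S"
proof -
  note P = cell_union_eq[OF \<open>0 < k\<close> I \<open>m < n\<close>]
  have L: "0 < L" using \<open>1 < L\<close> by simp
  have Tc: "T \<in> cell_maps {a<..<b} L k" using T by (simp add: onto_cell_maps_def)
  let ?A = "of_int m / real k" and ?B = "of_int n / real k"
  let ?S = "affine_interpolation k m n T"
  obtain \<epsilon> :: real where \<epsilon>: "\<bar>\<epsilon>\<bar> = 1"
    "\<And>z. z \<in> {m..<n} \<Longrightarrow> \<epsilon> * (T ((of_int z + 1) / real k) - T (of_int z / real k)) = cell_length k T z"
    using onto_cell_maps_length_sum[OF \<open>0 < k\<close> \<open>a < b\<close> L I \<open>m < n\<close> T] by blast
  have SS: "S x = ?S x" if "x \<in> {?A..?B}" for x using that by (simp add: S_def P)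
  show bil: "bilipschitz_on l (cell_union {a<..<b} k) S" if "0 < l"
    and "\<And>z. z \<in> {m..<n} \<Longrightarrow> 1 / l / real k \<le> cell_length k T z \<and> cell_length k T z \<le> l / real k" for l
    unfolding P
    using affine_interpolation_bilipschitz[OF \<open>0 < k\<close> \<open>m < n\<close> that(1) \<epsilon>(1), of T] that(2)
      bilipschitz_on_cong[of "{?A..?B}" S ?S l] SS \<epsilon>(2) by auto
  have Lb: "1 / L / real k \<le> cell_length k T z \<and> cell_length k T z \<le> L / real k" if "z \<in> {m..<n}" for z
    by (rule cell_maps_cell[OF \<open>0 < k\<close> \<open>a < b\<close> L I Tc that]) simp
  have bL: "bilipschitz_on L {?A..?B} S" using bil[OF L Lb] by (simp add: P)
  have range: "?S x \<in> {a..b}" if "x \<in> {?A..?B}" for x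
  proof -
    have i: "1 / L / real k \<le> \<epsilon> * (T ((of_int z + 1) / real k) - T (of_int z / real k)) \<and>
          \<epsilon> * (T ((of_int z + 1) / real k) - T (of_int z / real k)) \<le> L / real k" if "z \<in> {m..<n}" for z
      using Lb[OF that] \<epsilon>(2)[OF that] by simp
    have "0 \<le> 1 / L * (x - ?A)" "0 \<le> 1 / L * (?B - x)" using that L by auto
    then have "0 \<le> \<epsilon> * (?S x - ?S ?A)" "0 \<le> \<epsilon> * (?S ?B - ?S x)"
      using affine_interpolation_increment(1)[OF \<open>0 < k\<close> \<open>m < n\<close> L i, of ?A x]
        affine_interpolation_increment(1)[OF \<open>0 < k\<close> \<open>m < n\<close> L i, of x ?B] that by (auto intro: order_trans)
    moreover have "?S ?A = T ?A" "?S ?B = T ?B"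
      using \<open>m < n\<close> by (auto intro: affine_interpolation_node[OF \<open>0 < k\<close>])
    moreover have "T ?A \<in> {a..b}" "T ?B \<in> {a..b}"
      using Tc \<open>a < b\<close> that by (auto simp: cell_maps_def bilip_maps_def P PiE_def Pi_def)
    moreover have "\<epsilon> = 1 \<or> \<epsilon> = -1" using \<epsilon>(1) by auto
    ultimately show ?thesis by auto
  qed
  show Sc: "S \<in> cell_maps {a<..<b} L k"
    using bL range \<open>a < b\<close> by (auto simp: cell_maps_def bilip_maps_def P S_def)
  show "S ` cell k z = T ` cell k z" if z: "z \<in> {m..<n}" for z
  proof -
    have "(of_int m :: real) \<le> of_int z" "(of_int z :: real) + 1 \<le> of_int n" using z by auto
    then have "of_int z / real k \<in> {?A..?B}" "(of_int z + 1) / real k \<in> {?A..?B}"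
      using \<open>0 < k\<close> by (auto intro!: divide_right_mono)
    then have "S (of_int z / real k) = T (of_int z / real k)" "S ((of_int z + 1) / real k) = T ((of_int z + 1) / real k)"
      using SS affine_interpolation_node[OF \<open>0 < k\<close>, of m z n T] affine_interpolation_node[OF \<open>0 < k\<close>, of m "z + 1" n T] z
      by auto
    moreover have "T' ` cell k z = {min (T' (of_int z / real k)) (T' ((of_int z + 1) / real k))<..<
        max (T' (of_int z / real k)) (T' ((of_int z + 1) / real k))}" if "T' \<in> cell_maps {a<..<b} L k" for T'
      by (rule cell_maps_cell[OF \<open>0 < k\<close> \<open>a < b\<close> L I that z]) simp
    ultimately show ?thesis using Sc Tc by simp
  qed
qed

text \<open>The slope is the ratio of the length of \<Omega> to that of the union of the cells.
  Being at least 1 it exceeds \<open>1 / L\<close>, so the binding constraint is the bound by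
  L.\<close>

lemma affine_onto_cell_map:
  assumes "0 < k" "a < b" "1 < L" and I: "cell_indices {a<..<b} k = {m..<n}" and "m < n"
    and s: "1 \<le> (b - a) * real k / of_int (n - m)" "(b - a) * real k / of_int (n - m) \<le> L"
  obtains T where "T \<in> onto_cell_maps {a<..<b} L k"
    "\<And>z. z \<in> {m..<n} \<Longrightarrow> cell_length k T z = (b - a) / of_int (n - m)"
proof -
  note P = cell_union_eq[OF \<open>0 < k\<close> I \<open>m < n\<close>]
  let ?A = "of_int m / real k" and ?B = "of_int n / real k"
  define s where "s = (b - a) * real k / of_int (n - m)"
  define F where "F = (\<lambda>x. a + (x - ?A) * s)"
  define T where "T = restrict F {?A..?B}"
  have s: "1 \<le> s" "s \<le> L" using s by (auto simp: s_def)
  have nm: "(of_int (n - m) :: real) > 0" using \<open>m < n\<close> by simp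
  have FA: "F ?A = a" by (simp add: F_def)
  have FB: "F ?B = b"
  proof -
    have "?B - ?A = of_int (n - m) / real k" by (simp add: diff_divide_distrib)
    then have "(?B - ?A) * s = of_int (n - m) / real k * ((b - a) * real k / of_int (n - m))" by (simp only: s_def)
    also have "\<dots> = b - a" using nm \<open>0 < k\<close> by simp
    finally show ?thesis by (simp add: F_def)
  qed
  have Fd: "F x - F y = s * (x - y)" for x y by (simp add: F_def algebra_simps)
  have im: "F ` {?A..?B} = {a..b}"
  proof (intro set_eqI iffI)
    fix v assume "v \<in> F ` {?A..?B}"
    then obtain x where x: "?A \<le> x" "x \<le> ?B" "v = F x" by auto
    have "0 \<le> s * (x - ?A)" "0 \<le> s * (?B - x)" using x s by auto
    then show "v \<in> {a..b}" using Fd[of x ?A] Fd[of ?B x] FA FB x(3) by auto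
  next
    fix v assume v: "v \<in> {a..b}"
    have AB: "?A \<le> ?B" using \<open>m < n\<close> by (auto intro: divide_right_mono)
    have "continuous_on {?A..?B} F" unfolding F_def by (intro continuous_intros)
    then obtain x where "?A \<le> x" "x \<le> ?B" "F x = v" using IVT'[of F ?A v ?B] v FA FB AB by auto
    then show "v \<in> F ` {?A..?B}" by auto
  qed
  have "bilipschitz_on L {?A..?B} F"
    unfolding bilipschitz_on_def
  proof (intro ballI conjI)
    fix x y
    have "1 / L \<le> 1" using \<open>1 < L\<close> by simp
    then have "1 / L \<le> s" using s by linarith
    moreover have "\<bar>F x - F y\<bar> = s * \<bar>x - y\<bar>" using s by (simp add: Fd abs_mult)
    ultimately show "1 / L * \<bar>x - y\<bar> \<le> \<bar>F x - F y\<bar>" "\<bar>F x - F y\<bar> \<le> L * \<bar>x - y\<bar>"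
      using s by (simp_all only: mult_right_mono abs_ge_zero)
  qed
  then have "bilipschitz_on L {?A..?B} T"
    using bilipschitz_on_cong[of "{?A..?B}" T F] by (simp add: T_def)
  moreover have "T ` {?A..?B} = {a..b}" using im by (simp add: T_def)
  ultimately have "T \<in> onto_cell_maps {a<..<b} L k"
    using \<open>a < b\<close> im by (auto simp: onto_cell_maps_def cell_maps_def bilip_maps_def P T_def)
  moreover have "cell_length k T z = (b - a) / of_int (n - m)" if "z \<in> {m..<n}" for z
  proof -
    have "(of_int m :: real) \<le> of_int z" "(of_int z :: real) + 1 \<le> of_int n" using that by auto
    then have "of_int z / real k \<in> {?A..?B}" "(of_int z + 1) / real k \<in> {?A..?B}"
      using \<open>0 < k\<close> by (auto intro!: divide_right_mono)
    then have "cell_length k T z = \<bar>F ((of_int z + 1) / real k) - F (of_int z / real k)\<bar>"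
      by (simp add: cell_length_def T_def)
    also have "\<dots> = s / real k" using s by (simp add: Fd diff_divide_distrib[symmetric])
    also have "\<dots> = (b - a) / of_int (n - m)" using \<open>0 < k\<close> by (simp add: s_def)
    finally show ?thesis .
  qed
  ultimately show thesis using that by blast
qed

section \<open>Almost equal cell lengths\<close>

text \<open>On (0, L] the second derivative of \<open>x powr (- q)\<close> is at least
  \<open>q * (q + 1) * L powr (- q - 2)\<close>. Subtracting half this constant times the square of
  x leaves a convex function, whose tangent inequality is the claim.\<close>

lemma neg_powr_strong_convexity:
  fixes x y q L :: real
  assumes "0 < q" "0 < x" "x \<le> L" "0 < y" "y \<le> L"
  shows "q * (q + 1) / 2 * L powr (- q - 2) * (y - x)\<^sup>2 \<le> y powr (- q) - x powr (- q) + q * x powr (- q - 1) * (y - x)"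
proof -
  define \<gamma> where "\<gamma> = q * (q + 1) / 2 * L powr (- q - 2)"
  have "(- q * x powr (- q - 1) - 2 * \<gamma> * x) * (y - x) \<le> (y powr (- q) - \<gamma> * y\<^sup>2) - (x powr (- q) - \<gamma> * x\<^sup>2)"
  proof (rule f''_imp_f'[of "{0<..L}" "\<lambda>x. x powr (- q) - \<gamma> * x\<^sup>2" "\<lambda>x. - q * x powr (- q - 1) - 2 * \<gamma> * x"
        "\<lambda>x. - q * ((- q - 1) * x powr (- q - 1 - 1)) - 2 * \<gamma>"])
    show "((\<lambda>x. x powr (- q) - \<gamma> * x\<^sup>2) has_real_derivative - q * x powr (- q - 1) - 2 * \<gamma> * x) (at x)" if "x \<in> {0<..L}" for x
      using that by (auto intro!: derivative_eq_intros)
    show "((\<lambda>x. - q * x powr (- q - 1) - 2 * \<gamma> * x) has_real_derivative - q * ((- q - 1) * x powr (- q - 1 - 1)) - 2 * \<gamma>) (at x)" if "x \<in> {0<..L}" for x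
      using that by (auto intro!: derivative_eq_intros)
    show "0 \<le> - q * ((- q - 1) * x powr (- q - 1 - 1)) - 2 * \<gamma>" if "x \<in> {0<..L}" for x
    proof -
      have "L powr (- q - 2) \<le> x powr (- q - 2)" using that assms(1) by (intro powr_mono2') auto
      then have "q * (q + 1) * L powr (- q - 2) \<le> q * (q + 1) * x powr (- q - 2)"
        using assms(1) by (intro mult_left_mono) auto
      moreover have "- q * ((- q - 1) * x powr (- q - 1 - 1)) = q * (q + 1) * x powr (- q - 2)"
        by (simp add: algebra_simps)
      ultimately show ?thesis by (simp add: \<gamma>_def)
    qed
  qed (use assms in auto)
  then show ?thesis unfolding \<gamma>_def[symmetric] by (simp add: power2_eq_square algebra_simps)
qed

text \<open>Around the mean the linear terms of the convexity estimate sum to zero. Each single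
  square is at most the sum of all squares, which makes the bound uniform over the cells.\<close>

lemma deviation_from_mean:
  fixes s :: "'a \<Rightarrow> real"
  assumes "finite I" "0 < q" "\<And>z. z \<in> I \<Longrightarrow> 0 < s z \<and> s z \<le> L" "0 < m" "m \<le> L"
    and mean: "(\<Sum>z\<in>I. s z) = real (card I) * m" and "z \<in> I"
  shows "q * (q + 1) / 2 * L powr (- q - 2) * (s z - m)\<^sup>2 \<le> (\<Sum>z\<in>I. s z powr (- q)) - real (card I) * m powr (- q)"
proof -
  define \<gamma> where "\<gamma> = q * (q + 1) / 2 * L powr (- q - 2)"
  have "0 \<le> \<gamma>" using assms(2) by (simp add: \<gamma>_def)
  then have "\<gamma> * (s z - m)\<^sup>2 \<le> (\<Sum>z\<in>I. \<gamma> * (s z - m)\<^sup>2)"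
    using assms(1,7) by (intro member_le_sum) auto
  also have "\<dots> \<le> (\<Sum>z\<in>I. s z powr (- q) - m powr (- q) + q * m powr (- q - 1) * (s z - m))"
    unfolding \<gamma>_def using assms by (intro sum_mono neg_powr_strong_convexity) auto
  also have "\<dots> = (\<Sum>z\<in>I. s z powr (- q)) - real (card I) * m powr (- q)
      + q * m powr (- q - 1) * ((\<Sum>z\<in>I. s z) - real (card I) * m)"
    by (simp add: sum.distrib sum_subtractf sum_distrib_left[symmetric])
  finally show ?thesis by (simp add: mean \<gamma>_def)
qed

text \<open>With \<theta> = \<kappa>^(-3/2) and l \<le> L / \<kappa>, the quotient l^2 / \<theta>
  decays like \<kappa>^(-1/2). In the last term \<kappa>^(3p/2) and \<kappa>^(-3(p+1)/2) combine to
  \<kappa>^(-3/2). The constant 17 consists of 16 from the square of 4 * W * l and 1 from the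
  forcing.\<close>

lemma perturbation_bound_le:
  fixes \<kappa> l L W A B p :: real
  assumes "1 \<le> \<kappa>" "0 < l" "l \<le> L / \<kappa>" "0 \<le> W" "0 < p" "0 \<le> A" "sqrt A \<le> 4 * W * l"
    and B: "B \<le> l * (l * (4 * W * l)\<^sup>2) powr ((p + 1) / 2)"
  shows "perturbation_bound p (\<kappa> powr (- 3 / 2)) (W\<^sup>2) l A B
    \<le> 17 * W\<^sup>2 * L\<^sup>2 + L * (16 * W\<^sup>2 * L ^ 3) powr ((p + 1) / 2)"
proof -
  let ?\<theta> = "\<kappa> powr (- 3 / 2)"
  have \<theta>: "0 < ?\<theta>" "1 / ?\<theta> = \<kappa> powr (3 / 2)" using assms(1) by (auto simp: powr_minus_divide)
  have L: "0 < L" "l \<le> L"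
  proof -
    have "0 < L / \<kappa>" using assms(2,3) by linarith
    then show "0 < L" using assms(1) by (simp add: zero_less_divide_iff)
    then have "L / \<kappa> \<le> L" using assms(1) by (simp add: divide_le_eq mult_le_cancel_left1)
    then show "l \<le> L" using assms(3) by linarith
  qed
  have k2: "\<kappa>\<^sup>2 = \<kappa> powr 2" and k3: "\<kappa> ^ 3 = \<kappa> powr 3" using assms(1) by (simp_all add: powr_numeral)
  have lt: "l\<^sup>2 / ?\<theta> \<le> L\<^sup>2"
  proof -
    have "l\<^sup>2 / ?\<theta> \<le> (L / \<kappa>)\<^sup>2 / ?\<theta>" using assms \<theta> by (intro divide_right_mono power_mono) auto
    also have "\<dots> = L\<^sup>2 * (1 / ?\<theta> / \<kappa> powr 2)" using k2 by (simp add: power_divide)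
    also have "1 / ?\<theta> / \<kappa> powr 2 = \<kappa> powr (- 1 / 2)" unfolding \<theta>(2) by (simp flip: powr_diff)
    also have "L\<^sup>2 * \<kappa> powr (- 1 / 2) \<le> L\<^sup>2 * 1"
      using assms(1) powr_mono[of "-1/2" 0 \<kappa>] by (intro mult_left_mono) auto
    finally show ?thesis by simp
  qed
  have "A = (sqrt A)\<^sup>2" using assms by simp
  also have "\<dots> \<le> (4 * W * l)\<^sup>2" using assms by (intro power_mono) auto
  finally have "A \<le> 16 * W\<^sup>2 * l\<^sup>2" by (simp add: power_mult_distrib)
  then have "A / ?\<theta> \<le> 16 * W\<^sup>2 * l\<^sup>2 / ?\<theta>" using \<theta> by (intro divide_right_mono) auto
  also have "\<dots> = 16 * W\<^sup>2 * (l\<^sup>2 / ?\<theta>)" by simp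
  also have "\<dots> \<le> 16 * W\<^sup>2 * L\<^sup>2" using lt by (intro mult_left_mono) auto
  finally have 1: "A / ?\<theta> \<le> 16 * W\<^sup>2 * L\<^sup>2" .
  have "W\<^sup>2 * l\<^sup>2 / (2 * ?\<theta>) = W\<^sup>2 / 2 * (l\<^sup>2 / ?\<theta>)" by simp
  also have "\<dots> \<le> W\<^sup>2 / 2 * L\<^sup>2" using lt by (intro mult_left_mono) auto
  also have "\<dots> \<le> W\<^sup>2 * L\<^sup>2" by (simp add: mult_right_mono)
  finally have 2: "W\<^sup>2 * l\<^sup>2 / (2 * ?\<theta>) \<le> W\<^sup>2 * L\<^sup>2" .
  have "?\<theta> powr (- p) * B \<le> ?\<theta> powr (- p) * (l * (l * (4 * W * l)\<^sup>2) powr ((p + 1) / 2))"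
    using B by (intro mult_left_mono) auto
  also have "l * (4 * W * l)\<^sup>2 = 16 * W\<^sup>2 * l ^ 3" by (simp add: power_mult_distrib power2_eq_square power3_eq_cube)
  also have "?\<theta> powr (- p) * (l * (16 * W\<^sup>2 * l ^ 3) powr ((p + 1) / 2))
      \<le> ?\<theta> powr (- p) * (L * (16 * W\<^sup>2 * (L / \<kappa>) ^ 3) powr ((p + 1) / 2))"
    using assms L by (intro mult_left_mono mult_mono powr_mono2 power_mono) auto
  also have "16 * W\<^sup>2 * (L / \<kappa>) ^ 3 = (16 * W\<^sup>2 * L ^ 3) * \<kappa> powr (- 3)"
    using k3 by (simp add: power_divide powr_minus_divide)
  also have "((16 * W\<^sup>2 * L ^ 3) * \<kappa> powr (- 3)) powr ((p + 1) / 2)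
      = (16 * W\<^sup>2 * L ^ 3) powr ((p + 1) / 2) * \<kappa> powr (- 3 * ((p + 1) / 2))"
    by (simp only: powr_mult powr_powr)
  also have "?\<theta> powr (- p) * (L * ((16 * W\<^sup>2 * L ^ 3) powr ((p + 1) / 2) * \<kappa> powr (- 3 * ((p + 1) / 2))))
      = L * (16 * W\<^sup>2 * L ^ 3) powr ((p + 1) / 2) * (\<kappa> powr (- 3 / 2 * - p) * \<kappa> powr (- 3 * ((p + 1) / 2)))"
    by (simp only: powr_powr mult_ac)
  also have "\<kappa> powr (- 3 / 2 * - p) * \<kappa> powr (- 3 * ((p + 1) / 2)) = \<kappa> powr (- 3 / 2)"
    by (simp add: field_simps flip: powr_add)
  also have "\<dots> \<le> 1" using assms(1) powr_mono[of "-3/2" 0 \<kappa>] by simp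
  finally have 3: "?\<theta> powr (- p) * B \<le> L * (16 * W\<^sup>2 * L ^ 3) powr ((p + 1) / 2) * 1"
    using L by (simp add: mult_left_mono)
  show ?thesis using 1 2 3 unfolding perturbation_bound_def by simp
qed

section \<open>Cell energies uniformly in the map, and the number of cells\<close>

lemma cell_sign_abs: "\<bar>cell_sign z\<bar> = 1"
  by (simp add: cell_sign_def power_int_abs[symmetric])

text \<open>For cells of length at most L / k this quantity dominates the left side of the smallness
  condition in \<open>local_min_small\<close>, uniformly in the cell and in the map.\<close>

lemma eventually_small_cell:
  fixes L W p :: real
  assumes "1 < p" "0 < L"
  shows "eventually (\<lambda>k. (L / real k) powr ((p + 3) / 2) * (1 + 2 * W * L) powr (p - 1) \<le> 1 / 4) sequentially"
proof -
  have "(\<lambda>k. (L / real k) powr ((p + 3) / 2)) \<longlonglongrightarrow> 0"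
  proof -
    have "(\<lambda>k. L / real k) \<longlonglongrightarrow> 0" by real_asymp
    moreover have "eventually (\<lambda>k. 0 \<le> L / real k) sequentially" using assms by (intro always_eventually) auto
    ultimately show ?thesis using assms tendsto_zero_powrI[of "\<lambda>k. L / real k" sequentially "\<lambda>_. (p + 3) / 2" "(p + 3) / 2"]
      by auto
  qed
  then have "(\<lambda>k. (L / real k) powr ((p + 3) / 2) * (1 + 2 * W * L) powr (p - 1)) \<longlonglongrightarrow> 0 * (1 + 2 * W * L) powr (p - 1)"
    by (intro tendsto_intros)
  then have "eventually (\<lambda>k. (L / real k) powr ((p + 3) / 2) * (1 + 2 * W * L) powr (p - 1) < 1 / 4) sequentially"
    by (rule order_tendstoD) simp
  then show ?thesis by (rule eventually_mono) simp
qed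

text \<open>K depends neither on k nor on the cell or the map, so the estimates can be summed over
  cells. Nonemptiness of \<open>unit_levels p\<close> is carried along because it becomes known only
  once a minimax function is at hand.\<close>

lemma uniform_cell_energy:
  assumes ab: "a < b" and p: "1 < p" and w: "w \<in> L2_space {a<..<b}" and L: "1 < L"
    and lm: "local_min_choice {a<..<b} p w k\<Omega> kL ut" and mm: "minimax_choice {a<..<b} p w kL ut us"
  obtains K where "0 \<le> K"
    "eventually (\<lambda>k. \<forall>z\<in>cell_indices {a<..<b} k. \<forall>T\<in>cell_maps {a<..<b} L k. unit_levels p \<noteq> {} \<and>
      (1 - real k powr (- 3 / 2)) powr (mp_rate p) * (Inf (unit_levels p) * cell_length k T z powr (- cell_exponent p)) - K
        \<le> energy {a<..<b} p w (us k z T) \<and>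
      energy {a<..<b} p w (us k z T) \<le>
        (1 - real k powr (- 3 / 2)) powr (- mp_rate p) * (Inf (unit_levels p) * cell_length k T z powr (- cell_exponent p)) + K) sequentially"
proof -
  define W where "W = sqrt (nsq (\<lambda>x. indicator {a<..<b} x * w x))"
  have W: "0 \<le> W" "W\<^sup>2 = nsq (\<lambda>x. indicator {a<..<b} x * w x)" by (auto simp: W_def)
  define K where "K = 17 * W\<^sup>2 * L\<^sup>2 + L * (16 * W\<^sup>2 * L ^ 3) powr ((p + 1) / 2)"
  have "0 \<le> K" using L by (simp add: K_def)
  moreover have "eventually (\<lambda>k. \<forall>z\<in>cell_indices {a<..<b} k. \<forall>T\<in>cell_maps {a<..<b} L k. unit_levels p \<noteq> {} \<and>
      (1 - real k powr (- 3 / 2)) powr (mp_rate p) * (Inf (unit_levels p) * cell_length k T z powr (- cell_exponent p)) - K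
        \<le> energy {a<..<b} p w (us k z T) \<and>
      energy {a<..<b} p w (us k z T) \<le>
        (1 - real k powr (- 3 / 2)) powr (- mp_rate p) * (Inf (unit_levels p) * cell_length k T z powr (- cell_exponent p)) + K) sequentially"
    using eventually_small_cell[OF p less_trans[OF zero_less_one L], of W] eventually_ge_at_top[of "kL L"] eventually_ge_at_top[of 2]
  proof eventually_elim
    case (elim k)
    have k: "0 < k" "1 \<le> real k" "2 \<le> real k" using elim by auto
    show ?case
    proof (intro ballI)
      fix z T assume z: "z \<in> cell_indices {a<..<b} k" and T: "T \<in> cell_maps {a<..<b} L k"
      obtain c d where im: "T ` cell k z = {c<..<d}" and cd: "c < d" "{c<..<d} \<subseteq> {a<..<b}" "d - c = cell_length k T z"
        "d - c \<le> L / real k"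
        by (rule cell_maps_cell[OF k(1) ab _ cell_indices_eq[OF k(1)] T z[unfolded cell_indices_eq[OF k(1)]]])
          (use L in simp)
      have lmz: "is_local_min {a<..<b} p w {c<..<d} (ut k z T)"
        using lm L elim(2) z T unfolding local_min_choice_def is_unique_local_min_def im[symmetric]
        by (meson less_imp_le)
      have mmz: "is_minimax {a<..<b} p w {c<..<d} (cell_sign z) (ut k z T) (us k z T)"
        using mm L elim(2) z T unfolding minimax_choice_def im[symmetric]
        by (meson less_imp_le)
      obtain g where g: "sobolev0 {c<..<d} (ut k z T) g"
        using lmz H10_iff_sobolev0 unfolding is_local_min_def by blast
      have "L / real k \<le> L" using L k by (simp add: divide_le_eq mult_le_cancel_left1)
      then have dL: "d - c \<le> L" using cd(4) by linarith
      have small: "(d - c) powr ((p + 3) / 2) * (1 + 2 * W * (d - c)) powr (p - 1) \<le> 1 / 4"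
      proof -
        have "(d - c) powr ((p + 3) / 2) * (1 + 2 * W * (d - c)) powr (p - 1)
          \<le> (L / real k) powr ((p + 3) / 2) * (1 + 2 * W * L) powr (p - 1)"
          using cd(1,4) dL W(1) p by (intro mult_mono powr_mono2 add_left_mono mult_left_mono) auto
        also have "\<dots> \<le> 1 / 4" using elim(1) L by simp
        finally show ?thesis .
      qed
      note sm = local_min_small[OF lmz g cd(2,1) w p, folded W_def, OF small]
      define \<theta> where "\<theta> = real k powr (- 3 / 2)"
      \<comment> \<open>Strictness is the reason for requiring k to be at least 2: at k = 1 the
        parameter would be 1.\<close>
      have \<theta>: "0 < \<theta>" "\<theta> < 1"
        using k powr_less_mono[of "-3/2" 0 "real k"] by (auto simp: \<theta>_def)
      have "perturbation_bound p \<theta> (W\<^sup>2) (d - c) (nsq g) (pint (p + 1) (ut k z T)) \<le> K"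
        unfolding \<theta>_def K_def using k(2) cd W(1) p sm by (intro perturbation_bound_le) auto
      then show "unit_levels p \<noteq> {} \<and>
        (1 - real k powr (- 3 / 2)) powr (mp_rate p) * (Inf (unit_levels p) * cell_length k T z powr (- cell_exponent p)) - K
          \<le> energy {a<..<b} p w (us k z T) \<and>
        energy {a<..<b} p w (us k z T) \<le>
          (1 - real k powr (- 3 / 2)) powr (- mp_rate p) * (Inf (unit_levels p) * cell_length k T z powr (- cell_exponent p)) + K"
        using minimax_energy_bounds[OF g mmz cell_sign_abs cd(2,1) w p \<theta>, folded W(2)]
        unfolding cd(3)[symmetric] \<theta>_def[symmetric] by linarith
    qed
  qed
  ultimately show thesis by (rule that)
qed

text \<open>Rounding each end of the interval inward to a multiple of 1 / k discards less than one
  cell, so the number of cells lies between \<open>(b - a) * k - 2\<close> and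
  \<open>(b - a) * k\<close>.\<close>

lemma cell_number_bounds:
  assumes "2 < (b - a) * real k"
  shows "\<lceil>real k * a\<rceil> < \<lfloor>real k * b\<rfloor>"
    and "1 \<le> (b - a) * real k / of_int (\<lfloor>real k * b\<rfloor> - \<lceil>real k * a\<rceil>)"
    and "(b - a) * real k / of_int (\<lfloor>real k * b\<rfloor> - \<lceil>real k * a\<rceil>) \<le> (b - a) * real k / ((b - a) * real k - 2)"
proof -
  let ?N = "\<lfloor>real k * b\<rfloor> - \<lceil>real k * a\<rceil>"
  have N: "(b - a) * real k - 2 < of_int ?N" "of_int ?N \<le> (b - a) * real k"
  proof -
    have "(b - a) * real k = real k * b - real k * a" by (simp add: algebra_simps)
    then show "(b - a) * real k - 2 < of_int ?N" "of_int ?N \<le> (b - a) * real k"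
      unfolding of_int_diff by linarith+
  qed
  with assms have pos: "0 < (of_int ?N :: real)" by linarith
  then show "\<lceil>real k * a\<rceil> < \<lfloor>real k * b\<rfloor>" by simp
  show "1 \<le> (b - a) * real k / of_int ?N" using pos N by (simp only: le_divide_eq_1_pos)
  show "(b - a) * real k / of_int ?N \<le> (b - a) * real k / ((b - a) * real k - 2)"
    using pos N assms by (intro divide_left_mono) auto
qed

lemma eventually_onto_cell_maps:
  assumes "a < b" "1 < L"
  shows "eventually (\<lambda>k. 2 < (b - a) * real k \<and> (b - a) * real k / ((b - a) * real k - 2) \<le> L) sequentially"
proof -
  have "(\<lambda>k. (b - a) * real k / ((b - a) * real k - 2)) \<longlonglongrightarrow> 1" "filterlim (\<lambda>k. (b - a) * real k) at_top sequentially"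
    using assms by real_asymp+
  then have "eventually (\<lambda>k. (b - a) * real k / ((b - a) * real k - 2) < L) sequentially"
    "eventually (\<lambda>k. 2 < (b - a) * real k) sequentially"
    using assms by (auto dest: order_tendstoD simp: filterlim_at_top_dense)
  then show ?thesis by eventually_elim auto
qed

text \<open>The first summand is the relative error accumulated over at most \<open>k * l\<close>
  rescaled terms, each at most 1. The second is the additive error, incurred once by each of two
  maps on at most \<open>k * l\<close> cells and measured in units of \<open>k powr q\<close>; C is
  the additive error per cell divided by the level constant.\<close>

definition length_error :: "real \<Rightarrow> real \<Rightarrow> real \<Rightarrow> nat \<Rightarrow> real" where
  "length_error p l C k = real k * l * ((1 - real k powr (- 3 / 2)) powr (- 2 * mp_rate p) - 1)
     + (1 - real k powr (- 3 / 2)) powr (- mp_rate p) * (2 * l * C * real k powr (1 - cell_exponent p))"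

lemma length_error_tendsto_0:
  assumes "1 < p"
  shows "length_error p l C \<longlonglongrightarrow> 0"
proof -
  define R where "R = mp_rate p"
  define e where "e = cell_exponent p - 1"
  have R: "0 < R" using assms by (auto simp: R_def mp_rate_def intro!: add_pos_nonneg mult_nonneg_nonneg)
  have e: "0 < e" using assms by (simp add: e_def cell_exponent_def field_simps)
  \<comment> \<open>The difference is of order k^(-3/2), so the product is of order
    k^(-1/2).\<close>
  have 1: "(\<lambda>k. real k * ((1 - real k powr (- 3 / 2)) powr (- 2 * R) - 1)) \<longlonglongrightarrow> 0"
    using R by real_asymp
  have 2: "(\<lambda>k. (1 - real k powr (- 3 / 2)) powr (- R) * real k powr (- e)) \<longlonglongrightarrow> 0"
    using R e by real_asymp
  have "(\<lambda>k. l * (real k * ((1 - real k powr (- 3 / 2)) powr (- 2 * R) - 1))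
      + 2 * l * C * ((1 - real k powr (- 3 / 2)) powr (- R) * real k powr (- e))) \<longlonglongrightarrow> l * 0 + 2 * l * C * 0"
    by (intro tendsto_intros 1 2)
  then show ?thesis
    by (simp add: length_error_def[abs_def] R_def e_def mult_ac)
qed

text \<open>E and E0 stand for the cell energies of the minimizing map and of the affine map.
  Division by the scale \<open>c * k powr q\<close> turns their comparison into one for sums of
  \<open>(k * \<rho>) powr (- q)\<close>, where the arguments \<open>k * \<rho>\<close> have the
  prescribed mean \<mu>; \<open>deviation_from_mean\<close> then isolates a single cell.\<close>

lemma length_deviation:
  fixes E E0 :: "int \<Rightarrow> real"
  assumes k: "2 \<le> k" and p: "1 < p" and L: "1 < L" and l: "0 < l" and "m < n" and "0 < c" "0 \<le> K"
    and s: "\<And>z. z \<in> {m..<n} \<Longrightarrow> 1 / L / real k \<le> \<rho> z \<and> \<rho> z \<le> L / real k"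
    and sum: "(\<Sum>z\<in>{m..<n}. \<rho> z) = l" and N: "1 \<le> l * real k / of_int (n - m)" "l * real k / of_int (n - m) \<le> L"
    and lower: "\<And>z. z \<in> {m..<n} \<Longrightarrow>
      (1 - real k powr (- 3 / 2)) powr (mp_rate p) * (c * \<rho> z powr (- cell_exponent p)) - K \<le> E z"
    and upper: "\<And>z. z \<in> {m..<n} \<Longrightarrow>
      E0 z \<le> (1 - real k powr (- 3 / 2)) powr (- mp_rate p) * (c * (l / of_int (n - m)) powr (- cell_exponent p)) + K"
    and le: "(\<Sum>z\<in>{m..<n}. E z) \<le> (\<Sum>z\<in>{m..<n}. E0 z)" and z: "z \<in> {m..<n}"
  defines "q \<equiv> cell_exponent p"
  shows "q * (q + 1) / 2 * L powr (- q - 2) * (real k * \<rho> z - l * real k / of_int (n - m))\<^sup>2 \<le> length_error p l (K / c) k"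
proof -
  let ?I = "{m..<n}"
  define N where "N = real_of_int (n - m)"
  define \<theta> where "\<theta> = real k powr (- 3 / 2)"
  define R where "R = mp_rate p"
  define \<mu> where "\<mu> = l * real k / N"
  define X where "X = (\<Sum>z\<in>?I. (real k * \<rho> z) powr (- q))"
  have Np: "0 < N" using \<open>m < n\<close> by (simp add: N_def)
  have card: "real (card ?I) = N" using \<open>m < n\<close> by (simp add: N_def)
  have kp: "0 < real k" using k by simp
  have \<mu>: "1 \<le> \<mu>" "\<mu> \<le> L" using N by (auto simp: \<mu>_def N_def)
  have q: "1 < q" using p by (simp add: q_def cell_exponent_def field_simps)
  have \<theta>: "0 < \<theta>" "\<theta> < 1" using k powr_less_mono[of "-3/2" 0 "real k"] by (auto simp: \<theta>_def)
  have R: "0 \<le> R" using p by (auto simp: R_def mp_rate_def)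
  have Nk: "N \<le> l * real k" using \<mu>(1) Np by (simp add: \<mu>_def)
  have sc: "x powr (- q) = real k powr q * (real k * x) powr (- q)" if "0 \<le> x" for x
  proof -
    have "real k powr q * (real k * x) powr (- q) = (real k powr q * real k powr (- q)) * x powr (- q)"
      using that by (simp add: powr_mult)
    also have "real k powr q * real k powr (- q) = 1" using kp by (simp flip: powr_add)
    finally show ?thesis by simp
  qed
  have sp: "0 < real k * \<rho> z \<and> real k * \<rho> z \<le> L" if "z \<in> ?I" for z
  proof -
    have "0 < 1 / L / real k" using L kp by simp
    then have "0 < \<rho> z" using s[OF that] by linarith
    moreover have "real k * \<rho> z \<le> real k * (L / real k)" using s[OF that] by (intro mult_left_mono) auto
    ultimately show ?thesis using kp by simp
  qed
  have "q * (q + 1) / 2 * L powr (- q - 2) * (real k * \<rho> z - \<mu>)\<^sup>2 \<le> X - N * \<mu> powr (- q)"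
    using deviation_from_mean[of ?I q "\<lambda>z. real k * \<rho> z" L \<mu> z] q sp \<mu> z card Np sum
    by (simp add: X_def sum_distrib_left[symmetric] \<mu>_def mult.commute)
  also have "\<dots> \<le> length_error p l (K / c) k"
  proof -
    define Y where "Y = (1 - \<theta>) powr R"
    have Y: "0 < Y" "(1 - \<theta>) powr (- R) = 1 / Y" "(1 - \<theta>) powr (- 2 * R) = 1 / Y * (1 / Y)"
      using \<theta> powr_add[of "1 - \<theta>" "- R" "- R"] by (auto simp: Y_def powr_minus_divide)
    have "Y \<le> 1" using \<theta> R by (auto simp: Y_def intro: powr_le1)
    define Z where "Z = c * real k powr q"
    have Z: "0 < Z" using \<open>0 < c\<close> kp by (simp add: Z_def)
    have \<rho>p: "0 \<le> \<rho> z" if "z \<in> ?I" for z using sp[OF that] kp by (simp add: zero_less_mult_iff)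
    have "Y * Z * X - N * K = (\<Sum>z\<in>?I. Y * (c * \<rho> z powr (- q)) - K)"
      using card sc[OF \<rho>p] by (simp add: sum_subtractf X_def sum_distrib_left Z_def mult_ac)
    also have "\<dots> \<le> (\<Sum>z\<in>?I. E z)"
      using lower by (intro sum_mono) (simp add: Y_def \<theta>_def R_def q_def)
    also have "\<dots> \<le> (\<Sum>z\<in>?I. E0 z)" by (rule le)
    also have "\<dots> \<le> (\<Sum>z\<in>?I. 1 / Y * (Z * \<mu> powr (- q)) + K)"
    proof (intro sum_mono)
      fix z assume z: "z \<in> ?I"
      have "(l / N) powr (- q) = real k powr q * \<mu> powr (- q)"
        using sc[of "l / N"] l Np by (simp add: \<mu>_def mult.commute)
      then show "E0 z \<le> 1 / Y * (Z * \<mu> powr (- q)) + K"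
        using upper[OF z] unfolding \<theta>_def[symmetric] R_def[symmetric] q_def[symmetric] N_def[symmetric] Y(2)
        by (simp add: Z_def mult.assoc)
    qed
    also have "\<dots> = N * (1 / Y * (Z * \<mu> powr (- q))) + N * K"
      using card by (simp add: distrib_left)
    finally have "Y * Z * X \<le> N * (1 / Y * (Z * \<mu> powr (- q))) + 2 * N * K" by linarith
    then have "Y * Z * X / (Y * Z) \<le> (N * (1 / Y * (Z * \<mu> powr (- q))) + 2 * N * K) / (Y * Z)"
      using Y Z by (intro divide_right_mono) auto
    then have "X \<le> N * (1 / Y * (1 / Y)) * \<mu> powr (- q) + 1 / Y * (2 * N * K / Z)"
      using Y(1) Z by (simp add: add_divide_distrib mult_ac)
    then have "X - N * \<mu> powr (- q) \<le> N * \<mu> powr (- q) * (1 / Y * (1 / Y) - 1) + 1 / Y * (2 * N * K / Z)"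
      by (simp add: algebra_simps)
    \<comment> \<open>Since \<mu> is at least 1, each term of the equal-length sum is at most 1, and
      N is at most \<open>l * k\<close>.\<close>
    also have "N * \<mu> powr (- q) * (1 / Y * (1 / Y) - 1) \<le> (l * real k) * (1 / Y * (1 / Y) - 1)"
    proof (rule mult_right_mono)
      have "\<mu> powr (- q) \<le> 1" using \<mu>(1) q powr_mono[of "- q" 0 \<mu>] by simp
      then have "N * \<mu> powr (- q) \<le> N * 1" using Np by (intro mult_left_mono) auto
      then show "N * \<mu> powr (- q) \<le> l * real k" using Nk by simp
      have "1 \<le> 1 / Y" using \<open>Y \<le> 1\<close> Y(1) by simp
      then have "1 * 1 \<le> 1 / Y * (1 / Y)" using Y(1) by (intro mult_mono) auto
      then show "0 \<le> 1 / Y * (1 / Y) - 1" by simp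
    qed
    also have "1 / Y * (2 * N * K / Z) \<le> 1 / Y * (2 * (l * real k) * K / Z)"
      using Nk Y(1) Z \<open>0 \<le> K\<close> by (intro mult_left_mono divide_right_mono mult_right_mono) auto
    also have "2 * (l * real k) * K / Z = 2 * l * (K / c) * real k powr (1 - q)"
      using kp by (simp add: Z_def powr_diff)
    finally show ?thesis
      unfolding length_error_def \<theta>_def[symmetric] R_def[symmetric] q_def[symmetric] Y(2,3)
      by (simp add: mult_ac)
  qed
  finally show ?thesis by (simp add: \<mu>_def N_def)
qed

text \<open>
  A cell of length \<open>\<rho>\<close> has energy \<open>c * \<rho> powr (- q)\<close> up to a relative error \<open>o(1 / k)\<close> and a bounded
  additive error, so the energy excess of the minimizing map over the affine map is \<open>o(k powr q)\<close>.
\<close>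

lemma energy_minimizing_lengths:
  assumes ab: "a < b" and p: "1 < p" and w: "w \<in> L2_space {a<..<b}" and L: "1 < L"
    and lm: "local_min_choice {a<..<b} p w k\<Omega> kL ut" and mm: "minimax_choice {a<..<b} p w kL ut us"
    and em: "energy_map_choice {a<..<b} p w kL us Tt"
  obtains \<eta> :: "nat \<Rightarrow> real" where "\<eta> \<longlonglongrightarrow> 0"
    "eventually (\<lambda>k. Tt L k \<in> onto_cell_maps {a<..<b} L k \<and>
       (\<forall>z\<in>cell_indices {a<..<b} k. \<bar>real k * cell_length k (Tt L k) z - 1\<bar> \<le> \<eta> k)) sequentially"
proof -
  obtain K where K: "0 \<le> K" and en:
    "eventually (\<lambda>k. \<forall>z\<in>cell_indices {a<..<b} k. \<forall>T\<in>cell_maps {a<..<b} L k. unit_levels p \<noteq> {} \<and>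
      (1 - real k powr (- 3 / 2)) powr (mp_rate p) * (Inf (unit_levels p) * cell_length k T z powr (- cell_exponent p)) - K
        \<le> energy {a<..<b} p w (us k z T) \<and>
      energy {a<..<b} p w (us k z T) \<le>
        (1 - real k powr (- 3 / 2)) powr (- mp_rate p) * (Inf (unit_levels p) * cell_length k T z powr (- cell_exponent p)) + K) sequentially"
    by (rule uniform_cell_energy[OF ab p w L lm mm])
  define c where "c = Inf (unit_levels p)"
  define q where "q = cell_exponent p"
  define \<gamma> where "\<gamma> = q * (q + 1) / 2 * L powr (- q - 2)"
  \<comment> \<open>The square root bounds the distance of a rescaled length from the mean; the
    remaining term bounds the distance of the mean from 1.\<close>
  define \<eta> where "\<eta> = (\<lambda>k. sqrt (length_error p (b - a) (K / c) k / \<gamma>) + ((b - a) * real k / ((b - a) * real k - 2) - 1))"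
  have "0 < q" using p by (simp add: q_def cell_exponent_def)
  then have \<gamma>: "0 < \<gamma>" using L by (simp add: \<gamma>_def)
  have "(\<lambda>k. (b - a) * real k / ((b - a) * real k - 2)) \<longlonglongrightarrow> 1"
    using ab by real_asymp
  then have "\<eta> \<longlonglongrightarrow> sqrt (0 / \<gamma>) + (1 - 1)"
    unfolding \<eta>_def using \<gamma> by (intro tendsto_intros length_error_tendsto_0 p) auto
  then have "\<eta> \<longlonglongrightarrow> 0" by simp
  moreover have "eventually (\<lambda>k. Tt L k \<in> onto_cell_maps {a<..<b} L k \<and>
       (\<forall>z\<in>cell_indices {a<..<b} k. \<bar>real k * cell_length k (Tt L k) z - 1\<bar> \<le> \<eta> k)) sequentially"
    using en eventually_onto_cell_maps[OF ab L] eventually_ge_at_top[of "kL L"] eventually_ge_at_top[of 2]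
  proof eventually_elim
    case (elim k)
    have k: "0 < k" using elim(4) by simp
    have L0: "0 < L" using L by simp
    define m where "m = \<lceil>real k * a\<rceil>"
    define n where "n = \<lfloor>real k * b\<rfloor>"
    have I: "cell_indices {a<..<b} k = {m..<n}" unfolding m_def n_def by (rule cell_indices_eq[OF k])
    note N = cell_number_bounds[of b a k, folded m_def n_def] elim(2)
    have mn: "m < n" and N1: "1 \<le> (b - a) * real k / of_int (n - m)" using N by auto
    have N2: "(b - a) * real k / of_int (n - m) \<le> (b - a) * real k / ((b - a) * real k - 2)" using N by auto
    then have N3: "(b - a) * real k / of_int (n - m) \<le> L" using elim(2) by linarith
    obtain T0 where T0: "T0 \<in> onto_cell_maps {a<..<b} L k"
      "\<And>z. z \<in> {m..<n} \<Longrightarrow> cell_length k T0 z = (b - a) / of_int (n - m)"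
      by (rule affine_onto_cell_map[OF k ab L I mn N1 N3]) (rule that)
    let ?T = "Tt L k"
    have am: "is_arg_min (\<lambda>S. \<Sum>z\<in>{m..<n}. energy {a<..<b} p w (us k z S)) (\<lambda>S. S \<in> onto_cell_maps {a<..<b} L k) ?T"
    proof -
      have "onto_cell_maps {a<..<b} L k \<noteq> {}" "1 \<le> L" using T0(1) L by auto
      then show ?thesis using em elim(3) unfolding energy_map_choice_def I[symmetric] by blast
    qed
    then have T: "?T \<in> onto_cell_maps {a<..<b} L k"
      and le: "(\<Sum>z\<in>{m..<n}. energy {a<..<b} p w (us k z ?T)) \<le> (\<Sum>z\<in>{m..<n}. energy {a<..<b} p w (us k z T0))"
      using T0(1) by (auto simp: is_arg_min_def not_less)
    have cm: "?T \<in> cell_maps {a<..<b} L k" "T0 \<in> cell_maps {a<..<b} L k"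
      using T T0(1) by (auto simp: onto_cell_maps_def)
    \<comment> \<open>Some cell exists, which gives access to a minimax function and thereby to
      nonemptiness of the set of levels.\<close>
    have "m \<in> {m..<n}" using mn by simp
    then have ne: "unit_levels p \<noteq> {}" using elim(1) cm(1) I by blast
    have "0 < 1 / 2 - 1 / (p + 1)" using p by (simp add: field_simps)
    also have "\<dots> \<le> c" unfolding c_def using ne unit_levels_lower_bound[OF p] by (intro cInf_greatest)
    finally have c: "0 < c" .
    have sum: "(\<Sum>z\<in>{m..<n}. cell_length k ?T z) = b - a"
      by (rule onto_cell_maps_length_sum[OF k ab L0 I mn T]) simp
    have dev: "\<gamma> * (real k * cell_length k ?T z - (b - a) * real k / of_int (n - m))\<^sup>2 \<le> length_error p (b - a) (K / c) k"
      if z: "z \<in> {m..<n}" for z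
      unfolding \<gamma>_def q_def
    proof (rule length_deviation[OF elim(4) p L _ mn c K _ sum N1 N3 _ _ le z])
      fix z assume z: "z \<in> {m..<n}"
      show "1 / L / real k \<le> cell_length k ?T z \<and> cell_length k ?T z \<le> L / real k"
        by (rule cell_maps_cell[OF k ab L0 I cm(1) z]) simp
      show "(1 - real k powr (- 3 / 2)) powr (mp_rate p) * (c * cell_length k ?T z powr (- cell_exponent p)) - K
          \<le> energy {a<..<b} p w (us k z ?T)"
        using elim(1) z I cm(1) unfolding c_def by blast
      show "energy {a<..<b} p w (us k z T0) \<le>
          (1 - real k powr (- 3 / 2)) powr (- mp_rate p) * (c * ((b - a) / of_int (n - m)) powr (- cell_exponent p)) + K"
        unfolding T0(2)[OF z, symmetric] using elim(1) z I cm(2) unfolding c_def by blast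
    qed (use ab in simp)
    have "\<bar>real k * cell_length k ?T z - 1\<bar> \<le> \<eta> k" if z: "z \<in> {m..<n}" for z
    proof -
      have "(real k * cell_length k ?T z - (b - a) * real k / of_int (n - m))\<^sup>2 \<le> length_error p (b - a) (K / c) k / \<gamma>"
        using dev[OF z] \<gamma> by (simp only: pos_le_divide_eq mult.commute)
      from real_sqrt_le_mono[OF this]
      have "\<bar>real k * cell_length k ?T z - (b - a) * real k / of_int (n - m)\<bar> \<le> sqrt (length_error p (b - a) (K / c) k / \<gamma>)"
        by simp
      then show ?thesis using N1 N2 unfolding \<eta>_def by linarith
    qed
    then show ?case using T I by simp
  qed
  ultimately show thesis by (rule that)
qed

section \<open>Convergence of the optimal bi-Lipschitz constants\<close>

theorem lemma2p9:
  fixes \<Omega> :: "real set" and p :: real and w :: "real \<Rightarrow> real"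
  assumes "\<Omega> \<noteq> {}" and "open \<Omega>" and "bounded \<Omega>" and "is_interval \<Omega>"
    and "1 < p" and "w \<in> L2_space \<Omega>"
  shows "(\<forall>L>1. \<exists>kbar\<ge>1. \<forall>k\<ge>kbar. onto_cell_maps \<Omega> L k \<noteq> {}) \<and>
    (\<forall>k\<Omega> kL ut us Tt T.
       threshold_choice \<Omega> k\<Omega> \<longrightarrow>
       local_min_choice \<Omega> p w k\<Omega> kL ut \<longrightarrow>
       minimax_choice \<Omega> p w kL ut us \<longrightarrow>
       energy_map_choice \<Omega> p w kL us Tt \<longrightarrow>
       optimal_map_choice \<Omega> kL Tt T \<longrightarrow>
       (\<forall>L>1. (\<lambda>k. bilip_const (cell_union \<Omega> k) (T L k)) \<longlonglongrightarrow> 1))"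
proof -
  obtain a b where ab: "a < b" and \<Omega>: "\<Omega> = {a<..<b}"
    using open_interval_eq[OF assms(1-4)] .
  have w: "w \<in> L2_space {a<..<b}" using assms(6) by (simp add: \<Omega>)
  show ?thesis
    unfolding \<Omega>
  proof (intro conjI allI impI)
    fix L :: real assume L: "1 < L"
    obtain k0 where k0: "\<And>k. k0 \<le> k \<Longrightarrow> 2 < (b - a) * real k \<and> (b - a) * real k / ((b - a) * real k - 2) \<le> L"
      using eventually_onto_cell_maps[OF ab L] unfolding eventually_sequentially by blast
    have "onto_cell_maps {a<..<b} L k \<noteq> {}" if "max 1 k0 \<le> k" for k
    proof -
      have k: "0 < k" using that by simp
      note N = cell_number_bounds[of b a k] k0[of k]
      have "(b - a) * real k / of_int (\<lfloor>real k * b\<rfloor> - \<lceil>real k * a\<rceil>) \<le> L" using N that by linarith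
      then show ?thesis
        using affine_onto_cell_map[OF k ab L cell_indices_eq[OF k]] N that by (metis empty_iff max.boundedE)
    qed
    then show "\<exists>kbar\<ge>1. \<forall>k\<ge>kbar. onto_cell_maps {a<..<b} L k \<noteq> {}" by (intro exI[of _ "max 1 k0"]) auto
  next
    fix k\<Omega> kL ut us Tt T and L :: real
    assume lm: "local_min_choice {a<..<b} p w k\<Omega> kL ut" and mm: "minimax_choice {a<..<b} p w kL ut us"
      and em: "energy_map_choice {a<..<b} p w kL us Tt" and om: "optimal_map_choice {a<..<b} kL Tt T" and L: "1 < L"
    obtain \<eta> :: "nat \<Rightarrow> real" where \<eta>: "\<eta> \<longlonglongrightarrow> 0" and ev:
      "eventually (\<lambda>k. Tt L k \<in> onto_cell_maps {a<..<b} L k \<and>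
       (\<forall>z\<in>cell_indices {a<..<b} k. \<bar>real k * cell_length k (Tt L k) z - 1\<bar> \<le> \<eta> k)) sequentially"
      by (rule energy_minimizing_lengths[OF ab assms(5) w L lm mm em])
    have bounds: "eventually (\<lambda>k. 1 \<le> bilip_const (cell_union {a<..<b} k) (T L k) \<and>
        bilip_const (cell_union {a<..<b} k) (T L k) \<le> 1 / (1 - \<eta> k)) sequentially"
      using ev order_tendstoD(2)[OF \<eta> zero_less_one] eventually_onto_cell_maps[OF ab L]
        eventually_ge_at_top[of "kL L"] eventually_ge_at_top[of 1]
    proof eventually_elim
      case (elim k)
      have k: "0 < k" using elim(5) by simp
      define m where "m = \<lceil>real k * a\<rceil>"
      define n where "n = \<lfloor>real k * b\<rfloor>"
      have I: "cell_indices {a<..<b} k = {m..<n}" unfolding m_def n_def by (rule cell_indices_eq[OF k])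
      have mn: "m < n" using cell_number_bounds(1)[of b a k] elim(3) by (simp add: m_def n_def)
      have Tt: "Tt L k \<in> onto_cell_maps {a<..<b} L k" using elim(1) by simp
      define S where "S = restrict (affine_interpolation k m n (Tt L k)) (cell_union {a<..<b} k)"
      note S = affine_interpolation_cell_map[OF k ab L I mn Tt, folded S_def]
      have "is_arg_min (bilip_const (cell_union {a<..<b} k))
          (\<lambda>S. S \<in> cell_maps {a<..<b} L k \<and> (\<forall>z\<in>{m..<n}. S ` cell k z = Tt L k ` cell k z)) (T L k)"
      proof -
        have "onto_cell_maps {a<..<b} L k \<noteq> {}" "1 \<le> L" using Tt L by auto
        then show ?thesis using om elim(4) unfolding optimal_map_choice_def I[symmetric] by blast
      qed
      then have T: "T L k \<in> cell_maps {a<..<b} L k"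
        and le: "bilip_const (cell_union {a<..<b} k) (T L k) \<le> bilip_const (cell_union {a<..<b} k) S"
        using S(1,2) unfolding is_arg_min_def not_less[symmetric] by blast+
      \<comment> \<open>With this choice 1 / l is exactly 1 - \<eta>, and 1 + \<eta> \<le> l because
        (1 + \<eta>) * (1 - \<eta>) \<le> 1, so one constant serves both sides.\<close>
      define l where "l = 1 / (1 - \<eta> k)"
      \<comment> \<open>Any existing cell certifies this, since an absolute value lies below
        \<open>\<eta> k\<close>.\<close>
      have "0 \<le> \<eta> k" using elim(1) mn I by (force intro: order_trans[OF abs_ge_zero])
      then have l: "1 \<le> l" using elim(2) by (simp add: l_def)
      have "bilipschitz_on l (cell_union {a<..<b} k) S"
      proof (rule S(3))
        fix z assume "z \<in> {m..<n}"
        then have "\<bar>real k * cell_length k (Tt L k) z - 1\<bar> \<le> \<eta> k" using elim(1) I by blast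
        then have 1: "1 - \<eta> k \<le> real k * cell_length k (Tt L k) z" "real k * cell_length k (Tt L k) z \<le> 1 + \<eta> k"
          by linarith+
        have "(1 + \<eta> k) * (1 - \<eta> k) \<le> 1" by (simp add: algebra_simps)
        then have "1 + \<eta> k \<le> l" using elim(2) by (simp add: l_def pos_le_divide_eq)
        moreover have "1 / l = 1 - \<eta> k" by (simp add: l_def)
        ultimately show "1 / l / real k \<le> cell_length k (Tt L k) z \<and> cell_length k (Tt L k) z \<le> l / real k"
          using 1 k by (simp add: pos_divide_le_eq pos_le_divide_eq mult.commute)
      qed (use l in simp)
      then have "bilip_const (cell_union {a<..<b} k) S \<le> l" by (rule bilip_const_le[OF l])
      \<comment> \<open>The infimum defining \<open>bilip_const\<close> runs over a nonempty set, as
        L belongs to it.\<close>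
      moreover have "1 \<le> bilip_const (cell_union {a<..<b} k) (T L k)"
        using T L by (intro bilip_const_ge_1[of L]) (auto simp: cell_maps_def bilip_maps_def)
      ultimately show ?case using le by (simp add: l_def)
    qed
    have "(\<lambda>k. 1 / (1 - \<eta> k)) \<longlonglongrightarrow> 1 / (1 - 0)" by (intro tendsto_intros \<eta>) simp
    then have lim: "(\<lambda>k. 1 / (1 - \<eta> k)) \<longlonglongrightarrow> 1" by simp
    show "(\<lambda>k. bilip_const (cell_union {a<..<b} k) (T L k)) \<longlonglongrightarrow> 1"
      by (rule tendsto_sandwich[OF _ _ tendsto_const lim]) (use bounds in \<open>auto elim: eventually_mono\<close>)
  qed
qed

end
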